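(* For all $S\in\mathfrak S$, the following are equivalent. (a) There exists a preprojective $k(\Gamma,\Lambda)$-module $M$ satisfying $S\sim S_M$. (b) The word $w(S)\in\mathcal W$ is reduced. If $S\ne\emptyset$, let $S=T_1\vee\dots\vee T_l$ (up to $\sim$) where $T_i\in\mathfrak P$ for all $i$ and $l$ is the smallest possible (such an expression always exists). Then either of (a), (b) is equivalent to the following condition. (c) For $0<i\le l$, the word $w(T_i)\in\mathcal W$ is reduced.
   Context: $k$ is an arbitrary field and $\Gamma=(\Gamma_0,\Gamma_1)$ is a finite connected graph (multiple edges allowed) without loops and with more than one vertex. An orientation $\Lambda$ on $\Gamma$ chooses for each edge a starting point and an endpoint among its incident vertices, giving a quiver $(\Gamma,\Lambda)$; all orientations are assumed to have no oriented cycles. $\Gamma_0$ is a poset $(\Gamma_0,\Lambda)$ with $x\le y$ iff there is a path (possibly of length $0$) from $x$ to $y$. A sink is a vertex at which no arrow starts. $\sigma_x\Lambda$ is the orientation obtained by reversing all arrows incident with $x$. A finite sequence $S=x_1,\dots,x_s$ of vertices ($s\ge 0$) is (+)-admissible on $(\Gamma,\Lambda)$ if $x_1$ is a sink for $\Lambda$, $x_2$ is a sink for $\sigma_{x_1}\Lambda$, and so on; put $\Lambda^S=\sigma_{x_s}\cdots\sigma_{x_1}\Lambda$. $\mathfrak S$ is the set of (+)-admissible sequences on $(\Gamma,\Lambda)$. $\sim$ is the equivalence relation on $\mathfrak S$ generated by interchanging two consecutive terms $x_i,x_{i+1}$ that are not connected by an edge of $\Gamma$. For $S,T\in\mathfrak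 S$, $S\preccurlyeq T$ ($S$ is a subsequence of $T$) means $T\sim SU$ (concatenation) for some (+)-admissible sequence $U$ on $(\Gamma,\Lambda^S)$. $\mathrm{Supp}\,S$ is the set of vertices occurring in $S$. Canonical form: every nonempty $S\in\mathfrak S$ satisfies $S\sim S_1\cdots S_r$ where each segment $S_i$ is nonempty, consists of distinct vertices, and $\mathrm{Supp}\,S_i=\mathrm{Supp}\,S_iS_{i+1}\cdots S_r$; $r$ (the size) and the segments up to equivalence are determined by $S$. Join: if $S,T$ are nonempty with canonical forms $S_1\cdots S_r$, $T_1\cdots T_q$, $r\le q$, then $S\vee T$ is the (unique up to $\sim$) sequence in $\mathfrak S$ with canonical form $R_1\cdots R_q$, where $\mathrm{Supp}\,R_i=\mathrm{Supp}\,S_i\cup\mathrm{Supp}\,T_i$ for $i\le r$ and $\mathrm{Supp}\,R_i=\mathrm{Supp}\,T_i$ for $r<i\le q$; also $S\vee\emptyset=S$ for the empty sequence $\emptyset$. A filter of $(\Gamma_0,\Lambda)$ is an up-closed subset; the principal filter generated by $x$ is $\langle x\rangle=\{y: x\le y\}$. The hull $H_\Lambda(F)$ of a filter $F$ is the smallest filter containing $F$ and every vertex connected by an edge to a vertex in $F$. A nonempty $S\in\mathfrak S$ with canonical form $S_1\cdots S_r$ is principal if $\mathrm{Supp}\,S_i=H_\Lambda(\mathrm{Supp}\,S_{i+1})$ for $0<i<r$ and $\mathrm{Supp}\,S_r$ is a principal filter; $\mathfrak P$ is the set of principal sequences. $k(\Gamma,\Lambda)$-modules are finite-dimensional left modules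 over the path algebra, identified with finite-dimensional representations $(V,f)$ of $(\Gamma,\Lambda)$ over $k$. For a sink $x$ of $(\Gamma,\Lambda)$, the positive reflection functor $F_x^+$ from $k(\Gamma,\Lambda)$-modules to $k(\Gamma,\sigma_x\Lambda)$-modules sends $(V,f)$ to $(W,g)$ with $W(z)=V(z)$ for $z\ne x$ and $W(x)=\ker\big(h:\bigoplus_i V(y_i)\to V(x)\big)$, where $a_i:y_i\to x$ are all the arrows ending at $x$ and $h$ is induced by the $f_{a_i}$; $g$ agrees with $f$ on arrows not incident with $x$, and for the reversed arrows $x\to y_i$ the maps $W(x)\to V(y_i)$ are induced by the inclusion $W(x)\subset\bigoplus_i V(y_i)$; on morphisms $F_x^+$ is defined naturally. For $S=x_1,\dots,x_s$ in $\mathfrak S$, $F(S)=F^+_{x_s}\cdots F^+_{x_1}$ (the identity if $S=\emptyset$); $S$ annihilates $M$ if $F(S)M=0$. $M$ is preprojective if some $S\in\mathfrak S$ annihilates it. A shortest sequence annihilating $M$ is an $S\in\mathfrak S$ that annihilates $M$ while no proper subsequence of $S$ (no $S'\preccurlyeq S$ with $S'\not\sim S$) annihilates $M$; for each preprojective $M$ such a sequence exists and is unique up to $\sim$, and it is denoted $S_M$. Weyl group: $\Gamma_0=\{1,\dots,n\}$; put $a_{ii}=2$ and, for $i\ne j$, $-a_{ij}=$ the number of edges connecting $i$ and $j$. With $e_1,\dots,e_n$ the standard basis of $\mathbb Z^n$, let $\sigma_i$ be the automorphism of $\mathbb Z^n$ with $\sigma_i(e_j)=e_j-a_{ij}e_i$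 for all $j$; $\mathcal W\subset GL(\mathbb Z^n)$ is the group generated by the simple reflections $\sigma_1,\dots,\sigma_n$. The length $\ell(w)$ of $w\in\mathcal W$ is the least $l\ge0$ such that $w$ is a product of $l$ simple reflections; a word $\sigma_{y_t}\cdots\sigma_{y_1}$ is reduced if its length as an element is $t$. For $S=x_1,\dots,x_s$ in $\mathfrak S$, $w(S)=\sigma_{x_s}\cdots\sigma_{x_1}$. *)

theory Defs
  imports
    "Graph_Theory.Digraph_Component"
    "HOL-Library.Function_Algebras"
    "HOL-Library.Poly_Mapping"
begin

section \<open>Graphs, orientations and admissible sequences\<close>

text \<open>
  A pair consisting of a loopless finite multigraph and an orientation is a loopless finite
  digraph with multiple arcs: the arcs are the edges, and the orientation is recorded by
  \<^const>\<open>tail\<close> (starting point) and \<^const>\<open>head\<close> (endpoint).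
  \<^const>\<open>Digraph_Component.connected\<close> refers to the underlying undirected graph.
\<close>

definition acyclic_quiver :: "('v, 'e) pre_digraph \<Rightarrow> bool" where
  "acyclic_quiver G \<longleftrightarrow> fin_digraph G \<and> loopfree_digraph G \<and> Digraph_Component.connected G \<and>
     card (verts G) > 1 \<and> (\<nexists>p. pre_digraph.cycle G p)"

definition edges_between :: "('v, 'e) pre_digraph \<Rightarrow> 'v \<Rightarrow> 'v \<Rightarrow> 'e set" where
  "edges_between G x y = {a \<in> arcs G. {tail G a, head G a} = {x, y}}"

definition sink :: "('v, 'e) pre_digraph \<Rightarrow> 'v \<Rightarrow> bool" where
  "sink G x \<longleftrightarrow> x \<in> verts G \<and> out_arcs G x = {}"

definition reverse_at :: "'v \<Rightarrow> ('v, 'e) pre_digraph \<Rightarrow> ('v, 'e) pre_digraph" where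
  "reverse_at x G = G\<lparr>
     tail := (\<lambda>a. if a \<in> in_arcs G x \<union> out_arcs G x then head G a else tail G a),
     head := (\<lambda>a. if a \<in> in_arcs G x \<union> out_arcs G x then tail G a else head G a)\<rparr>"

fun admissible :: "('v, 'e) pre_digraph \<Rightarrow> 'v list \<Rightarrow> bool" where
  "admissible G [] \<longleftrightarrow> True"
| "admissible G (x # xs) \<longleftrightarrow> sink G x \<and> admissible (reverse_at x G) xs"

definition reverse_along :: "'v list \<Rightarrow> ('v, 'e) pre_digraph \<Rightarrow> ('v, 'e) pre_digraph" where
  "reverse_along S G = fold reverse_at S G"

inductive swap_step :: "('v, 'e) pre_digraph \<Rightarrow> 'v list \<Rightarrow> 'v list \<Rightarrow> bool" for G where
  "\<lbrakk>admissible G (U @ [x, y] @ W); admissible G (U @ [y, x] @ W); edges_between G x y = {}\<rbrakk>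
   \<Longrightarrow> swap_step G (U @ [x, y] @ W) (U @ [y, x] @ W)"

definition seq_equiv :: "('v, 'e) pre_digraph \<Rightarrow> 'v list \<Rightarrow> 'v list \<Rightarrow> bool" where
  "seq_equiv G S T \<longleftrightarrow> admissible G S \<and> admissible G T \<and> equivclp (swap_step G) S T"

definition subsequence :: "('v, 'e) pre_digraph \<Rightarrow> 'v list \<Rightarrow> 'v list \<Rightarrow> bool" where
  "subsequence G S T \<longleftrightarrow> admissible G S \<and> admissible G T \<and>
     (\<exists>U. admissible (reverse_along S G) U \<and> seq_equiv G T (S @ U))"


section \<open>Canonical forms, joins and principal sequences\<close>

text \<open>The segments of a canonical form are listed from left to right.\<close>

definition canonical_form :: "('v, 'e) pre_digraph \<Rightarrow> 'v list \<Rightarrow> 'v list list \<Rightarrow> bool" where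
  "canonical_form G S Ss \<longleftrightarrow> seq_equiv G S (concat Ss) \<and>
     (\<forall>i < length Ss. Ss ! i \<noteq> [] \<and> distinct (Ss ! i) \<and> set (Ss ! i) = set (concat (drop i Ss)))"

definition segment_supp :: "'v list list \<Rightarrow> nat \<Rightarrow> 'v set" where
  "segment_supp Ss i = (if i < length Ss then set (Ss ! i) else {})"

text \<open>
  Joins, canonical forms and shortest annihilating sequences are only determined up to
  \<^const>\<open>seq_equiv\<close>, so they are given as relations.  Segments beyond the size of the shorter of
  two sequences count as empty, which covers both orders of the two sizes.
\<close>

definition is_join :: "('v, 'e) pre_digraph \<Rightarrow> 'v list \<Rightarrow> 'v list \<Rightarrow> 'v list \<Rightarrow> bool" where
  "is_join G S T R \<longleftrightarrow>
     (if T = [] then seq_equiv G R S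
      else if S = [] then seq_equiv G R T
      else \<exists>Ss Ts Rs. canonical_form G S Ss \<and> canonical_form G T Ts \<and> canonical_form G R Rs \<and>
             length Rs = max (length Ss) (length Ts) \<and>
             (\<forall>i < length Rs. set (Rs ! i) = segment_supp Ss i \<union> segment_supp Ts i))"

fun is_join_list :: "('v, 'e) pre_digraph \<Rightarrow> 'v list list \<Rightarrow> 'v list \<Rightarrow> bool" where
  "is_join_list G [] R \<longleftrightarrow> seq_equiv G R []"
| "is_join_list G [T] R \<longleftrightarrow> seq_equiv G R T"
| "is_join_list G (T # T' # Ts) R \<longleftrightarrow> (\<exists>Q. is_join_list G (T' # Ts) Q \<and> is_join G T Q R)"

definition up_set :: "('v, 'e) pre_digraph \<Rightarrow> 'v set \<Rightarrow> bool" where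
  "up_set G F \<longleftrightarrow> F \<subseteq> verts G \<and> (\<forall>x \<in> F. \<forall>y. x \<rightarrow>\<^sup>*\<^bsub>G\<^esub> y \<longrightarrow> y \<in> F)"

definition principal_up_set :: "('v, 'e) pre_digraph \<Rightarrow> 'v \<Rightarrow> 'v set" where
  "principal_up_set G x = {y. x \<rightarrow>\<^sup>*\<^bsub>G\<^esub> y}"

definition filter_hull :: "('v, 'e) pre_digraph \<Rightarrow> 'v set \<Rightarrow> 'v set" where
  "filter_hull G F = \<Inter> {F'. up_set G F' \<and> F \<subseteq> F' \<and>
                      (\<forall>x \<in> F. \<forall>y. edges_between G x y \<noteq> {} \<longrightarrow> y \<in> F')}"

definition principal_seq :: "('v, 'e) pre_digraph \<Rightarrow> 'v list \<Rightarrow> bool" where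
  "principal_seq G S \<longleftrightarrow> admissible G S \<and> S \<noteq> [] \<and>
     (\<exists>Ss. canonical_form G S Ss \<and>
           (\<forall>i. Suc i < length Ss \<longrightarrow> set (Ss ! i) = filter_hull G (set (Ss ! Suc i))) \<and>
           (\<exists>x \<in> verts G. set (last Ss) = principal_up_set G x))"

definition principal_join_expr :: "('v, 'e) pre_digraph \<Rightarrow> 'v list \<Rightarrow> 'v list list \<Rightarrow> bool" where
  "principal_join_expr G S Ts \<longleftrightarrow> (\<forall>T \<in> set Ts. principal_seq G T) \<and> is_join_list G Ts S"

definition minimal_principal_join_expr ::
    "('v, 'e) pre_digraph \<Rightarrow> 'v list \<Rightarrow> 'v list list \<Rightarrow> bool" where
  "minimal_principal_join_expr G S Ts \<longleftrightarrow> principal_join_expr G S Ts \<and>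
     (\<forall>Ts'. principal_join_expr G S Ts' \<longrightarrow> length Ts \<le> length Ts')"


section \<open>Representations and reflection functors\<close>

text \<open>
  The space at each vertex is a finite-dimensional subspace of one fixed infinite-dimensional
  coordinate space.  Every finite-dimensional space is isomorphic to such a subspace, so up to
  isomorphism all finite-dimensional representations occur.  The coordinates are
  indexed by pairs of a list of arcs and a number so that finite direct sums indexed by arcs can
  be formed inside the same space: the coordinate \<open>(p, n)\<close> of the \<open>a\<close>-th component of \<open>u\<close> is the
  coordinate \<open>(a # p, n)\<close> of \<open>u\<close>.
\<close>

type_synonym ('e, 'k) coord_vec = "'e list \<times> nat \<Rightarrow> 'k"

definition coord_scale :: "'k::field \<Rightarrow> ('e, 'k) coord_vec \<Rightarrow> ('e, 'k) coord_vec" where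
  "coord_scale c u = (\<lambda>i. c * u i)"

interpretation coord: vector_space "coord_scale :: 'k::field \<Rightarrow> ('e, 'k) coord_vec \<Rightarrow> _"
  by unfold_locales (simp_all add: coord_scale_def fun_eq_iff algebra_simps)

definition findim_subspace :: "('e, 'k::field) coord_vec set \<Rightarrow> bool" where
  "findim_subspace V \<longleftrightarrow> coord.subspace V \<and> (\<exists>B. finite B \<and> V = coord.span B)"

definition linear_between :: "('e, 'k::field) coord_vec set \<Rightarrow> ('e, 'k) coord_vec set \<Rightarrow>
    (('e, 'k) coord_vec \<Rightarrow> ('e, 'k) coord_vec) \<Rightarrow> bool" where
  "linear_between V W f \<longleftrightarrow> f ` V \<subseteq> W \<and> (\<forall>u \<in> V. \<forall>v \<in> V. f (u + v) = f u + f v) \<and>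
     (\<forall>c. \<forall>u \<in> V. f (coord_scale c u) = coord_scale c (f u))"

text \<open>
  Only the values of \<open>space\<close> on vertices, of \<open>arrow_map\<close> on arcs, and of \<open>arrow_map M a\<close> on the
  space at the tail of \<open>a\<close> are meaningful.
\<close>

record ('v, 'e, 'k) quiver_rep =
  space :: "'v \<Rightarrow> ('e, 'k) coord_vec set"
  arrow_map :: "'e \<Rightarrow> ('e, 'k) coord_vec \<Rightarrow> ('e, 'k) coord_vec"

definition is_rep :: "('v, 'e) pre_digraph \<Rightarrow> ('v, 'e, 'k::field) quiver_rep \<Rightarrow> bool" where
  "is_rep G M \<longleftrightarrow> (\<forall>x \<in> verts G. findim_subspace (space M x)) \<and>
     (\<forall>a \<in> arcs G. linear_between (space M (tail G a)) (space M (head G a)) (arrow_map M a))"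

definition zero_rep :: "('v, 'e) pre_digraph \<Rightarrow> ('v, 'e, 'k::field) quiver_rep \<Rightarrow> bool" where
  "zero_rep G M \<longleftrightarrow> (\<forall>x \<in> verts G. space M x = {0})"

definition arc_component :: "'e \<Rightarrow> ('e, 'k::field) coord_vec \<Rightarrow> ('e, 'k) coord_vec" where
  "arc_component a u = (\<lambda>(p, n). u (a # p, n))"

definition incoming_sum ::
    "('v, 'e) pre_digraph \<Rightarrow> 'v \<Rightarrow> ('v, 'e, 'k::field) quiver_rep \<Rightarrow> ('e, 'k) coord_vec set" where
  "incoming_sum G x M =
     {u. (\<forall>a \<in> in_arcs G x. arc_component a u \<in> space M (tail G a)) \<and>
         (\<forall>p n. u (p, n) \<noteq> 0 \<longrightarrow> p \<noteq> [] \<and> hd p \<in> in_arcs G x)}"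

definition incoming_map :: "('v, 'e) pre_digraph \<Rightarrow> 'v \<Rightarrow> ('v, 'e, 'k::field) quiver_rep \<Rightarrow>
    ('e, 'k) coord_vec \<Rightarrow> ('e, 'k) coord_vec" where
  "incoming_map G x M u = (\<Sum>a \<in> in_arcs G x. arrow_map M a (arc_component a u))"

definition reflection_functor :: "('v, 'e) pre_digraph \<Rightarrow> 'v \<Rightarrow>
    ('v, 'e, 'k::field) quiver_rep \<Rightarrow> ('v, 'e, 'k) quiver_rep" where
  "reflection_functor G x M = \<lparr>
     space = (space M)(x := {u \<in> incoming_sum G x M. incoming_map G x M u = 0}),
     arrow_map = (\<lambda>a. if a \<in> in_arcs G x then arc_component a else arrow_map M a)\<rparr>"

fun seq_functor :: "('v, 'e) pre_digraph \<Rightarrow> 'v list \<Rightarrow>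
    ('v, 'e, 'k::field) quiver_rep \<Rightarrow> ('v, 'e, 'k) quiver_rep" where
  "seq_functor G [] M = M"
| "seq_functor G (x # xs) M = seq_functor (reverse_at x G) xs (reflection_functor G x M)"

definition annihilates ::
    "('v, 'e) pre_digraph \<Rightarrow> 'v list \<Rightarrow> ('v, 'e, 'k::field) quiver_rep \<Rightarrow> bool" where
  "annihilates G S M \<longleftrightarrow> zero_rep (reverse_along S G) (seq_functor G S M)"

definition preprojective :: "('v, 'e) pre_digraph \<Rightarrow> ('v, 'e, 'k::field) quiver_rep \<Rightarrow> bool" where
  "preprojective G M \<longleftrightarrow> is_rep G M \<and> (\<exists>S. admissible G S \<and> annihilates G S M)"

definition shortest_annihilating ::
    "('v, 'e) pre_digraph \<Rightarrow> ('v, 'e, 'k::field) quiver_rep \<Rightarrow> 'v list \<Rightarrow> bool" where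
  "shortest_annihilating G M S \<longleftrightarrow> admissible G S \<and> annihilates G S M \<and>
     (\<forall>S'. subsequence G S' S \<and> \<not> seq_equiv G S' S \<longrightarrow> \<not> annihilates G S' M)"


section \<open>The Weyl group\<close>

definition cartan_entry :: "('v, 'e) pre_digraph \<Rightarrow> 'v \<Rightarrow> 'v \<Rightarrow> int" where
  "cartan_entry G i j = (if i = j then 2 else - int (card (edges_between G i j)))"

text \<open>
  The reflections act on the free abelian group over the whole vertex type, with basis
  \<^term>\<open>frag_of j\<close>.  Reflections at vertices of \<open>G\<close> fix the basis elements outside \<open>verts G\<close>, so
  products of them are determined by their action on the span of the vertices of \<open>G\<close>.
\<close>

definition simple_reflection ::
    "('v, 'e) pre_digraph \<Rightarrow> 'v \<Rightarrow> ('v \<Rightarrow>\<^sub>0 int) \<Rightarrow> ('v \<Rightarrow>\<^sub>0 int)" where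
  "simple_reflection G i =
     frag_extend (\<lambda>j. frag_of j - frag_cmul (cartan_entry G i j) (frag_of i))"

text \<open>The leftmost letter of the list acts first.\<close>

fun weyl_word :: "('v, 'e) pre_digraph \<Rightarrow> 'v list \<Rightarrow> ('v \<Rightarrow>\<^sub>0 int) \<Rightarrow> ('v \<Rightarrow>\<^sub>0 int)" where
  "weyl_word G [] = id"
| "weyl_word G (x # xs) = weyl_word G xs \<circ> simple_reflection G x"

definition weyl_length :: "('v, 'e) pre_digraph \<Rightarrow> (('v \<Rightarrow>\<^sub>0 int) \<Rightarrow> ('v \<Rightarrow>\<^sub>0 int)) \<Rightarrow> nat" where
  "weyl_length G w = (LEAST l. \<exists>ys. length ys = l \<and> set ys \<subseteq> verts G \<and> w = weyl_word G ys)"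

definition reduced_word :: "('v, 'e) pre_digraph \<Rightarrow> 'v list \<Rightarrow> bool" where
  "reduced_word G xs \<longleftrightarrow> weyl_length G (weyl_word G xs) = length xs"

end

theory Submission
  imports Defs
begin

text \<open>
  An admissible sequence is determined up to equivalence by the number of occurrences \<open>m v\<close> of
  each vertex, and the functions that occur are those with \<open>m x \<le> m y \<le> m x + 1\<close> for every arrow
  from \<open>x\<close> to \<open>y\<close>; joins become pointwise maxima.  A letter \<open>v\<close> of a sequence, preceded by
  \<open>x\<^sub>1, \<dots>, x\<^sub>i\<close>, has the root obtained by applying the reflections at \<open>x\<^sub>i, \<dots>, x\<^sub>1\<close> to
  \<open>e\<^sub>v\<close>, which depends only on \<open>v\<close> and on how often \<open>v\<close> occurred before.  By Tits' theorem
  a word is reduced if and only if all roots of its letters are positive; hence a join is reduced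
  if and only if its parts are.

  On the module side, a letter \<open>v\<close> is the simple module at \<open>v\<close>, pulled back by negative reflection
  functors.  As long as this does not annihilate it, the result is a brick whose dimension vector
  is the root of the letter, and it represents the space at \<open>v\<close> of what the positive functors make
  of a module.  For a reduced word the direct sum of these bricks has the word as its shortest
  annihilating sequence.  Conversely, if a sequence is shortest for some module, then going
  backwards through the letters every letter is seen to have a nonzero brick, so its root is positive.
\<close>

section \<open>Reduced words and positive roots\<close>

text \<open>Existence of a brick and positivity of its root are one condition, tested letter by
  letter. The negative reflection at \<open>x\<close> is refused for a brick only if the brick is
  the simple one at \<open>x\<close>, with dimension vector e_x, and then the simple reflection
  gives -e_x. Having only scalar endomorphisms is what forces this alternative, so it is carried
  through all pullbacks.

  Of the adjunction between the two kinds of functors only two pieces are built: the unit,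
  invertible away from the refused case, and the lifting of a morphism \<open>Y\<close> ->
  \<open>pos M\<close> to \<open>neg Y\<close> -> \<open>M\<close>. Invariance under isomorphism and
  behaviour on direct sums both come from left exactness, stated for jointly injective families.

  The obstacle in the converse is that minimality only speaks about letters that can be moved to the
  end. Any other letter \<open>v\<close> has a later neighbour; let \<open>y\<close> be the first
  one. The brick of \<open>y\<close> is simple at \<open>y\<close> once its turn comes, and this
  forces it to be nonzero at \<open>v\<close> when \<open>v\<close> is due, although the given
  module may play no part there. Hence the representation is allowed to change from letter to
  letter.\<close>

abbreviation root_nonneg :: "('v \<Rightarrow>\<^sub>0 int) \<Rightarrow> bool" where
  "root_nonneg z \<equiv> \<forall>i. 0 \<le> Poly_Mapping.lookup z i"

section \<open>Linearity of the simple reflections and their rank two relations\<close>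

lemma cartan_entry_sym: "cartan_entry G i j = cartan_entry G j i"
  by (auto simp: cartan_entry_def edges_between_def insert_commute)

lemma simple_reflection_frag_of:
  "simple_reflection G i (frag_of j) = frag_of j - frag_cmul (cartan_entry G i j) (frag_of i)"
  by (simp add: simple_reflection_def)

lemma simple_reflection_add: "simple_reflection G i (u + v) = simple_reflection G i u + simple_reflection G i v"
  by (simp add: simple_reflection_def frag_extend_add)

lemma simple_reflection_diff: "simple_reflection G i (u - v) = simple_reflection G i u - simple_reflection G i v"
  by (simp add: simple_reflection_def frag_extend_diff)

lemma simple_reflection_minus: "simple_reflection G i (- v) = - simple_reflection G i v"
  by (simp add: simple_reflection_def frag_extend_minus)

lemma simple_reflection_cmul: "simple_reflection G i (frag_cmul c v) = frag_cmul c (simple_reflection G i v)"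
  by (simp add: simple_reflection_def frag_extend_cmul)

lemmas simple_reflection_linear = simple_reflection_frag_of simple_reflection_add
  simple_reflection_diff simple_reflection_minus simple_reflection_cmul

lemma simple_reflection_self: "simple_reflection G i (frag_of i) = - frag_of i"
  by (rule poly_mapping_eqI) (simp add: simple_reflection_frag_of cartan_entry_def lookup_minus)

lemma weyl_word_append: "weyl_word G (xs @ ys) = weyl_word G ys \<circ> weyl_word G xs"
  by (induction xs) (auto simp: fun_eq_iff)

lemma weyl_word_add: "weyl_word G xs (u + v) = weyl_word G xs u + weyl_word G xs v"
  by (induction xs arbitrary: u v) (auto simp: simple_reflection_linear)

lemma weyl_word_diff: "weyl_word G xs (u - v) = weyl_word G xs u - weyl_word G xs v"
  by (induction xs arbitrary: u v) (auto simp: simple_reflection_linear)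

lemma weyl_word_minus: "weyl_word G xs (- v) = - weyl_word G xs v"
  by (induction xs arbitrary: v) (auto simp: simple_reflection_linear simp del: minus_frag_cmul)

lemma weyl_word_cmul: "weyl_word G xs (frag_cmul c v) = frag_cmul c (weyl_word G xs v)"
  by (induction xs arbitrary: v) (auto simp: simple_reflection_linear)

lemma weyl_word_zero: "weyl_word G xs 0 = 0"
  using weyl_word_diff[of G xs 0 0] by simp

text \<open>All maps in play are additive, so a relation between reflections only has to be checked
  on the basis of the free abelian group.\<close>

lemma additive_eqI:
  fixes f g :: "('v \<Rightarrow>\<^sub>0 int) \<Rightarrow> ('w \<Rightarrow>\<^sub>0 int)"
  assumes "\<And>u v. f (u - v) = f u - f v" "\<And>u v. g (u - v) = g u - g v"
    and "\<And>j. f (frag_of j) = g (frag_of j)"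
  shows "f = g"
proof
  fix z :: "'v \<Rightarrow>\<^sub>0 int"
  have "f 0 = 0" "g 0 = 0"
    using assms(1)[of 0 0] assms(2)[of 0 0] by simp_all
  with subset_UNIV show "f z = g z"
    by (induction z rule: frag_induction) (auto simp: assms)
qed

lemma simple_reflection_involution: "simple_reflection G i \<circ> simple_reflection G i = id"
proof (rule additive_eqI)
  fix j
  show "(simple_reflection G i \<circ> simple_reflection G i) (frag_of j) = id (frag_of j)"
    by (simp add: simple_reflection_diff simple_reflection_frag_of simple_reflection_cmul
        simple_reflection_self frag_cmul_diff_distrib)
       (rule poly_mapping_eqI, simp add: lookup_minus cartan_entry_def)
qed (simp_all add: simple_reflection_diff)

lemma simple_reflection_involution': "simple_reflection G i (simple_reflection G i z) = z"
  using simple_reflection_involution[of G i] by (simp add: fun_eq_iff)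

lemma weyl_word_rev_cancel: "weyl_word G (rev xs) (weyl_word G xs z) = z"
  by (induction xs arbitrary: z) (auto simp: weyl_word_append simple_reflection_involution')

lemma weyl_word_rev_cancel': "weyl_word G xs (weyl_word G (rev xs) z) = z"
  using weyl_word_rev_cancel[of G "rev xs"] by simp

lemma weyl_word_rev_cong:
  assumes "weyl_word G xs = weyl_word G ys"
  shows "weyl_word G (rev xs) = weyl_word G (rev ys)"
proof
  fix z
  have "weyl_word G (rev xs) z = weyl_word G (rev xs) (weyl_word G ys (weyl_word G (rev ys) z))"
    by (simp add: weyl_word_rev_cancel')
  then show "weyl_word G (rev xs) z = weyl_word G (rev ys) z"
    by (simp add: assms[symmetric] weyl_word_rev_cancel)
qed

lemma weyl_word_cancel_pair: "weyl_word G (s # s # xs) = weyl_word G xs"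
  by (simp add: comp_assoc simple_reflection_involution)

lemma reflections_commute:
  assumes "cartan_entry G s t = 0"
  shows "simple_reflection G s \<circ> simple_reflection G t = simple_reflection G t \<circ> simple_reflection G s"
proof (rule additive_eqI)
  have "cartan_entry G t s = 0"
    using assms by (simp add: cartan_entry_sym)
  then show "(simple_reflection G s \<circ> simple_reflection G t) (frag_of j) =
        (simple_reflection G t \<circ> simple_reflection G s) (frag_of j)" for j
    by (simp add: simple_reflection_linear assms)
qed (simp_all add: simple_reflection_diff)

text \<open>A single edge makes both Cartan entries -1, the relation of type A2. Together with
  \<open>reflections_commute\<close> this covers the finite rank two groups that can occur; for two
  or more edges positivity comes from \<open>alternating_nonneg_comb\<close>.\<close>

lemma reflections_braid:
  assumes "cartan_entry G s t = -1"
  shows "simple_reflection G s \<circ> simple_reflection G t \<circ> simple_reflection G s =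
         simple_reflection G t \<circ> simple_reflection G s \<circ> simple_reflection G t"
proof (rule additive_eqI)
  have *: "cartan_entry G t s = -1"
    using assms by (simp add: cartan_entry_sym)
  show "(simple_reflection G s \<circ> simple_reflection G t \<circ> simple_reflection G s) (frag_of j) =
        (simple_reflection G t \<circ> simple_reflection G s \<circ> simple_reflection G t) (frag_of j)" for j
    by (rule poly_mapping_eqI) 
       (simp add: simple_reflection_linear assms * lookup_minus lookup_add cartan_entry_def[of G x x for x]
         algebra_simps)
qed (simp_all add: simple_reflection_diff)

section \<open>Length and reduced words\<close>

lemma weyl_length_le:
  assumes "set ys \<subseteq> verts G"
  shows "weyl_length G (weyl_word G ys) \<le> length ys"
  unfolding weyl_length_def using assms by (intro Least_le) auto

lemma weyl_length_word:
  assumes "set ys \<subseteq> verts G"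
  obtains zs where "set zs \<subseteq> verts G" "weyl_word G zs = weyl_word G ys"
    "length zs = weyl_length G (weyl_word G ys)" "reduced_word G zs"
proof -
  have "\<exists>zs. length zs = weyl_length G (weyl_word G ys) \<and> set zs \<subseteq> verts G \<and> weyl_word G ys = weyl_word G zs"
    unfolding weyl_length_def by (rule LeastI_ex) (use assms in auto)
  then show thesis
    using that unfolding reduced_word_def by metis
qed

lemma reduced_wordI:
  assumes "set ys \<subseteq> verts G"
    and "\<And>zs. set zs \<subseteq> verts G \<Longrightarrow> weyl_word G zs = weyl_word G ys \<Longrightarrow> length ys \<le> length zs"
  shows "reduced_word G ys"
  by (metis assms le_antisym reduced_word_def weyl_length_le weyl_length_word)

lemma reduced_wordD:
  assumes "reduced_word G ys" "set zs \<subseteq> verts G" "weyl_word G zs = weyl_word G ys"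
  shows "length ys \<le> length zs"
  by (metis assms reduced_word_def weyl_length_le)

text \<open>A shorter word for one factor could be substituted into the whole word.\<close>

lemma reduced_word_append:
  assumes "reduced_word G (xs @ ys)" "set (xs @ ys) \<subseteq> verts G"
  shows "reduced_word G xs" "reduced_word G ys"
proof -
  show "reduced_word G xs"
  proof (rule reduced_wordI)
    fix zs assume "set zs \<subseteq> verts G" "weyl_word G zs = weyl_word G xs"
    then show "length xs \<le> length zs"
      using reduced_wordD[OF assms(1), of "zs @ ys"] assms(2) by (simp add: weyl_word_append)
  qed (use assms in auto)
  show "reduced_word G ys"
  proof (rule reduced_wordI)
    fix zs assume "set zs \<subseteq> verts G" "weyl_word G zs = weyl_word G ys"
    then show "length ys \<le> length zs"
      using reduced_wordD[OF assms(1), of "xs @ zs"] assms(2) by (simp add: weyl_word_append)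
  qed (use assms in auto)
qed

text \<open>Reversal inverts the element, so a shorter word for the inverse, read backwards, would
  shorten \<open>xs\<close>.\<close>

lemma reduced_word_rev:
  assumes "reduced_word G xs" "set xs \<subseteq> verts G"
  shows "reduced_word G (rev xs)"
proof (rule reduced_wordI)
  fix zs assume "set zs \<subseteq> verts G" "weyl_word G zs = weyl_word G (rev xs)"
  then show "length (rev xs) \<le> length zs"
    using reduced_wordD[OF assms(1), of "rev zs"] weyl_word_rev_cong[of G zs "rev xs"] by simp
qed (use assms in auto)

section \<open>Words in two letters and Tits' positivity theorem\<close>

fun alternating :: "nat \<Rightarrow> 'v \<Rightarrow> 'v \<Rightarrow> 'v list" where
  "alternating 0 a b = []"
| "alternating (Suc k) a b = a # alternating k b a"

lemma alternating_if_no_repeats: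
  assumes "set us \<subseteq> {a, b}" "\<And>ps c qs. us \<noteq> ps @ [c, c] @ qs" "us = [] \<or> hd us = a"
  shows "us = alternating (length us) a b"
  using assms
proof (induction us arbitrary: a b)
  case (Cons x us)
  have "us = alternating (length us) b a"
  proof (rule Cons.IH)
    show "us \<noteq> ps @ [c, c] @ qs" for ps c qs
      using Cons.prems(2)[of "x # ps" c qs] by simp
    show "us = [] \<or> hd us = b"
      using Cons.prems(1,3) Cons.prems(2)[of "[]" x "tl us"] by (cases us) auto
  qed (use Cons.prems in auto)
  then show ?case
    using Cons.prems(3) by simp
qed simp

text \<open>The inequality \<open>q \<le> p\<close> is the invariant. With n =
  -\<open>cartan_entry G a b\<close> at least 2, the reflection at \<open>a\<close> replaces the
  coefficient \<open>q\<close> of \<open>a\<close> by n * \<open>p\<close> - \<open>q\<close>, which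
  is at least \<open>p\<close>. So the new coefficient of \<open>a\<close> dominates that of
  \<open>b\<close>, and the next reflection is at \<open>b\<close>.\<close>

lemma alternating_nonneg_comb:
  assumes "cartan_entry G a b \<le> -2" "0 \<le> q" "q \<le> p"
  obtains p' q' where "0 \<le> p'" "0 \<le> q'"
    "weyl_word G (alternating k a b) (frag_cmul p (frag_of b) + frag_cmul q (frag_of a)) =
       frag_cmul p' (frag_of a) + frag_cmul q' (frag_of b)"
proof -
  have "\<exists>p'\<ge>0. \<exists>q'\<ge>0. weyl_word G (alternating k a b) (frag_cmul p (frag_of b) + frag_cmul q (frag_of a)) =
       frag_cmul p' (frag_of a) + frag_cmul q' (frag_of b)"
    using assms
  proof (induction k arbitrary: a b p q)
    case 0
    then show ?case
      by (metis add.commute alternating.simps(1) id_apply order_trans weyl_word.simps(1))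
  next
    case (Suc k)
    let ?n = "- cartan_entry G a b"
    have eq: "simple_reflection G a (frag_cmul p (frag_of b) + frag_cmul q (frag_of a)) =
        frag_cmul (?n * p - q) (frag_of a) + frag_cmul p (frag_of b)"
      by (rule poly_mapping_eqI)
         (simp add: simple_reflection_linear simple_reflection_self lookup_add lookup_minus algebra_simps
          cartan_entry_def[of G a a])
    have "2 * p \<le> ?n * p"
      using Suc.prems by (intro mult_right_mono) auto
    then have "p \<le> ?n * p - q"
      using Suc.prems by linarith
    then obtain p' q' where "p' \<ge> 0" "q' \<ge> 0" "weyl_word G (alternating k b a)
        (frag_cmul (?n * p - q) (frag_of a) + frag_cmul p (frag_of b)) =
       frag_cmul p' (frag_of b) + frag_cmul q' (frag_of a)"
      using Suc.IH[of b a p "?n * p - q"] Suc.prems by (auto simp: cartan_entry_sym)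
    then show ?case
      using eq by (metis add.commute alternating.simps(2) comp_apply weyl_word.simps(2))
  qed
  then show thesis
    using that by blast
qed

lemma reduced_no_repeats:
  assumes "reduced_word G (ps @ [c, c] @ qs)" "set (ps @ [c, c] @ qs) \<subseteq> verts G"
  shows False
  using reduced_wordD[OF assms(1), of "ps @ qs"] assms(2)
  by (simp add: weyl_word_append comp_assoc simple_reflection_involution)

lemma cartan_entry_cases:
  assumes "s \<noteq> t"
  obtains "cartan_entry G s t = 0" | "cartan_entry G s t = -1" | "cartan_entry G s t \<le> -2"
proof -
  have "cartan_entry G s t \<le> 0"
    using assms by (simp add: cartan_entry_def)
  then show thesis
    using that by linarith
qed

text \<open>
  Tits' positivity theorem by rank two reduction: write a reduced word as a word \<open>us\<close> in two letters
  followed by a rest \<open>vs\<close>, with \<open>us\<close> as long as possible; the induction hypothesis applies to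
  \<open>vs\<close> and both letters, and \<open>us\<close> maps \<open>e\<^sub>s\<close> to a nonnegative combination of
  the two simple roots.
\<close>

lemma root_nonneg_if_length_le:
  assumes "reduced_word G ws" "set ws \<subseteq> verts G" "s \<in> verts G"
    and "length ws \<le> weyl_length G (weyl_word G (s # ws))"
  shows "root_nonneg (weyl_word G ws (frag_of s))"
  using assms
proof (induction "length ws" arbitrary: ws s rule: less_induct)
  case less
  show ?case
  proof (cases ws)
    case Nil
    then show ?thesis by simp
  next
    case (Cons t ws')
    \<comment> \<open>A word for the same element, no longer than \<open>ws\<close>, cannot begin
      with \<open>s\<close>: in \<open>s # ws\<close> the two letters \<open>s\<close> would cancel
      and leave an element shorter than \<open>ws\<close>, against the length hypothesis.\<close>
    have not_s: "zs = [] \<or> hd zs \<noteq> s"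
      if "weyl_word G zs = weyl_word G ws" "set zs \<subseteq> verts G" "length zs \<le> length ws" for zs
    proof (cases zs)
      case (Cons z zs')
      show ?thesis
      proof (rule ccontr)
        assume "\<not> (zs = [] \<or> hd zs \<noteq> s)"
        then have "weyl_word G (s # ws) = weyl_word G zs'"
          using that Cons weyl_word_cancel_pair[of G s zs'] by auto
        then have "weyl_length G (weyl_word G (s # ws)) \<le> length zs'"
          using weyl_length_le[of zs' G] that Cons by auto
        then show False
          using that less.prems(4) Cons by auto
      qed
    qed simp
    have t: "t \<noteq> s" "t \<in> verts G"
      using not_s[of ws] less.prems(2) Cons by auto
    \<comment> \<open>All words for the element of the same length as \<open>ws\<close>, cut into a
      part in \<open>s\<close> and \<open>t\<close> and a rest. The cut \<open>([t], ws')\<close> is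
      among them, so a longest \<open>us\<close> is nonempty and \<open>vs\<close> is short enough
      for the induction.\<close>
    define splits where "splits = (\<lambda>(us, vs). set us \<subseteq> {s, t} \<and> set (us @ vs) \<subseteq> verts G \<and>
        weyl_word G (us @ vs) = weyl_word G ws \<and> length us + length vs = length ws)"
    have init: "splits ([t], ws')"
      using less.prems Cons by (auto simp: splits_def)
    have bounded: "\<forall>y. splits y \<longrightarrow> length (fst y) < Suc (length ws)"
      by (auto simp: splits_def)
    obtain us vs where sp: "splits (us, vs)"
      and max: "\<And>us' vs'. splits (us', vs') \<Longrightarrow> length us' \<le> length us"
      using arg_max_natI[of splits "([t], ws')" "\<lambda>y. length (fst y)", OF init bounded]
        arg_max_nat_le[of splits _ "\<lambda>y. length (fst y)", OF _ bounded]
      by (metis fst_conv surj_pair)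
    have us: "set us \<subseteq> {s, t}" and v_verts: "set (us @ vs) \<subseteq> verts G"
      and w_eq: "weyl_word G (us @ vs) = weyl_word G ws" and len: "length us + length vs = length ws"
      using sp by (auto simp: splits_def)
    have "us \<noteq> []"
      using max[OF init] by auto
    then have short: "length vs < length ws"
      using len by (cases us) auto
    have red: "reduced_word G (us @ vs)"
      using less.prems(1) w_eq len by (auto simp: reduced_word_def)
    have red_vs: "reduced_word G vs"
      using reduced_word_append[OF red v_verts] by simp
    have pos: "root_nonneg (weyl_word G vs (frag_of r))" if r: "r \<in> {s, t}" for r
    proof (rule less.hyps[OF short red_vs])
      \<comment> \<open>Otherwise the element of \<open>r # vs\<close> has a word \<open>zs\<close>
        shorter than \<open>vs\<close>. Since two letters \<open>r\<close> cancel,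
        \<open>us @ [r] @ zs\<close> is again a word for \<open>ws\<close>, and as \<open>ws\<close>
        is reduced it has exactly the same length. Its two-letter part \<open>us @ [r]\<close>
        contradicts the choice of \<open>us\<close>.\<close>
      show "length vs \<le> weyl_length G (weyl_word G (r # vs))"
      proof (rule ccontr)
        assume "\<not> length vs \<le> weyl_length G (weyl_word G (r # vs))"
        moreover have rv: "set (r # vs) \<subseteq> verts G"
          using r t v_verts less.prems(3) by auto
        ultimately obtain zs where zs: "set zs \<subseteq> verts G" "weyl_word G zs = weyl_word G (r # vs)"
          "length zs < length vs"
          by (metis not_le weyl_length_word)
        have "weyl_word G ((us @ [r]) @ zs) = weyl_word G us' " if "us' = us @ (r # r # vs)" for us'
          using that zs(2) by (simp add: weyl_word_append comp_assoc)
        then have eq: "weyl_word G ((us @ [r]) @ zs) = weyl_word G ws"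
          using w_eq by (simp only: weyl_word_append weyl_word_cancel_pair)
        have set: "set ((us @ [r]) @ zs) \<subseteq> verts G"
          using zs rv v_verts by auto
        have "length ws \<le> length ((us @ [r]) @ zs)"
          using reduced_wordD[OF less.prems(1) set eq] .
        then have "splits (us @ [r], zs)"
          using eq set us r zs(3) len by (auto simp: splits_def)
        then show False
          using max by fastforce
      qed
    qed (use r t v_verts less.prems(3) in auto)
    have hd_us: "us = [] \<or> hd us = t"
      using not_s[of "us @ vs"] us v_verts w_eq len by (cases us) auto
    have alt: "us = alternating (length us) t s"
    proof (rule alternating_if_no_repeats)
      show "us \<noteq> ps @ [c, c] @ qs" for ps c qs
        using reduced_no_repeats[of G ps c "qs @ vs"] red v_verts by auto
    qed (use us hd_us in auto)
    have "\<exists>p'\<ge>0. \<exists>q'\<ge>0. weyl_word G us (frag_of s) = frag_cmul p' (frag_of t) + frag_cmul q' (frag_of s)"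
    proof (cases rule: cartan_entry_cases[OF t(1), of G])
      \<comment> \<open>From two letters on, commuting the first two would give a word that begins
        with \<open>s\<close>. So \<open>us\<close> is \<open>[t]\<close>, and this reflection fixes
        e_s.\<close>
      case 1
      have "length us = 1"
      proof (rule ccontr)
        assume "length us \<noteq> 1"
        then obtain k where "length us = Suc (Suc k)"
          using \<open>us \<noteq> []\<close> by (metis One_nat_def Suc_pred length_greater_0_conv not_less_eq less_one linorder_neqE_nat gr0_conv_Suc)
        then have u: "us = t # s # alternating k t s"
          using alt by simp
        have "weyl_word G (s # t # alternating k t s @ vs) = weyl_word G ws"
          using reflections_commute[OF 1] w_eq unfolding u by (simp add: weyl_word_append comp_assoc)
        then show False
          using not_s[of "s # t # alternating k t s @ vs"] v_verts len unfolding u by simp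
      qed
      then have "us = [t]"
        using hd_us by (cases us) auto
      then have "weyl_word G us (frag_of s) = frag_cmul 0 (frag_of t) + frag_cmul 1 (frag_of s)"
        using 1 by (simp add: simple_reflection_frag_of cartan_entry_sym[of G t s])
      then show ?thesis
        by (blast intro: order_refl zero_le_one)
    next
      \<comment> \<open>From three letters on, the braid relation would give a word that begins with
        \<open>s\<close>. Only \<open>[t]\<close> and \<open>[t, s]\<close> remain, sending e_s to
        e_t + e_s and to e_t.\<close>
      case 2
      have "length us \<le> 2"
      proof (rule ccontr)
        assume "\<not> length us \<le> 2"
        then obtain k where "length us = Suc (Suc (Suc k))"
          by (metis One_nat_def Suc_1 not_less_eq_eq Suc_le_D)
        then have u: "us = t # s # t # alternating k s t"
          using alt by simp
        have "weyl_word G (s # t # s # alternating k s t @ vs) = weyl_word G ws"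
          using reflections_braid[OF 2] w_eq unfolding u by (simp add: weyl_word_append comp_assoc)
        then show False
          using not_s[of "s # t # s # alternating k s t @ vs"] v_verts len unfolding u by simp
      qed
      moreover have "length us \<ge> 1"
        using \<open>us \<noteq> []\<close> by (cases us) auto
      ultimately have "length us = 1 \<or> length us = 2"
        by linarith
      then have "us = [t] \<or> us = [t, s]"
        using alt by (auto simp: numeral_2_eq_2)
      moreover have "weyl_word G [t] (frag_of s) = frag_cmul 1 (frag_of t) + frag_cmul 1 (frag_of s)"
        by (simp add: simple_reflection_frag_of 2)
      moreover have "weyl_word G [t, s] (frag_of s) = frag_cmul 1 (frag_of t) + frag_cmul 0 (frag_of s)"
        using 2 by (intro poly_mapping_eqI)
          (simp add: simple_reflection_linear cartan_entry_sym[of G s t] cartan_entry_def[of G s s]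
            lookup_add lookup_minus)
      ultimately show ?thesis
        by (elim disjE) (blast intro: zero_le_one order_refl)+
    next
      \<comment> \<open>Here \<open>us\<close> can be arbitrarily long; the invariant starts at e_s,
        that is at coefficients 1 for \<open>s\<close> and 0 for \<open>t\<close>.\<close>
      case 3
      then show ?thesis
        using alternating_nonneg_comb[OF 3, of 0 1 "length us"] alt by (metis (no_types, opaque_lifting) add.right_neutral frag_cmul_one frag_cmul_zero order_refl zero_le_one)
    qed
    then obtain p' q' where pq: "p' \<ge> 0" "q' \<ge> 0"
      "weyl_word G us (frag_of s) = frag_cmul p' (frag_of t) + frag_cmul q' (frag_of s)"
      by blast
    have "weyl_word G ws (frag_of s) =
        frag_cmul p' (weyl_word G vs (frag_of t)) + frag_cmul q' (weyl_word G vs (frag_of s))"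
      unfolding w_eq[symmetric] by (simp add: weyl_word_append pq weyl_word_add weyl_word_cmul)
    then show ?thesis
      using pos pq by (simp add: lookup_add)
  qed
qed

text \<open>The reversal makes the letter of \<open>A\<close> closest to \<open>v\<close> act first,
  since in \<open>weyl_word\<close> the leftmost letter acts first.\<close>

definition letter_root :: "('v, 'e) pre_digraph \<Rightarrow> 'v list \<Rightarrow> 'v \<Rightarrow> ('v \<Rightarrow>\<^sub>0 int)" where
  "letter_root G A v = weyl_word G (rev A) (frag_of v)"

text \<open>The reversed word \<open>v # rev A\<close> is reduced too and one letter longer than
  \<open>rev A\<close>; this is the length hypothesis of
  \<open>root_nonneg_if_length_le\<close>.\<close>

lemma letter_root_nonneg_if_reduced:
  assumes "reduced_word G (A @ [v])" "set (A @ [v]) \<subseteq> verts G"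
  shows "root_nonneg (letter_root G A v)"
proof -
  have "reduced_word G (v # rev A)" "reduced_word G (rev A)"
    using reduced_word_rev[OF assms] reduced_word_append[OF assms]
      reduced_word_rev[of G A] assms(2) by auto
  then show ?thesis
    unfolding letter_root_def using assms(2)
    by (intro root_nonneg_if_length_le) (auto simp: reduced_word_def)
qed

text \<open>If the length did not go up, a shortest word \<open>zs\<close> for
  \<open>v # rev A\<close> would be no longer than \<open>A\<close>, while \<open>v # zs\<close>
  represents \<open>rev A\<close>. Positivity applied to \<open>zs\<close> then makes the negative
  of the letter root nonnegative, so the root would vanish, which an invertible map
  excludes.\<close>

lemma reduced_snoc:
  assumes red: "reduced_word G A" and set: "set (A @ [v]) \<subseteq> verts G"
    and pos: "root_nonneg (letter_root G A v)"
  shows "reduced_word G (A @ [v])"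
proof -
  have red': "reduced_word G (rev A)"
    using assms reduced_word_rev by auto
  have verts: "set (v # rev A) \<subseteq> verts G"
    using set by auto
  obtain zs where zs: "set zs \<subseteq> verts G" "weyl_word G zs = weyl_word G (v # rev A)"
    "length zs = weyl_length G (weyl_word G (v # rev A))" "reduced_word G zs"
    using weyl_length_word[OF verts] by blast
  have "length (v # rev A) \<le> length zs"
  proof (rule ccontr)
    assume short: "\<not> length (v # rev A) \<le> length zs"
    have eq: "weyl_word G (v # zs) = weyl_word G (rev A)"
      using zs(2) weyl_word_cancel_pair[of G v "rev A"] by simp
    then have "length zs \<le> weyl_length G (weyl_word G (v # zs))"
      using short red' by (simp add: reduced_word_def)
    then have "root_nonneg (weyl_word G zs (frag_of v))"
      using zs verts by (intro root_nonneg_if_length_le) auto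
    moreover have "weyl_word G zs (frag_of v) = - letter_root G A v"
      unfolding zs(2) letter_root_def by (simp add: simple_reflection_self weyl_word_minus)
    ultimately have "letter_root G A v = 0"
      using pos by (intro poly_mapping_eqI) (simp add: antisym)
    then have "frag_of v = (0 :: _ \<Rightarrow>\<^sub>0 int)"
      using weyl_word_rev_cancel'[of G A "frag_of v"] by (simp add: letter_root_def weyl_word_zero)
    then show False
      by simp
  qed
  then have "reduced_word G (v # rev A)"
    using zs(3) weyl_length_le[OF verts] by (simp add: reduced_word_def)
  then show ?thesis
    using reduced_word_rev[of G "v # rev A"] verts by simp
qed

lemma reduced_if_letter_roots_nonneg:
  assumes "set S \<subseteq> verts G"
    and "\<And>A v B. S = A @ [v] @ B \<Longrightarrow> root_nonneg (letter_root G A v)"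
  shows "reduced_word G S"
  using assms
proof (induction S rule: rev_induct)
  case Nil
  then show ?case by (simp add: reduced_wordI)
next
  case (snoc v A)
  show ?case
  proof (rule reduced_snoc)
    show "reduced_word G A"
      using snoc by auto
  qed (use snoc.prems in auto)
qed

section \<open>Admissible sequences and vertex multiplicities\<close>

text \<open>The form of the hypotheses that survives reflections. A height that drops along arrows
  stands for acyclicity. That every vertex meets an arc is what is kept of connectedness with
  several vertices: at an isolated vertex the same letter could be repeated immediately.\<close>

definition graded_quiver :: "('v, 'e) pre_digraph \<Rightarrow> bool" where
  "graded_quiver G \<longleftrightarrow> fin_digraph G \<and> (\<exists>h :: 'v \<Rightarrow> nat. \<forall>a \<in> arcs G. h (head G a) < h (tail G a)) \<and>
     (\<forall>v \<in> verts G. \<exists>a \<in> arcs G. tail G a = v \<or> head G a = v)"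

text \<open>The height of a vertex is the number of vertices reachable by a path of positive length.
  It drops strictly along an arc, because the head is reachable in this way from the tail but,
  without cycles, not from itself.\<close>

lemma acyclic_quiver_graded:
  assumes "acyclic_quiver G"
  shows "graded_quiver G"
proof -
  interpret fin_digraph G
    using assms by (simp add: acyclic_quiver_def)
  have acyc: "(v, v) \<notin> (arcs_ends G)\<^sup>+" for v
  proof
    assume "(v, v) \<in> (arcs_ends G)\<^sup>+"
    then obtain p where "awalk v p v" "p \<noteq> []"
      using reachable1_awalk by blast
    then have "closed_w p"
      by (auto simp: closed_w_def)
    then show False
      using closed_w_imp_cycle assms by (auto simp: acyclic_quiver_def)
  qed
  have "card {u. (head G a, u) \<in> (arcs_ends G)\<^sup>+} < card {u. (tail G a, u) \<in> (arcs_ends G)\<^sup>+}"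
    if a: "a \<in> arcs G" for a
  proof (rule psubset_card_mono)
    have arc: "(tail G a, head G a) \<in> arcs_ends G"
      using a by (auto simp: arcs_ends_conv)
    have "{u. (tail G a, u) \<in> (arcs_ends G)\<^sup>+} \<subseteq> verts G"
      using reachable1_in_verts(2) by blast
    then show "finite {u. (tail G a, u) \<in> (arcs_ends G)\<^sup>+}"
      by (rule finite_subset) simp
    show "{u. (head G a, u) \<in> (arcs_ends G)\<^sup>+} \<subset> {u. (tail G a, u) \<in> (arcs_ends G)\<^sup>+}"
      using arc acyc[of "head G a"] by (auto intro: trancl_into_trancl2)
  qed
  then have height: "\<exists>h :: 'a \<Rightarrow> nat. \<forall>a \<in> arcs G. h (head G a) < h (tail G a)"
    by (intro exI[of _ "\<lambda>v. card {u. (v, u) \<in> (arcs_ends G)\<^sup>+}"]) blast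
  have "\<exists>a \<in> arcs G. tail G a = v \<or> head G a = v" if v: "v \<in> verts G" for v
  proof -
    have "\<not> verts G \<subseteq> {v}"
      using assms card_mono[of "{v}" "verts G"] by (auto simp: acyclic_quiver_def)
    then obtain w where w: "w \<in> verts G" "w \<noteq> v"
      by auto
    have "strongly_connected (with_proj (mk_symmetric G))"
      using assms by (auto simp: acyclic_quiver_def connected_def)
    then have "(v, w) \<in> rtrancl_on (verts G) (arcs_ends (with_proj (mk_symmetric G)))"
      using v w by (auto simp: strongly_connected_def reachable_def)
    then have "\<exists>u. (v, u) \<in> arcs_ends (with_proj (mk_symmetric G))"
      using w(2) by (induction rule: rtrancl_on_induct) auto
    then show ?thesis
      by (auto simp: mk_symmetric_def arcs_ends_conv)
  qed
  then show ?thesis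
    using height fin_digraph_axioms by (simp add: graded_quiver_def)
qed

lemma verts_reverse_at [simp]: "verts (reverse_at x G) = verts G"
  and arcs_reverse_at [simp]: "arcs (reverse_at x G) = arcs G"
  by (simp_all add: reverse_at_def)

lemma tail_reverse_at: "a \<in> arcs G \<Longrightarrow>
    tail (reverse_at x G) a = (if tail G a = x \<or> head G a = x then head G a else tail G a)"
  and head_reverse_at: "a \<in> arcs G \<Longrightarrow>
    head (reverse_at x G) a = (if tail G a = x \<or> head G a = x then tail G a else head G a)"
  by (auto simp: reverse_at_def)

lemma edges_between_reverse_at [simp]: "edges_between (reverse_at x G) = edges_between G"
proof (intro ext)
  have "{tail (reverse_at x G) a, head (reverse_at x G) a} = {tail G a, head G a}" if "a \<in> arcs G" for a
    using that by (auto simp: tail_reverse_at head_reverse_at)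
  then show "edges_between (reverse_at x G) u v = edges_between G u v" for u v
    by (auto simp: edges_between_def)
qed

lemma edges_between_commute: "edges_between G x y = edges_between G y x"
  by (simp add: edges_between_def insert_commute)

lemma verts_reverse_along [simp]: "verts (reverse_along S G) = verts G"
  and arcs_reverse_along [simp]: "arcs (reverse_along S G) = arcs G"
  and edges_between_reverse_along [simp]: "edges_between (reverse_along S G) = edges_between G"
  by (induction S arbitrary: G) (auto simp: reverse_along_def)

lemma reverse_along_Nil [simp]: "reverse_along [] G = G"
  and reverse_along_Cons [simp]: "reverse_along (x # S) G = reverse_along S (reverse_at x G)"
  by (simp_all add: reverse_along_def)

lemma weyl_word_reverse_at [simp]: "weyl_word (reverse_at x G) = weyl_word G"
proof -
  have "cartan_entry (reverse_at x G) = cartan_entry G"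
    by (auto simp: cartan_entry_def fun_eq_iff)
  then have "simple_reflection (reverse_at x G) = simple_reflection G"
    by (simp add: simple_reflection_def fun_eq_iff)
  then have "weyl_word (reverse_at x G) ys = weyl_word G ys" for ys
    by (induction ys) auto
  then show ?thesis by blast
qed

lemma reduced_word_reverse_at [simp]: "reduced_word (reverse_at x G) = reduced_word G"
  by (simp add: reduced_word_def weyl_length_def fun_eq_iff)

lemma letter_root_reverse_at [simp]: "letter_root (reverse_at x G) = letter_root G"
  by (simp add: letter_root_def fun_eq_iff)

lemma sink_iff: "sink G x \<longleftrightarrow> x \<in> verts G \<and> (\<forall>a \<in> arcs G. tail G a \<noteq> x)"
  by (auto simp: sink_def out_arcs_def)

lemma graded_quiver_no_loop:
  assumes "graded_quiver G" "a \<in> arcs G"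
  shows "tail G a \<noteq> head G a"
  using assms unfolding graded_quiver_def by (metis less_irrefl)

text \<open>The sink becomes a source, so it only needs a new height above all others.\<close>

lemma graded_quiver_reverse_at:
  assumes "graded_quiver G" "sink G x"
  shows "graded_quiver (reverse_at x G)"
proof -
  interpret fin_digraph G
    using assms by (simp add: graded_quiver_def)
  obtain h :: "'a \<Rightarrow> nat" where h: "\<forall>a \<in> arcs G. h (head G a) < h (tail G a)"
    using assms by (auto simp: graded_quiver_def)
  have "fin_digraph (reverse_at x G)"
    by unfold_locales (auto simp: tail_reverse_at head_reverse_at)
  moreover have "\<forall>a \<in> arcs G. (h(x := Suc (Max (h ` verts G)))) (head (reverse_at x G) a) <
      (h(x := Suc (Max (h ` verts G)))) (tail (reverse_at x G) a)"
    using h assms(2) by (auto simp: tail_reverse_at head_reverse_at sink_iff less_Suc_eq_le)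
  moreover have "\<forall>v \<in> verts G. \<exists>a \<in> arcs G. tail (reverse_at x G) a = v \<or> head (reverse_at x G) a = v"
    using assms unfolding graded_quiver_def by (metis tail_reverse_at head_reverse_at)
  ultimately show ?thesis
    unfolding graded_quiver_def by auto
qed

lemma graded_quiver_reverse_along:
  assumes "graded_quiver G" "admissible G S"
  shows "graded_quiver (reverse_along S G)"
  using assms by (induction S arbitrary: G) (auto intro: graded_quiver_reverse_at)

lemma admissible_append:
  "admissible G (S @ T) \<longleftrightarrow> admissible G S \<and> admissible (reverse_along S G) T"
  by (induction S arbitrary: G) auto

lemma admissible_verts: "admissible G S \<Longrightarrow> set S \<subseteq> verts G"
proof (induction S arbitrary: G)
  case (Cons x S)
  then show ?case
    using Cons.IH[of "reverse_at x G"] by (simp add: sink_iff)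
qed simp

lemma reverse_at_commute:
  assumes "edges_between G x y = {}"
  shows "reverse_at x (reverse_at y G) = reverse_at y (reverse_at x G)"
  using assms
  by (intro pre_digraph.equality ext) (auto simp: reverse_at_def edges_between_def)

lemma sink_reverse_at_iff:
  assumes "edges_between G x y = {}" "x \<noteq> y"
  shows "sink (reverse_at x G) y \<longleftrightarrow> sink G y"
proof -
  have "tail (reverse_at x G) a = y \<longleftrightarrow> tail G a = y" if "a \<in> arcs G" for a
    using that assms by (auto simp: tail_reverse_at edges_between_def doubleton_eq_iff)
  then show ?thesis
    by (auto simp: sink_iff)
qed

lemma sinks_not_adjacent:
  assumes "sink G x" "sink G y"
  shows "edges_between G x y = {}"
  using assms by (auto simp: sink_iff edges_between_def doubleton_eq_iff)

lemma seq_equiv_refl: "admissible G S \<Longrightarrow> seq_equiv G S S"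
  by (simp add: seq_equiv_def)

lemma seq_equiv_sym: "seq_equiv G S T \<Longrightarrow> seq_equiv G T S"
  by (simp add: seq_equiv_def equivclp_sym)

lemma seq_equiv_trans [trans]: "seq_equiv G S T \<Longrightarrow> seq_equiv G T U \<Longrightarrow> seq_equiv G S U"
  unfolding seq_equiv_def by (blast intro: equivclp_trans)

lemma seq_equiv_swap:
  assumes "admissible G (x # y # W)" "edges_between G x y = {}" "sink G y" "x \<noteq> y"
  shows "seq_equiv G (x # y # W) (y # x # W)"
proof -
  have adm: "admissible G (y # x # W)"
    using assms reverse_at_commute[OF assms(2)] sink_reverse_at_iff[of G y x]
    by (simp add: edges_between_commute)
  have "swap_step G ([] @ [x, y] @ W) ([] @ [y, x] @ W)"
    using assms adm by (intro swap_step.intros) simp_all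
  then show ?thesis
    using assms adm by (simp add: seq_equiv_def r_into_equivclp)
qed

lemma swap_step_Cons:
  assumes "swap_step (reverse_at a G) S T" "sink G a"
  shows "swap_step G (a # S) (a # T)"
  using assms(1)
proof cases
  case (1 U x y W)
  then show ?thesis
    using swap_step.intros[of G "a # U" x y W] assms(2) by simp
qed

lemma seq_equiv_Cons:
  assumes "seq_equiv (reverse_at a G) S T" "sink G a"
  shows "seq_equiv G (a # S) (a # T)"
proof -
  have "equivclp (swap_step (reverse_at a G)) S T"
    using assms by (simp add: seq_equiv_def)
  then have "equivclp (swap_step G) (a # S) (a # T)"
    unfolding equivclp_def
  proof (induction rule: rtranclp_induct)
    case (step T' T'')
    then have "symclp (swap_step G) (a # T') (a # T'')"
      using swap_step_Cons[OF _ assms(2)] by (auto simp: symclp_def)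
    with step.IH show ?case
      by (rule rtranclp.rtrancl_into_rtrancl)
  qed simp
  then show ?thesis
    using assms by (simp add: seq_equiv_def)
qed

lemma seq_equiv_append:
  assumes "seq_equiv (reverse_along A G) S T" "admissible G A"
  shows "seq_equiv G (A @ S) (A @ T)"
  using assms by (induction A arbitrary: G) (auto intro: seq_equiv_Cons)

text \<open>Whatever is unchanged by one swap is an invariant of the class. The instances are
  multiplicities, length, the Weyl group element and the composed functor.\<close>

lemma seq_equiv_induct [consumes 1, case_names swap]:
  assumes "seq_equiv G S T"
    and "\<And>U x y W. admissible G (U @ [x, y] @ W) \<Longrightarrow> admissible G (U @ [y, x] @ W) \<Longrightarrow>
      edges_between G x y = {} \<Longrightarrow> f (U @ [x, y] @ W) = f (U @ [y, x] @ W)"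
  shows "f S = f T"
proof -
  have "(symclp (swap_step G))\<^sup>*\<^sup>* S T"
    using assms(1) by (simp add: seq_equiv_def equivclp_def)
  then show ?thesis
  proof (induction rule: rtranclp_induct)
    case (step T' T'')
    then have "swap_step G T' T'' \<or> swap_step G T'' T'"
      by (auto simp: symclp_def)
    then have "f T' = f T''"
      by (auto elim!: swap_step.cases dest: assms(2))
    with step.IH show ?case by simp
  qed simp
qed

lemma seq_equiv_count: "seq_equiv G S T \<Longrightarrow> count_list S = count_list T"
  by (rule seq_equiv_induct[where f = count_list]) (auto simp: fun_eq_iff)

lemma seq_equiv_weyl_word:
  assumes "seq_equiv G S T"
  shows "weyl_word G S = weyl_word G T"
  using assms
proof (induction rule: seq_equiv_induct)
  case (swap U x y W)
  show ?case
  proof (cases "x = y")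
    case False
    then have "cartan_entry G x y = 0"
      using swap by (simp add: cartan_entry_def)
    then show ?thesis
      using reflections_commute[of G x y] by (simp add: weyl_word_append comp_assoc)
  qed simp
qed

text \<open>Two vertices that are sinks at the same time are not joined by an edge. So
  \<open>x\<close> stays a sink while the letters of \<open>A\<close> are processed, and each of
  them may be interchanged with it.\<close>

lemma bubble_front:
  assumes "admissible G (A @ x # B)" "sink G x" "x \<notin> set A"
  shows "seq_equiv G (A @ x # B) (x # A @ B)"
  using assms
proof (induction A arbitrary: G)
  case Nil
  then show ?case by (simp add: seq_equiv_def)
next
  case (Cons a A)
  have "sink G a" "a \<noteq> x"
    using Cons.prems by auto
  have nonadj: "edges_between G a x = {}"
    using sinks_not_adjacent \<open>sink G a\<close> Cons.prems(2) .
  then have "sink (reverse_at a G) x"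
    using Cons.prems(2) sink_reverse_at_iff[OF nonadj \<open>a \<noteq> x\<close>] by simp
  then have "seq_equiv (reverse_at a G) (A @ x # B) (x # A @ B)"
    using Cons.IH Cons.prems by simp
  then have 1: "seq_equiv G (a # A @ x # B) (a # x # A @ B)"
    using \<open>sink G a\<close> by (rule seq_equiv_Cons)
  then have "admissible G (a # x # A @ B)"
    by (simp add: seq_equiv_def)
  then have "seq_equiv G (a # x # A @ B) (x # a # A @ B)"
    using nonadj Cons.prems(2) \<open>a \<noteq> x\<close> by (rule seq_equiv_swap)
  with 1 have "seq_equiv G (a # A @ x # B) (x # a # A @ B)"
    by (rule seq_equiv_trans)
  then show ?case by simp
qed

text \<open>A letter \<open>b\<close> not joined to \<open>x\<close> was a sink already before the
  reflection at \<open>x\<close>, so both orders are admissible and \<open>x\<close> passes the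
  letters of \<open>B\<close> one by one.\<close>

lemma bubble_back:
  assumes "admissible G (x # B)" "\<And>b. b \<in> set B \<Longrightarrow> b \<noteq> x \<and> edges_between G b x = {}"
  shows "seq_equiv G (x # B) (B @ [x])"
  using assms
proof (induction B arbitrary: G)
  case Nil
  then show ?case by (simp add: seq_equiv_refl)
next
  case (Cons b B)
  have b: "sink G b" "edges_between G x b = {}" "x \<noteq> b"
    using Cons.prems sink_reverse_at_iff[of G x b] by (auto simp: edges_between_commute)
  then have 1: "seq_equiv G (x # b # B) (b # x # B)"
    using Cons.prems by (intro seq_equiv_swap) auto
  then have "admissible (reverse_at b G) (x # B)"
    by (simp add: seq_equiv_def)
  then have "seq_equiv (reverse_at b G) (x # B) (B @ [x])"
    using Cons by simp
  then have "seq_equiv G (b # x # B) (b # B @ [x])"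
    using seq_equiv_Cons b(1) by fast
  with 1 have "seq_equiv G (x # b # B) (b # B @ [x])"
    by (rule seq_equiv_trans)
  then show ?case
    by simp
qed

text \<open>The first letter of \<open>S\<close> is a sink and occurs in \<open>T\<close>; its first
  occurrence there moves to the front, and then this letter is removed from both.\<close>

lemma extend_to_larger_count:
  assumes "admissible G S" "admissible G T" "\<And>v. count_list S v \<le> count_list T v"
  obtains U where "seq_equiv G T (S @ U)"
proof -
  have "\<exists>U. seq_equiv G T (S @ U)"
    using assms
  proof (induction S arbitrary: G T)
    case Nil
    then show ?case by (auto intro: seq_equiv_refl)
  next
    case (Cons x S)
    have "count_list T x \<noteq> 0"
      using Cons.prems(3)[of x] by simp
    then obtain A B where T: "T = A @ x # B" "x \<notin> set A"
      by (metis count_list_0_iff split_list_first)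
    have 1: "seq_equiv G T (x # A @ B)"
      using bubble_front Cons.prems T by auto
    then have adm: "admissible (reverse_at x G) (A @ B)"
      by (simp add: seq_equiv_def)
    have "count_list S v \<le> count_list (A @ B) v" for v
      using Cons.prems(3)[of v] unfolding T by (auto split: if_splits)
    then obtain U where "seq_equiv (reverse_at x G) (A @ B) (S @ U)"
      using Cons adm by fastforce
    then have "seq_equiv G (x # A @ B) (x # S @ U)"
      using seq_equiv_Cons Cons.prems(1) by auto
    with 1 have "seq_equiv G T (x # S @ U)"
      by (rule seq_equiv_trans)
    then show ?case
      by auto
  qed
  then show thesis
    using that by blast
qed

lemma count_list_eq_zero_imp_Nil: "(\<And>v. count_list U v = 0) \<Longrightarrow> U = []"
  by (metis count_list_0_iff list.set_intros(1) neq_Nil_conv)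

text \<open>With equal multiplicities nothing is left over in
  \<open>extend_to_larger_count\<close>.\<close>

lemma seq_equiv_iff_count:
  assumes "admissible G S" "admissible G T"
  shows "seq_equiv G S T \<longleftrightarrow> count_list S = count_list T"
proof
  assume eq: "count_list S = count_list T"
  then obtain U where U: "seq_equiv G S (T @ U)"
    using extend_to_larger_count[OF assms(2,1)] by auto
  then have "U = []"
    using seq_equiv_count[OF U] eq by (intro count_list_eq_zero_imp_Nil) (simp add: fun_eq_iff)
  then show "seq_equiv G S T"
    using U by simp
qed (rule seq_equiv_count)

lemma subsequence_iff_count:
  "subsequence G S T \<longleftrightarrow> admissible G S \<and> admissible G T \<and> (\<forall>v. count_list S v \<le> count_list T v)"
proof
  assume "subsequence G S T"
  then show "admissible G S \<and> admissible G T \<and> (\<forall>v. count_list S v \<le> count_list T v)"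
    unfolding subsequence_def by (auto dest!: seq_equiv_count)
next
  assume *: "admissible G S \<and> admissible G T \<and> (\<forall>v. count_list S v \<le> count_list T v)"
  then obtain U where "seq_equiv G T (S @ U)"
    using extend_to_larger_count[of G S T] by blast
  then show "subsequence G S T"
    using * unfolding subsequence_def by (metis admissible_append seq_equiv_def)
qed

definition compatible_count :: "('v, 'e) pre_digraph \<Rightarrow> ('v \<Rightarrow> nat) \<Rightarrow> bool" where
  "compatible_count G m \<longleftrightarrow> (\<forall>v. v \<notin> verts G \<longrightarrow> m v = 0) \<and>
     (\<forall>a \<in> arcs G. m (tail G a) \<le> m (head G a) \<and> m (head G a) \<le> Suc (m (tail G a)))"

text \<open>Only the current head of an arc can be reflected, and this turns the arc around. So its
  two ends occur alternately, beginning with the head, and the difference of their multiplicities, 0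
  or 1, records the current direction.\<close>

lemma admissible_count_arc:
  assumes "graded_quiver G" "admissible G S" "a \<in> arcs G"
  shows "count_list S (tail G a) \<le> count_list S (head G a)"
    and "count_list S (head G a) \<le> Suc (count_list S (tail G a))"
    and "tail (reverse_along S G) a =
      (if count_list S (head G a) = count_list S (tail G a) then tail G a else head G a)"
    and "head (reverse_along S G) a =
      (if count_list S (head G a) = count_list S (tail G a) then head G a else tail G a)"
proof -
  have "count_list S (tail G a) \<le> count_list S (head G a) \<and>
    count_list S (head G a) \<le> Suc (count_list S (tail G a)) \<and>
    tail (reverse_along S G) a =
      (if count_list S (head G a) = count_list S (tail G a) then tail G a else head G a) \<and>
    head (reverse_along S G) a =
      (if count_list S (head G a) = count_list S (tail G a) then head G a else tail G a)"
    using assms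
  proof (induction S arbitrary: G)
    case (Cons x S)
    have loop: "tail G a \<noteq> head G a" "tail G a \<noteq> x"
      using Cons.prems graded_quiver_no_loop[OF Cons.prems(1,3)] by (auto simp: sink_iff)
    have IH: "graded_quiver (reverse_at x G)" "admissible (reverse_at x G) S" "a \<in> arcs (reverse_at x G)"
      using Cons.prems graded_quiver_reverse_at by auto
    show ?case
      using Cons.IH[OF IH] loop Cons.prems(3)
      by (cases "head G a = x") (auto simp: tail_reverse_at head_reverse_at split: if_splits)
  qed simp
  then show "count_list S (tail G a) \<le> count_list S (head G a)"
    "count_list S (head G a) \<le> Suc (count_list S (tail G a))"
    "tail (reverse_along S G) a =
      (if count_list S (head G a) = count_list S (tail G a) then tail G a else head G a)"
    "head (reverse_along S G) a =
      (if count_list S (head G a) = count_list S (tail G a) then head G a else tail G a)"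
    by blast+
qed

lemma compatible_count_admissible:
  assumes "graded_quiver G" "admissible G S"
  shows "compatible_count G (count_list S)"
  using admissible_count_arc[OF assms] admissible_verts[OF assms(2)]
  unfolding compatible_count_def by (auto simp: count_list_0_iff)

text \<open>The sequence is built from the front: a suitable sink of positive multiplicity is
  reflected and its multiplicity lowered by one, which keeps the inequalities for the reversed
  arcs.\<close>

lemma admissible_with_count:
  assumes "graded_quiver G" "compatible_count G m"
  obtains S where "admissible G S" "count_list S = m"
proof -
  have "\<exists>S. admissible G S \<and> count_list S = m"
    using assms
  proof (induction "\<Sum>v\<in>verts G. m v" arbitrary: G m rule: less_induct)
    case less
    interpret fin_digraph G
      using less.prems by (simp add: graded_quiver_def)
    show ?case
    proof (cases "\<forall>v \<in> verts G. m v = 0")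
      case True
      then have "count_list [] = m"
        using less.prems(2) by (auto simp: compatible_count_def fun_eq_iff)
      then show ?thesis
        by (intro exI[of _ "[]"]) simp
    next
      case False
      obtain h :: "'a \<Rightarrow> nat" where h: "\<forall>a \<in> arcs G. h (head G a) < h (tail G a)"
        using less.prems by (auto simp: graded_quiver_def)
      \<comment> \<open>A lowest vertex of the support is a sink: an arrow out of it would end in
        the support again, at a smaller height.\<close>
      obtain v where v: "v \<in> verts G \<and> 0 < m v"
        and min: "\<And>u. u \<in> verts G \<and> 0 < m u \<Longrightarrow> h v \<le> h u"
        using ex_has_least_nat[of "\<lambda>v. v \<in> verts G \<and> 0 < m v" _ h] False by auto
      have "sink G v"
        unfolding sink_iff
      proof (intro conjI ballI notI)
        fix a assume a: "a \<in> arcs G" "tail G a = v"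
        then have "0 < m (head G a)"
          using less.prems(2) v by (metis compatible_count_def not_gr_zero le_zero_eq)
        then show False
          using min[of "head G a"] bspec[OF h a(1)] a by simp
      qed (use v in simp)
      let ?m = "m(v := m v - 1)"
      have compat: "compatible_count (reverse_at v G) ?m"
        unfolding compatible_count_def
      proof (intro conjI ballI)
        fix a assume a: "a \<in> arcs (reverse_at v G)"
        then have "tail G a \<noteq> v" "m (tail G a) \<le> m (head G a)" "m (head G a) \<le> Suc (m (tail G a))"
          using \<open>sink G v\<close> less.prems(2) by (auto simp: sink_iff compatible_count_def)
        then show "?m (tail (reverse_at v G) a) \<le> ?m (head (reverse_at v G) a)"
          "?m (head (reverse_at v G) a) \<le> Suc (?m (tail (reverse_at v G) a))"
          using a by (auto simp: tail_reverse_at head_reverse_at)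
      qed (use less.prems(2) v in \<open>auto simp: compatible_count_def\<close>)
      have "(\<Sum>u\<in>verts G. ?m u) < (\<Sum>u\<in>verts G. m u)"
      proof (rule sum_strict_mono_ex1)
        show "\<exists>u\<in>verts G. ?m u < m u"
          using v by (intro bexI[of _ v]) simp_all
      qed auto
      then have smaller: "(\<Sum>u\<in>verts (reverse_at v G). ?m u) < (\<Sum>u\<in>verts G. m u)"
        by simp
      obtain S where S: "admissible (reverse_at v G) S" "count_list S = ?m"
        using less.hyps[OF smaller graded_quiver_reverse_at[OF less.prems(1) \<open>sink G v\<close>] compat] by blast
      then have "admissible G (v # S)" "count_list (v # S) = m"
        using \<open>sink G v\<close> v by (auto simp: fun_eq_iff)
      then show ?thesis by blast
    qed
  qed
  then show thesis
    using that by blast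
qed

lemma sink_reverse_along_count:
  assumes "graded_quiver G" "admissible G (A @ [v])" "a \<in> arcs G"
  shows "tail G a = v \<Longrightarrow> count_list A (head G a) = Suc (count_list A v)"
    and "head G a = v \<Longrightarrow> count_list A (tail G a) = count_list A v"
proof -
  have A: "admissible G A" and s: "sink (reverse_along A G) v"
    using assms by (auto simp: admissible_append)
  have "tail (reverse_along A G) a \<noteq> v"
    using s assms(3) by (auto simp: sink_iff)
  then show "tail G a = v \<Longrightarrow> count_list A (head G a) = Suc (count_list A v)"
    "head G a = v \<Longrightarrow> count_list A (tail G a) = count_list A v"
    using admissible_count_arc[OF assms(1) A assms(3)] by (auto split: if_splits)
qed

text \<open>When \<open>v\<close> is due, all its arcs point to it. By
  \<open>sink_reverse_along_count\<close> a neighbour then has occurred as often as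
  \<open>v\<close>, or once more, depending only on the direction of the arc in
  \<open>G\<close>.\<close>

lemma neighbour_count_eq:
  assumes "graded_quiver G" "admissible G (A @ [v])" "admissible G (B @ [v])"
    and "count_list A v = count_list B v" "edges_between G u v \<noteq> {}"
  shows "count_list A u = count_list B u"
proof -
  obtain a where a: "a \<in> arcs G" "{tail G a, head G a} = {u, v}"
    using assms(5) by (auto simp: edges_between_def)
  then consider "tail G a = v" "head G a = u" | "tail G a = u" "head G a = v"
    by (auto simp: doubleton_eq_iff)
  then show ?thesis
    using sink_reverse_along_count[OF assms(1,2) a(1)] sink_reverse_along_count[OF assms(1,3) a(1)] assms(4)
    by cases auto
qed

lemma letter_root_far:
  assumes "\<And>b. b \<in> set B \<Longrightarrow> b \<noteq> v \<and> edges_between G b v = {}"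
  shows "letter_root G B v = frag_of v"
  using assms
proof (induction B)
  case (Cons b B)
  then have "letter_root G (b # B) v = simple_reflection G b (frag_of v)"
    by (simp add: letter_root_def weyl_word_append)
  then show ?case
    using Cons.prems by (simp add: simple_reflection_frag_of cartan_entry_def)
qed (simp add: letter_root_def)

lemma seq_equiv_letter_root:
  assumes "seq_equiv G A B"
  shows "letter_root G A v = letter_root G B v"
  using weyl_word_rev_cong[OF seq_equiv_weyl_word[OF assms]] by (simp add: letter_root_def)

text \<open>Write \<open>A\<close> as \<open>C\<close> followed by \<open>D\<close>. At
  \<open>v\<close> and its neighbours \<open>A\<close> and \<open>B\<close> have the same
  multiplicities, hence so has their minimum \<open>C\<close>. Thus \<open>D\<close> contains none
  of these vertices and its reflections fix e_v.\<close>

lemma letter_root_eq_if_count_le: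
  assumes "graded_quiver G" "admissible G (A @ [v])" "admissible G (B @ [v])"
    and "count_list A v = count_list B v" "admissible G C"
    and C: "\<And>u. count_list C u = min (count_list A u) (count_list B u)"
  shows "letter_root G A v = letter_root G C v"
proof -
  have A: "admissible G A"
    using assms by (simp add: admissible_append)
  then obtain D where D: "seq_equiv G A (C @ D)"
    using extend_to_larger_count[OF assms(5), of A] C by auto
  have "d \<noteq> v \<and> edges_between G d v = {}" if "d \<in> set D" for d
  proof (rule ccontr)
    assume "\<not> (d \<noteq> v \<and> edges_between G d v = {})"
    then have "count_list A d = count_list B d"
      using neighbour_count_eq[OF assms(1-4), of d] assms(4) by metis
    moreover have "count_list A d = count_list C d + count_list D d"
      using fun_cong[OF seq_equiv_count[OF D], of d] by simp
    ultimately have "count_list D d = 0"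
      using C[of d] by linarith
    then show False
      using that by (simp add: count_list_0_iff)
  qed
  then show ?thesis
    using seq_equiv_letter_root[OF D, of v] letter_root_far[of D v G]
    by (simp add: letter_root_def weyl_word_append)
qed

lemma compatible_count_min:
  "compatible_count G m \<Longrightarrow> compatible_count G n \<Longrightarrow> compatible_count G (\<lambda>v. min (m v) (n v))"
  unfolding compatible_count_def by (simp add: min_def) fastforce

lemma compatible_count_max:
  "compatible_count G m \<Longrightarrow> compatible_count G n \<Longrightarrow> compatible_count G (\<lambda>v. max (m v) (n v))"
  unfolding compatible_count_def by (simp add: max_def) fastforce

text \<open>Both prefixes are compared with a sequence for the pointwise minimum of their
  multiplicities, which is again realisable.\<close>

lemma letter_root_eq_if_count_eq:
  assumes "graded_quiver G" "admissible G (A @ [v])" "admissible G (B @ [v])"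
    and "count_list A v = count_list B v"
  shows "letter_root G A v = letter_root G B v"
proof -
  have "compatible_count G (\<lambda>u. min (count_list A u) (count_list B u))"
    using assms by (intro compatible_count_min compatible_count_admissible) (auto simp: admissible_append)
  then obtain C where C: "admissible G C" "count_list C = (\<lambda>u. min (count_list A u) (count_list B u))"
    using admissible_with_count assms(1) by blast
  have C': "count_list C u = min (count_list A u) (count_list B u)"
    "count_list C u = min (count_list B u) (count_list A u)" for u
    using C(2) by (simp_all add: min.commute)
  show ?thesis
    using letter_root_eq_if_count_le[OF assms C(1) C'(1)]
      letter_root_eq_if_count_le[OF assms(1,3,2) assms(4)[symmetric] C(1) C'(2)]
    by (rule trans[OF _ sym])
qed

section \<open>Canonical forms, joins and principal sequences\<close>

lemma nat_eq_if_less_iff: "(\<And>i :: nat. i < a \<longleftrightarrow> i < b) \<Longrightarrow> a = b"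
  by (metis linorder_neq_iff)

lemma distinct_count_list: "distinct xs \<Longrightarrow> count_list xs x = of_bool (x \<in> set xs)"
  by (induction xs) auto

text \<open>The supports of the segments decrease and no segment repeats a vertex, so a vertex lies
  exactly in its first k segments, where k is its total multiplicity.\<close>

lemma segment_supp_count:
  assumes "\<And>i. i < length Ss \<Longrightarrow> distinct (Ss ! i) \<and> set (Ss ! i) = set (concat (drop i Ss))"
  shows "segment_supp Ss i = {v. i < count_list (concat Ss) v}"
  using assms
proof (induction Ss arbitrary: i)
  case Nil
  then show ?case by (simp add: segment_supp_def)
next
  case (Cons s Ss)
  have s: "distinct s" "set (concat Ss) \<subseteq> set s"
    using Cons.prems[of 0] by auto
  have count_s: "count_list s v = of_bool (v \<in> set s)" for v
    using s(1) by (rule distinct_count_list)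
  have count_Ss: "count_list (concat Ss) v = 0" if "v \<notin> set s" for v
    using s(2) that by (auto simp: count_list_0_iff)
  show ?case
  proof (cases i)
    case 0
    have "count_list (concat (s # Ss)) v = 0 \<longleftrightarrow> v \<notin> set s" for v
      using s(2) by (auto simp: count_list_0_iff)
    then show ?thesis
      using 0 by (auto simp: segment_supp_def simp flip: neq0_conv)
  next
    case (Suc j)
    have "segment_supp Ss j = {v. j < count_list (concat Ss) v}"
      using Cons.prems[of "Suc k" for k] by (intro Cons.IH) auto
    moreover have "segment_supp (s # Ss) i = segment_supp Ss j"
      using Suc by (simp add: segment_supp_def)
    moreover have "i < count_list (concat (s # Ss)) v \<longleftrightarrow> j < count_list (concat Ss) v" for v
      using Suc count_s[of v] count_Ss[of v] by (cases "v \<in> set s") auto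
    ultimately show ?thesis
      by simp
  qed
qed

lemma canonical_form_segment_supp:
  assumes "canonical_form G T Ss"
  shows "segment_supp Ss i = {v. i < count_list T v}"
  using assms segment_supp_count[of Ss i] seq_equiv_count[of G T "concat Ss"]
  by (auto simp: canonical_form_def)

lemma canonical_form_length:
  assumes "canonical_form G T Ss"
  shows "i < length Ss \<longleftrightarrow> (\<exists>v. i < count_list T v)"
proof -
  have "i < length Ss \<longleftrightarrow> segment_supp Ss i \<noteq> {}"
    using assms unfolding segment_supp_def canonical_form_def by (metis set_empty)
  then show ?thesis
    using canonical_form_segment_supp[OF assms, of i] by simp
qed

lemma canonical_form_nth:
  assumes "canonical_form G T Ss" "i < length Ss"
  shows "set (Ss ! i) = {v. i < count_list T v}"
  using canonical_form_segment_supp[OF assms(1), of i] assms(2) by (simp add: segment_supp_def)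

text \<open>The first segment runs once through the support of \<open>T\<close>. It lies below
  \<open>T\<close>, so it can be split off, and the shorter rest is treated in the same way on the
  reflected quiver.\<close>

lemma canonical_form_exists:
  assumes "graded_quiver G" "admissible G T"
  obtains Ss where "canonical_form G T Ss"
proof -
  have "\<exists>Ss. canonical_form G T Ss"
    using assms
  proof (induction "length T" arbitrary: G T rule: less_induct)
    case less
    show ?case
    proof (cases "T = []")
      case True
      then show ?thesis
        by (intro exI[of _ "[]"]) (simp add: canonical_form_def seq_equiv_refl)
    next
      case False
      \<comment> \<open>Positive multiplicity at a tail forces it at the head; the upper bound is
        automatic for values 0 and 1.\<close>
      have "compatible_count G (\<lambda>v. of_bool (v \<in> set T))"
        using compatible_count_admissible[OF less.prems] unfolding compatible_count_def
        by (fastforce simp: count_list_0_iff simp flip: neq0_conv)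
      then obtain S where S: "admissible G S" "count_list S = (\<lambda>v. of_bool (v \<in> set T))"
        using admissible_with_count less.prems(1) by blast
      have set_S: "v \<in> set S \<longleftrightarrow> v \<in> set T" for v
        using count_list_0_iff[of S v] S(2) by simp
      have "distinct S"
      proof (rule ccontr)
        assume "\<not> distinct S"
        then obtain xs ys zs y where "S = xs @ [y] @ ys @ [y] @ zs"
          using not_distinct_decomp by blast
        then have "count_list S y \<ge> 2"
          by simp
        then show False
          using S(2) by (simp add: of_bool_def split: if_splits)
      qed
      have "count_list S v \<le> count_list T v" for v
        using S(2) count_list_0_iff[of T v] by (cases "v \<in> set T") auto
      then obtain U where U: "seq_equiv G T (S @ U)"
        using extend_to_larger_count[OF S(1) less.prems(2)] by blast
      have count: "count_list T v = count_list S v + count_list U v" for v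
        using fun_cong[OF seq_equiv_count[OF U], of v] by simp
      have mset: "mset T = mset (S @ U)"
        by (rule multiset_eqI) (simp add: count_mset count)
      have "S \<noteq> []"
        using set_S[of "hd T"] False by (cases T) auto
      then have shorter: "length U < length T"
        using mset_eq_length[OF mset] by simp
      have U_adm: "admissible (reverse_along S G) U"
        using U by (simp add: seq_equiv_def admissible_append)
      then obtain Us where Us: "canonical_form (reverse_along S G) U Us"
        using less.hyps[OF shorter graded_quiver_reverse_along[OF less.prems(1) S(1)]] by blast
      then have "seq_equiv (reverse_along S G) U (concat Us)"
        by (simp add: canonical_form_def)
      then have "seq_equiv G (S @ U) (S @ concat Us)"
        using S(1) by (rule seq_equiv_append)
      with U have equiv: "seq_equiv G T (concat (S # Us))"
        using seq_equiv_trans by fastforce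
      have "set (concat (S # Us)) = set S"
        using seq_equiv_count[OF equiv] set_S by (metis count_list_0_iff set_eqI)
      then have "canonical_form G T (S # Us)"
        using Us equiv \<open>S \<noteq> []\<close> \<open>distinct S\<close>
        unfolding canonical_form_def by (auto simp: nth_Cons split: nat.split)
      then show ?thesis by blast
    qed
  qed
  then show thesis
    using that by blast
qed

text \<open>Segment i consists of the vertices of multiplicity greater than i, so uniting segments
  position by position is taking maxima. The cases with an empty sequence in the definition obey the
  same rule.\<close>

lemma is_join_iff_count:
  assumes G: "graded_quiver G" and adm: "admissible G S" "admissible G T"
  shows "is_join G S T R \<longleftrightarrow>
    admissible G R \<and> (\<forall>v. count_list R v = max (count_list S v) (count_list T v))"
    (is "_ \<longleftrightarrow> ?R")
proof (cases "S = [] \<or> T = []")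
  case True
  then have "is_join G S T R \<longleftrightarrow> seq_equiv G R (if T = [] then S else T)"
    by (auto simp: is_join_def)
  also have "\<dots> \<longleftrightarrow> ?R"
    using True adm seq_equiv_iff_count[of G R "if T = [] then S else T"]
    by (auto simp: fun_eq_iff seq_equiv_def)
  finally show ?thesis .
next
  case False
  then have join: "is_join G S T R \<longleftrightarrow> (\<exists>Ss Ts Rs. canonical_form G S Ss \<and> canonical_form G T Ts \<and>
      canonical_form G R Rs \<and> length Rs = max (length Ss) (length Ts) \<and>
      (\<forall>i < length Rs. set (Rs ! i) = segment_supp Ss i \<union> segment_supp Ts i))"
    by (simp add: is_join_def)
  show ?thesis
  proof
    assume "is_join G S T R"
    then obtain Ss Ts Rs where c: "canonical_form G S Ss" "canonical_form G T Ts" "canonical_form G R Rs"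
      and len: "length Rs = max (length Ss) (length Ts)"
      and supp: "\<forall>i < length Rs. set (Rs ! i) = segment_supp Ss i \<union> segment_supp Ts i"
      using join by blast
    have "i < count_list R v \<longleftrightarrow> i < count_list S v \<or> i < count_list T v" for i v
    proof -
      have "segment_supp Rs i = segment_supp Ss i \<union> segment_supp Ts i"
        using len supp by (cases "i < length Rs") (auto simp: segment_supp_def)
      then have "v \<in> segment_supp Rs i \<longleftrightarrow> v \<in> segment_supp Ss i \<or> v \<in> segment_supp Ts i"
        by simp
      then show ?thesis
        unfolding c[THEN canonical_form_segment_supp] by simp
    qed
    then have "count_list R v = max (count_list S v) (count_list T v)" for v
      by (intro nat_eq_if_less_iff) (simp add: less_max_iff_disj)
    then show ?R
      using c(3) by (simp add: canonical_form_def seq_equiv_def)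
  next
    assume R: ?R
    obtain Ss where Ss: "canonical_form G S Ss"
      using canonical_form_exists[OF G adm(1)] .
    obtain Ts where Ts: "canonical_form G T Ts"
      using canonical_form_exists[OF G adm(2)] .
    obtain Rs where Rs: "canonical_form G R Rs"
      using canonical_form_exists[OF G] R by blast
    have "i < length Rs \<longleftrightarrow> i < length Ss \<or> i < length Ts" for i
      using R canonical_form_length[OF Ss, of i] canonical_form_length[OF Ts, of i]
        canonical_form_length[OF Rs, of i] by (auto simp: less_max_iff_disj)
    then have "length Rs = max (length Ss) (length Ts)"
      by (intro nat_eq_if_less_iff) (simp add: less_max_iff_disj)
    moreover have "set (Rs ! i) = segment_supp Ss i \<union> segment_supp Ts i" if "i < length Rs" for i
      unfolding canonical_form_nth[OF Rs that] canonical_form_segment_supp[OF Ss]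
        canonical_form_segment_supp[OF Ts]
      using R by (auto simp: less_max_iff_disj)
    ultimately show "is_join G S T R"
      using join Ss Ts Rs by blast
  qed
qed

lemma compatible_count_foldr_max:
  assumes "graded_quiver G" "\<forall>T \<in> set Ts. admissible G T"
  shows "compatible_count G (\<lambda>v. foldr (\<lambda>T. max (count_list T v)) Ts 0)"
  using assms(2)
proof (induction Ts)
  case Nil
  then show ?case by (simp add: compatible_count_def)
next
  case (Cons T Ts)
  then show ?case
    using compatible_count_max[OF compatible_count_admissible[OF assms(1), of T]] by simp
qed

text \<open>The join of the tail of the list has to exist as an intermediate sequence; it does,
  because maxima of realisable multiplicities are realisable.\<close>

lemma is_join_list_iff_count:
  assumes G: "graded_quiver G" and adm: "\<forall>T \<in> set Ts. admissible G T"
  shows "is_join_list G Ts R \<longleftrightarrow>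
    admissible G R \<and> (\<forall>v. count_list R v = foldr (\<lambda>T. max (count_list T v)) Ts 0)"
  using adm
proof (induction Ts arbitrary: R rule: induct_list012)
  case 1
  then show ?case
    using seq_equiv_iff_count[of G R "[]"] by (auto simp: seq_equiv_def fun_eq_iff)
next
  case (2 T)
  then show ?case
    using seq_equiv_iff_count[of G R T] by (auto simp: seq_equiv_def fun_eq_iff)
next
  case (3 T T' Ts)
  let ?m = "\<lambda>v. foldr (\<lambda>T. max (count_list T v)) (T' # Ts) 0"
  have IH: "is_join_list G (T' # Ts) Q \<longleftrightarrow> admissible G Q \<and> (\<forall>v. count_list Q v = ?m v)" for Q
    using "3.IH"(2) "3.prems" by simp
  have join: "is_join G T Q R \<longleftrightarrow> admissible G R \<and> (\<forall>v. count_list R v = max (count_list T v) (count_list Q v))"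
    if "admissible G Q" for Q
    using is_join_iff_count[OF G _ that] "3.prems" by simp
  have "compatible_count G ?m"
    using "3.prems" by (intro compatible_count_foldr_max G) auto
  then obtain Q where Q: "admissible G Q" "count_list Q = ?m"
    using admissible_with_count G by blast
  have "is_join_list G (T # T' # Ts) R \<longleftrightarrow> (\<exists>Q. is_join_list G (T' # Ts) Q \<and> is_join G T Q R)"
    by simp
  also have "\<dots> \<longleftrightarrow> admissible G R \<and> (\<forall>v. count_list R v = max (count_list T v) (?m v))"
  proof
    assume "\<exists>Q. is_join_list G (T' # Ts) Q \<and> is_join G T Q R"
    then show "admissible G R \<and> (\<forall>v. count_list R v = max (count_list T v) (?m v))"
      using IH join by metis
  next
    assume *: "admissible G R \<and> (\<forall>v. count_list R v = max (count_list T v) (?m v))"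
    have "is_join_list G (T' # Ts) Q"
      unfolding IH using Q by simp
    moreover have "is_join G T Q R"
      unfolding join[OF Q(1)] using * Q(2) by simp
    ultimately show "\<exists>Q. is_join_list G (T' # Ts) Q \<and> is_join G T Q R"
      by blast
  qed
  finally show ?case by simp
qed

lemma le_foldr_max_iff:
  "j < foldr (\<lambda>T. max (f T)) Ts (0 :: nat) \<longleftrightarrow> (\<exists>T \<in> set Ts. j < f T)"
  by (induction Ts) (auto simp: less_max_iff_disj)

lemma split_list_at_count:
  assumes "j < count_list S v"
  obtains A B where "S = A @ v # B" "count_list A v = j"
proof -
  have "\<exists>A B. S = A @ v # B \<and> count_list A v = j"
    using assms
  proof (induction S arbitrary: j)
    case (Cons x S)
    show ?case
    proof (cases "x = v \<and> j = 0")
      case True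
      then show ?thesis
        by (intro exI[of _ "[]"] exI[of _ S]) auto
    next
      case False
      obtain i where i: "i < count_list S v" "j = (if x = v then Suc i else i)"
        using Cons.prems False by (cases j) (auto split: if_splits)
      obtain A B where "S = A @ v # B" "count_list A v = i"
        using Cons.IH[OF i(1)] by blast
      then show ?thesis
        using i(2) by (intro exI[of _ "x # A"] exI[of _ B]) auto
    qed
  qed simp
  then show thesis
    using that by blast
qed

lemma reduced_word_iff_letter_roots:
  assumes "set S \<subseteq> verts G"
  shows "reduced_word G S \<longleftrightarrow> (\<forall>A v B. S = A @ [v] @ B \<longrightarrow> root_nonneg (letter_root G A v))"
proof
  assume red: "reduced_word G S"
  show "\<forall>A v B. S = A @ [v] @ B \<longrightarrow> root_nonneg (letter_root G A v)"
  proof (intro allI impI)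
    fix A v B i assume "S = A @ [v] @ B"
    then have "reduced_word G (A @ [v])" "set (A @ [v]) \<subseteq> verts G"
      using reduced_word_append(1)[of G "A @ [v]" B] red assms by auto
    then show "0 \<le> Poly_Mapping.lookup (letter_root G A v) i"
      using letter_root_nonneg_if_reduced[of G A v] by blast
  qed
qed (use reduced_if_letter_roots_nonneg[OF assms] in blast)

text \<open>Identify a letter by its vertex and the number of earlier occurrences. The letters of a
  join are then the union of the letters of its parts, and the root depends on nothing else.\<close>

lemma reduced_word_join:
  assumes G: "graded_quiver G" and adm: "admissible G S" "\<forall>T \<in> set Ts. admissible G T"
    and join: "is_join_list G Ts S"
  shows "reduced_word G S \<longleftrightarrow> (\<forall>T \<in> set Ts. reduced_word G T)"
proof -
  have count: "j < count_list S v \<longleftrightarrow> (\<exists>T \<in> set Ts. j < count_list T v)" for j v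
    using join unfolding is_join_list_iff_count[OF G adm(2)] by (simp add: le_foldr_max_iff)
  have transfer: "\<exists>A' B'. U' = A' @ [v] @ B' \<and> letter_root G A' v = letter_root G A v"
    if U: "admissible G U" "U = A @ [v] @ B" and U': "admissible G U'" "count_list A v < count_list U' v"
    for U U' A v B
  proof -
    obtain A' B' where *: "U' = A' @ v # B'" "count_list A' v = count_list A v"
      using split_list_at_count[OF U'(2)] .
    have "admissible G (A @ [v])"
      using U by (simp add: admissible_append)
    moreover have "admissible G (A' @ [v])"
      using U'(1) *(1) by (simp add: admissible_append)
    ultimately have "letter_root G A' v = letter_root G A v"
      using letter_root_eq_if_count_eq[OF G] *(2) by blast
    then show ?thesis
      using *(1) by auto
  qed
  have red: "reduced_word G U \<longleftrightarrow> (\<forall>A v B. U = A @ [v] @ B \<longrightarrow> root_nonneg (letter_root G A v))"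
    if "admissible G U" for U
    using that by (intro reduced_word_iff_letter_roots admissible_verts)
  show ?thesis
  proof
    assume S: "reduced_word G S"
    show "\<forall>T \<in> set Ts. reduced_word G T"
    proof
      fix T assume T: "T \<in> set Ts"
      show "reduced_word G T"
      proof (rule reduced_if_letter_roots_nonneg)
        fix A v B assume eq: "T = A @ [v] @ B"
        then have "count_list A v < count_list S v"
          unfolding count using T by (intro bexI[of _ T]) auto
        then obtain A' B' where "S = A' @ [v] @ B'" "letter_root G A' v = letter_root G A v"
          using transfer[OF _ eq adm(1)] adm(2) T by blast
        then show "root_nonneg (letter_root G A v)"
          using S red[OF adm(1)] by metis
      qed (use adm(2) T admissible_verts in auto)
    qed
  next
    assume T: "\<forall>T \<in> set Ts. reduced_word G T"
    show "reduced_word G S"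
    proof (rule reduced_if_letter_roots_nonneg)
      fix A v B assume eq: "S = A @ [v] @ B"
      then have "count_list A v < count_list S v"
        by simp
      then obtain T where T': "T \<in> set Ts" "count_list A v < count_list T v"
        using count by blast
      then obtain A' B' where "T = A' @ [v] @ B'" "letter_root G A' v = letter_root G A v"
        using transfer[OF adm(1) eq] adm(2) by blast
      then show "root_nonneg (letter_root G A v)"
        using T T'(1) red[of T] adm(2) by metis
    qed (use adm(1) admissible_verts in auto)
  qed
qed

section \<open>Filter hulls and the existence of principal join expressions\<close>

lemma up_set_verts:
  assumes "graded_quiver G"
  shows "up_set G (verts G)"
  by (auto simp: up_set_def elim: reachable_in_vertsE)

lemma edges_between_verts:
  assumes "graded_quiver G" "edges_between G x y \<noteq> {}"
  shows "x \<in> verts G" "y \<in> verts G"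
proof -
  interpret fin_digraph G
    using assms by (simp add: graded_quiver_def)
  obtain a where "a \<in> arcs G" "{tail G a, head G a} = {x, y}"
    using assms(2) by (auto simp: edges_between_def)
  then show "x \<in> verts G" "y \<in> verts G"
    using tail_in_verts[of a] head_in_verts[of a] by (auto simp: doubleton_eq_iff)
qed

lemma filter_hull_least:
  assumes "up_set G F'" "F \<subseteq> F'" "\<And>x y. x \<in> F \<Longrightarrow> edges_between G x y \<noteq> {} \<Longrightarrow> y \<in> F'"
  shows "filter_hull G F \<subseteq> F'"
  using assms unfolding filter_hull_def by (intro Inter_lower) auto

lemma filter_hull_superset: "F \<subseteq> filter_hull G F"
  unfolding filter_hull_def by auto

lemma filter_hull_neighbour: "x \<in> F \<Longrightarrow> edges_between G x y \<noteq> {} \<Longrightarrow> y \<in> filter_hull G F"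
  unfolding filter_hull_def by auto

lemma up_set_filter_hull:
  assumes "graded_quiver G" "F \<subseteq> verts G"
  shows "up_set G (filter_hull G F)"
proof -
  have "filter_hull G F \<subseteq> verts G"
    by (rule filter_hull_least[OF up_set_verts[OF assms(1)] assms(2) edges_between_verts(2)[OF assms(1)]])
  moreover have "y \<in> filter_hull G F" if "x \<in> filter_hull G F" "x \<rightarrow>\<^sup>*\<^bsub>G\<^esub> y" for x y
    unfolding filter_hull_def
  proof (intro InterI)
    fix F' assume F': "F' \<in> {F'. up_set G F' \<and> F \<subseteq> F' \<and>
                      (\<forall>x \<in> F. \<forall>y. edges_between G x y \<noteq> {} \<longrightarrow> y \<in> F')}"
    then have "x \<in> F'"
      using that(1) unfolding filter_hull_def by blast
    then show "y \<in> F'"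
      using F' that(2) by (simp add: up_set_def)
  qed
  ultimately show ?thesis
    by (simp add: up_set_def)
qed

lemma up_set_arc:
  assumes "up_set G F" "graded_quiver G" "a \<in> arcs G" "tail G a \<in> F"
  shows "head G a \<in> F"
proof -
  interpret fin_digraph G
    using assms by (simp add: graded_quiver_def)
  have "tail G a \<rightarrow>\<^sup>*\<^bsub>G\<^esub> head G a"
    using assms(3) by (intro reachable_adjI) (auto simp: arcs_ends_conv)
  then show ?thesis
    using assms by (auto simp: up_set_def)
qed

lemma up_set_count_ge:
  assumes "graded_quiver G" "admissible G S" "0 < c"
  shows "up_set G {u. c \<le> count_list S u}"
proof -
  have "count_list S x \<le> count_list S y" if "x \<rightarrow>\<^sup>*\<^bsub>G\<^esub> y" for x y
    using that unfolding reachable_def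
  proof (induction rule: rtrancl_on_induct)
    case (step y z)
    then obtain a where "a \<in> arcs G" "tail G a = y" "head G a = z"
      by (auto simp: arcs_ends_conv)
    then show ?case
      using admissible_count_arc(1)[OF assms(1,2)] step.IH by fastforce
  qed simp
  then have mono: "c \<le> count_list S y" if "x \<rightarrow>\<^sup>*\<^bsub>G\<^esub> y" "c \<le> count_list S x" for x y
    using that order_trans by blast
  have "u \<in> verts G" if "c \<le> count_list S u" for u
  proof -
    have "u \<in> set S"
      using assms(3) that count_list_0_iff[of S u] by linarith
    then show ?thesis
      using admissible_verts[OF assms(2)] by auto
  qed
  then show ?thesis
    unfolding up_set_def using mono by auto
qed

lemma count_le_Suc_neighbour:
  assumes "graded_quiver G" "admissible G S" "edges_between G x y \<noteq> {}"
  shows "count_list S x \<le> Suc (count_list S y)"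
proof -
  obtain a where a: "a \<in> arcs G" "{tail G a, head G a} = {x, y}"
    using assms(3) by (auto simp: edges_between_def)
  then show ?thesis
    using admissible_count_arc(1,2)[OF assms(1,2) a(1)] by (auto simp: doubleton_eq_iff)
qed

text \<open>The smallest candidate with the same multiplicity r at \<open>v\<close>: its last
  segment is the principal filter of \<open>v\<close>, and each step to the left takes a hull. The
  point is that it stays below \<open>S\<close>.\<close>

lemma principal_seq_exists:
  assumes G: "graded_quiver G" and S: "admissible G S" and v: "v \<in> set S"
  obtains T where "principal_seq G T" "count_list T v = count_list S v"
    "\<And>u. count_list T u \<le> count_list S u"
proof -
  define r where "r = count_list S v"
  define H where "H = (\<lambda>k. (filter_hull G ^^ k) (principal_up_set G v))"
  \<comment> \<open>The number of hulls needed to reach \<open>u\<close>. The disjunct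
    \<open>r \<le> k\<close> makes the minimum exist and caps it at \<open>r\<close>, so that
    vertices not reached in time get multiplicity 0.\<close>
  define l where "l = (\<lambda>u. LEAST k. r \<le> k \<or> u \<in> H k)"
  define m where "m = (\<lambda>u. r - l u)"
  have r: "0 < r"
    using v count_list_0_iff[of S v] unfolding r_def by auto
  have v_verts: "v \<in> verts G"
    using v admissible_verts[OF S] by auto
  have H_Suc: "H (Suc k) = filter_hull G (H k)" for k
    by (simp add: H_def)
  have up_H: "up_set G (H k)" for k
  proof (induction k)
    case 0
    interpret fin_digraph G
      using G by (simp add: graded_quiver_def)
    show ?case
      by (auto simp: H_def principal_up_set_def up_set_def elim: reachable_in_vertsE intro: reachable_trans)
  next
    case (Suc k)
    then show ?case
      unfolding H_Suc by (intro up_set_filter_hull G) (simp add: up_set_def)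
  qed
  have mono_H: "H k \<subseteq> H k'" if "k \<le> k'" for k k'
    using that by (rule lift_Suc_mono_le[rotated]) (simp add: H_Suc filter_hull_superset)
  have v_H: "v \<in> H 0"
    using v_verts by (simp add: H_def principal_up_set_def reachable_def rtrancl_on_refl)
  have l_le: "l u \<le> k \<longleftrightarrow> r \<le> k \<or> u \<in> H k" for u k
  proof
    assume "l u \<le> k"
    moreover have "r \<le> l u \<or> u \<in> H (l u)"
      unfolding l_def by (rule LeastI_ex) auto
    ultimately show "r \<le> k \<or> u \<in> H k"
      using mono_H[of "l u" k] by auto
  qed (auto simp: l_def intro: Least_le)
  have m_gt: "i < m u \<longleftrightarrow> i < r \<and> u \<in> H (r - Suc i)" for i u
    using l_le[of u "r - Suc i"] r unfolding m_def by auto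
  have m_v: "m v = r"
    using l_le[of v 0] v_H by (simp add: m_def)
  \<comment> \<open>One hull costs at most one occurrence: multiplicities in \<open>S\<close> at
    adjacent vertices differ by at most 1, and the sets of vertices with multiplicity at least c > 0
    are filters.\<close>
  have H_count: "H k \<subseteq> {u. r - k \<le> count_list S u}" if "k < r" for k
    using that
  proof (induction k)
    case 0
    have "up_set G {u. r \<le> count_list S u}"
      using G S r by (rule up_set_count_ge)
    then show ?case
      by (auto simp: H_def principal_up_set_def up_set_def r_def)
  next
    case (Suc k)
    have "up_set G {u. r - Suc k \<le> count_list S u}"
      using G S Suc.prems by (intro up_set_count_ge) auto
    moreover have "r - Suc k \<le> count_list S y" if "x \<in> H k" "edges_between G x y \<noteq> {}" for x y
      using Suc that count_le_Suc_neighbour[OF G S that(2)] by fastforce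
    ultimately show ?case
      unfolding H_Suc using Suc by (intro filter_hull_least) auto
  qed
  have m_le: "m u \<le> count_list S u" for u
  proof (cases "m u")
    case (Suc i)
    then show ?thesis
      using m_gt[of i u] H_count[of "r - Suc i"] by auto
  qed simp
  have "compatible_count G m"
    unfolding compatible_count_def
  proof (intro conjI ballI allI impI)
    fix u assume "u \<notin> verts G"
    then have "u \<notin> H k" for k
      using up_H by (auto simp: up_set_def)
    then show "m u = 0"
      using m_gt[of 0 u] by auto
  next
    fix a assume a: "a \<in> arcs G"
    \<comment> \<open>The sets \<open>H k\<close> are filters, so the head is reached no later than
      the tail. Conversely the tail is adjacent to the head and hence belongs to the next
      hull.\<close>
    have "l (head G a) \<le> l (tail G a)"
      using l_le[of "head G a"] l_le[of "tail G a" "l (tail G a)"] up_set_arc[OF up_H G a] by auto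
    then show "m (tail G a) \<le> m (head G a)"
      by (simp add: m_def diff_le_mono2)
    have "edges_between G (head G a) (tail G a) \<noteq> {}"
      using a by (auto simp: edges_between_def)
    then have "l (tail G a) \<le> Suc (l (head G a))"
      using l_le[of "tail G a" "Suc (l (head G a))"] l_le[of "head G a" "l (head G a)"]
        filter_hull_neighbour[of "head G a" "H (l (head G a))" G] by (auto simp: H_Suc)
    then show "m (head G a) \<le> Suc (m (tail G a))"
      by (simp add: m_def)
  qed
  then obtain T where T: "admissible G T" "count_list T = m"
    using admissible_with_count[OF G] by blast
  obtain Ts where Ts: "canonical_form G T Ts"
    using canonical_form_exists[OF G T(1)] .
  have "i < length Ts \<longleftrightarrow> i < r" for i
    using canonical_form_length[OF Ts, of i] m_gt m_v T(2) by metis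
  then have len: "length Ts = r"
    by (rule nat_eq_if_less_iff)
  have nth: "set (Ts ! i) = H (r - Suc i)" if "i < r" for i
    using canonical_form_nth[OF Ts, of i] that len m_gt T(2) by auto
  have "set (Ts ! i) = filter_hull G (set (Ts ! Suc i))" if "Suc i < length Ts" for i
    using nth[of i] nth[of "Suc i"] that len H_Suc[of "r - Suc (Suc i)"] by (simp add: Suc_diff_Suc)
  moreover have "set (last Ts) = principal_up_set G v"
    using nth[of "r - 1"] r len by (subst last_conv_nth) (auto simp: H_def)
  moreover have "T \<noteq> []"
    using T(2) m_v r by auto
  ultimately have "principal_seq G T"
    unfolding principal_seq_def using T(1) Ts v_verts by blast
  then show thesis
    using that T(2) m_v m_le r_def by simp
qed

text \<open>Take one principal sequence for each letter of \<open>S\<close>. Each attains the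
  multiplicity of \<open>S\<close> at its own vertex and exceeds it nowhere, so the pointwise
  maximum is that of \<open>S\<close>.\<close>

lemma principal_join_expr_exists:
  assumes G: "graded_quiver G" and S: "admissible G S"
  obtains Ts where "principal_join_expr G S Ts"
proof -
  have "\<exists>T. principal_seq G T \<and> count_list T v = count_list S v \<and> (\<forall>u. count_list T u \<le> count_list S u)"
    if "v \<in> set S" for v
    using principal_seq_exists[OF G S that] by metis
  then obtain f where f: "\<And>v. v \<in> set S \<Longrightarrow> principal_seq G (f v) \<and> count_list (f v) v = count_list S v \<and>
      (\<forall>u. count_list (f v) u \<le> count_list S u)"
    by metis
  let ?Ts = "map f S"
  have adm: "\<forall>T \<in> set ?Ts. admissible G T"
    using f by (auto simp: principal_seq_def)
  have "count_list S v = foldr (\<lambda>T. max (count_list T v)) ?Ts 0" for v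
  proof -
    have "j < count_list S v \<longleftrightarrow> (\<exists>T \<in> set ?Ts. j < count_list T v)" for j
    proof
      assume j: "j < count_list S v"
      then have "v \<in> set S"
        using count_list_0_iff[of S v] by auto
      then show "\<exists>T \<in> set ?Ts. j < count_list T v"
        using f[of v] j by (intro bexI[of _ "f v"]) auto
    next
      assume "\<exists>T \<in> set ?Ts. j < count_list T v"
      then show "j < count_list S v"
        using f by (auto intro: less_le_trans)
    qed
    then show ?thesis
      by (intro nat_eq_if_less_iff) (simp only: le_foldr_max_iff)
  qed
  then have "is_join_list G ?Ts S"
    using is_join_list_iff_count[OF G adm] S by blast
  then show thesis
    using f by (intro that[of ?Ts]) (auto simp: principal_join_expr_def)
qed

lemma minimal_principal_join_expr_exists:
  assumes "graded_quiver G" "admissible G S"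
  shows "\<exists>Ts. minimal_principal_join_expr G S Ts"
  unfolding minimal_principal_join_expr_def
  using principal_join_expr_exists[OF assms] ex_has_least_nat[of "principal_join_expr G S" _ length]
  by metis

lemma reduced_word_principal_join:
  assumes "graded_quiver G" "admissible G S" "principal_join_expr G S Ts"
  shows "reduced_word G S \<longleftrightarrow> (\<forall>T \<in> set Ts. reduced_word G T)"
  using assms by (intro reduced_word_join) (auto simp: principal_join_expr_def principal_seq_def)

section \<open>Linear algebra in the coordinate space\<close>

interpretation coord_pair: vector_space_pair
  "coord_scale :: 'k::field \<Rightarrow> ('e, 'k) coord_vec \<Rightarrow> _" "coord_scale :: 'k \<Rightarrow> ('e, 'k) coord_vec \<Rightarrow> _"
  by unfold_locales

abbreviation coord_linear :: "(('e, 'k::field) coord_vec \<Rightarrow> ('e, 'k) coord_vec) \<Rightarrow> bool" where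
  "coord_linear \<equiv> Vector_Spaces.linear coord_scale coord_scale"

lemma coord_linearI:
  assumes "\<And>u v. f (u + v) = f u + f v" "\<And>c u. f (coord_scale c u) = coord_scale c (f u)"
  shows "coord_linear f"
  using assms by unfold_locales auto

lemma coord_linearD:
  assumes "coord_linear f"
  shows "f (u + v) = f u + f v" "f (u - v) = f u - f v" "f (coord_scale c u) = coord_scale c (f u)"
    "f 0 = 0" "f (sum h A) = (\<Sum>a\<in>A. f (h a))"
proof -
  interpret f: Vector_Spaces.linear coord_scale coord_scale f
    by fact
  show "f (u + v) = f u + f v" "f (u - v) = f u - f v" "f (coord_scale c u) = coord_scale c (f u)"
    "f 0 = 0" "f (sum h A) = (\<Sum>a\<in>A. f (h a))"
    by (simp_all add: f.add f.diff f.scale f.sum)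
qed

lemma linear_betweenI:
  assumes "\<And>u. u \<in> V \<Longrightarrow> f u \<in> W" "\<And>u v. u \<in> V \<Longrightarrow> v \<in> V \<Longrightarrow> f (u + v) = f u + f v"
    "\<And>c u. u \<in> V \<Longrightarrow> f (coord_scale c u) = coord_scale c (f u)"
  shows "linear_between V W f"
  using assms by (auto simp: linear_between_def)

lemma linear_between_coord_linear:
  assumes "coord_linear f" "\<And>u. u \<in> V \<Longrightarrow> f u \<in> W"
  shows "linear_between V W f"
  by (rule linear_betweenI) (simp_all add: assms(2) coord_linearD[OF assms(1)])

text \<open>Makes the theory of linear maps on the whole coordinate space available for maps that
  are meaningful only on a subspace.\<close>

lemma linear_between_extend:
  assumes V: "coord.subspace V" and f: "linear_between V W f"
  obtains g where "coord_linear g" "\<And>u. u \<in> V \<Longrightarrow> g u = f u"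
proof -
  obtain C where C: "C \<subseteq> V" "coord.independent C" "V \<subseteq> coord.span C"
    by (rule coord.maximal_independent_subset)
  obtain g where g: "coord_linear g" "\<forall>x\<in>C. g x = f x"
    using coord_pair.linear_independent_extend[OF C(2), of f] by blast
  have f0: "f 0 = 0"
    using f coord.subspace_0[OF V] unfolding linear_between_def by (metis add_cancel_left_right)
  have "coord.subspace {u \<in> V. g u = f u}"
    using V f f0 g(1) by (auto simp: coord.subspace_def linear_between_def coord_linearD[OF g(1)])
  then have "coord.span C \<subseteq> {u \<in> V. g u = f u}"
    using C(1) g(2) by (intro coord.span_minimal) auto
  then show thesis
    using C(3) g(1) that by blast
qed

lemma linear_betweenD:
  assumes "linear_between V W f" "coord.subspace V"
  shows "u \<in> V \<Longrightarrow> f u \<in> W"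
    "u \<in> V \<Longrightarrow> v \<in> V \<Longrightarrow> f (u + v) = f u + f v"
    "u \<in> V \<Longrightarrow> v \<in> V \<Longrightarrow> f (u - v) = f u - f v"
    "u \<in> V \<Longrightarrow> f (coord_scale c u) = coord_scale c (f u)"
    "f 0 = 0"
    "(\<And>a. a \<in> A \<Longrightarrow> h a \<in> V) \<Longrightarrow> f (sum h A) = (\<Sum>a\<in>A. f (h a))"
proof -
  obtain g where g: "coord_linear g" "\<And>u. u \<in> V \<Longrightarrow> g u = f u"
    using linear_between_extend[OF assms(2,1)] by blast
  note V = coord.subspace_add[OF assms(2)] coord.subspace_diff[OF assms(2)]
    coord.subspace_scale[OF assms(2)] coord.subspace_0[OF assms(2)] coord.subspace_sum[OF assms(2)]
  show "u \<in> V \<Longrightarrow> f u \<in> W"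
    using assms(1) by (auto simp: linear_between_def)
  show "u \<in> V \<Longrightarrow> v \<in> V \<Longrightarrow> f (u + v) = f u + f v"
    "u \<in> V \<Longrightarrow> v \<in> V \<Longrightarrow> f (u - v) = f u - f v"
    "u \<in> V \<Longrightarrow> f (coord_scale c u) = coord_scale c (f u)"
    "f 0 = 0"
    "(\<And>a. a \<in> A \<Longrightarrow> h a \<in> V) \<Longrightarrow> f (sum h A) = (\<Sum>a\<in>A. f (h a))"
    by (simp_all flip: g(2) add: V coord_linearD[OF g(1)])
qed

lemma linear_between_compose:
  "linear_between U V f \<Longrightarrow> linear_between V W g \<Longrightarrow> linear_between U W (\<lambda>u. g (f u))"
  by (simp add: linear_between_def image_subset_iff)

lemma linear_between_sum:
  assumes "coord.subspace W" "\<And>a. a \<in> A \<Longrightarrow> linear_between V W (f a)"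
  shows "linear_between V W (\<lambda>u. \<Sum>a\<in>A. f a u)"
proof (rule linear_betweenI)
  fix u v c assume u: "u \<in> V"
  show "(\<Sum>a\<in>A. f a u) \<in> W"
    by (rule coord.subspace_sum[OF assms(1)])
      (use assms(2) u in \<open>simp add: linear_between_def image_subset_iff\<close>)
  show "(\<Sum>a\<in>A. f a (coord_scale c u)) = coord_scale c (\<Sum>a\<in>A. f a u)"
    unfolding coord.scale_sum_right
    by (rule sum.cong[OF refl]) (use assms(2) u in \<open>simp add: linear_between_def\<close>)
  assume v: "v \<in> V"
  show "(\<Sum>a\<in>A. f a (u + v)) = (\<Sum>a\<in>A. f a u) + (\<Sum>a\<in>A. f a v)"
    unfolding sum.distrib[symmetric]
    by (rule sum.cong[OF refl]) (use assms(2) u v in \<open>simp add: linear_between_def\<close>)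
qed

lemma linear_between_inv_into:
  assumes f: "linear_between V W f" and V: "coord.subspace V" and inj: "inj_on f V"
  shows "linear_between (f ` V) V (inv_into V f)"
proof (rule linear_betweenI)
  note lin = linear_betweenD[OF f V]
  note inv = inv_into_f_f[OF inj]
  fix w assume "w \<in> f ` V"
  then obtain u where u: "u \<in> V" "w = f u"
    by blast
  show "inv_into V f w \<in> V"
    using u inv by simp
  show "inv_into V f (coord_scale c w) = coord_scale c (inv_into V f w)" for c
    unfolding u(2) inv[OF u(1)] lin(4)[OF u(1), symmetric]
    by (rule inv[OF coord.subspace_scale[OF V u(1)]])
  fix w' assume "w' \<in> f ` V"
  then obtain u' where u': "u' \<in> V" "w' = f u'"
    by blast
  show "inv_into V f (w + w') = inv_into V f w + inv_into V f w'"
    unfolding u(2) u'(2) inv[OF u(1)] inv[OF u'(1)] lin(2)[OF u(1) u'(1), symmetric]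
    by (rule inv[OF coord.subspace_add[OF V u(1) u'(1)]])
qed

lemma findim_subspace_subset:
  assumes "findim_subspace V" "coord.subspace U" "U \<subseteq> V"
  shows "findim_subspace U"
proof -
  obtain B where B: "finite B" "V = coord.span B"
    using assms(1) by (auto simp: findim_subspace_def)
  obtain C where C: "C \<subseteq> U" "coord.independent C" "U \<subseteq> coord.span C"
    by (rule coord.maximal_independent_subset)
  have "finite C"
    using coord.independent_span_bound[OF B(1) C(2)] C(1) assms(3) B(2) by blast
  moreover have "U = coord.span C"
    using C(1,3) coord.span_minimal[OF C(1) assms(2)] by blast
  ultimately show ?thesis
    using assms(2) by (auto simp: findim_subspace_def)
qed

lemma findim_subspace_imp_subspace: "findim_subspace V \<Longrightarrow> coord.subspace V"
  by (simp add: findim_subspace_def)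

lemma findim_subspace_span: "finite B \<Longrightarrow> findim_subspace (coord.span B)"
  by (auto simp: findim_subspace_def)

lemma findim_subspace_image:
  assumes "findim_subspace V" "coord_linear g"
  shows "findim_subspace (g ` V)"
proof -
  interpret g: Vector_Spaces.linear coord_scale coord_scale g
    by fact
  obtain B where "finite B" "V = coord.span B"
    using assms(1) by (auto simp: findim_subspace_def)
  then have "g ` V = coord.span (g ` B)" "finite (g ` B)"
    by (simp_all add: g.span_image)
  then show ?thesis
    by (simp add: findim_subspace_span)
qed

lemma subspace_kernel:
  assumes "linear_between V W f" "coord.subspace V"
  shows "coord.subspace {u \<in> V. f u = 0}"
  using assms linear_betweenD[OF assms] by (auto simp: coord.subspace_def)

lemma subspace_image_between:
  assumes "coord.subspace V" "linear_between V W f"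
  shows "coord.subspace (f ` V)"
proof -
  obtain g where g: "coord_linear g" "\<And>u. u \<in> V \<Longrightarrow> g u = f u"
    using linear_between_extend[OF assms] by blast
  interpret g: Vector_Spaces.linear coord_scale coord_scale g
    by fact
  show ?thesis
    using g.subspace_image[OF assms(1)] g(2) by simp
qed

lemma linear_between_subset:
  "linear_between V W f \<Longrightarrow> U \<subseteq> V \<Longrightarrow> (\<And>u. u \<in> U \<Longrightarrow> f u \<in> X) \<Longrightarrow> linear_between U X f"
  unfolding linear_between_def by blast

text \<open>A basis \<open>B\<close> of \<open>K\<close> is extended by \<open>D\<close> to one of
  \<open>V\<close>. The linear map that kills \<open>B\<close> and fixes \<open>D\<close> shows that
  the two spans meet only in 0.\<close>

lemma kernel_complement:
  assumes K: "coord.subspace K" "K \<subseteq> V" and V: "coord.subspace V"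
  obtains B D where "B \<inter> D = {}" "coord.independent (B \<union> D)" "K = coord.span B"
    "V = coord.span (B \<union> D)" "coord.span B \<inter> coord.span D \<subseteq> {0}"
proof -
  obtain B where B: "B \<subseteq> K" "coord.independent B" "K \<subseteq> coord.span B"
    by (rule coord.maximal_independent_subset)
  obtain C where C: "B \<subseteq> C" "C \<subseteq> V" "coord.independent C" "V \<subseteq> coord.span C"
    by (rule coord.maximal_independent_subset_extend[OF order_trans[OF B(1) K(2)] B(2)])
  define D where "D = C - B"
  have C_eq: "C = B \<union> D"
    using C(1) by (auto simp: D_def)
  obtain p where p: "coord_linear p" "\<forall>x\<in>C. p x = (if x \<in> D then x else 0)"
    using coord_pair.linear_independent_extend[OF C(3), of "\<lambda>x. if x \<in> D then x else 0"] by blast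
  have "coord.span B \<subseteq> {u. p u = 0}"
    using p C(1) by (intro coord.span_minimal) (auto simp: coord.subspace_def coord_linearD[OF p(1)] D_def)
  moreover have "coord.span D \<subseteq> {u. p u = u}"
    using p by (intro coord.span_minimal) (auto simp: coord.subspace_def coord_linearD[OF p(1)] D_def)
  ultimately have "p u = 0 \<and> p u = u" if "u \<in> coord.span B \<inter> coord.span D" for u
    using that by blast
  then have "coord.span B \<inter> coord.span D \<subseteq> {0}"
    by (metis singletonI subsetI)
  moreover have "K = coord.span B"
    using B coord.span_minimal[OF B(1) K(1)] by blast
  moreover have "V = coord.span C"
    using C coord.span_minimal[OF C(2) V] by blast
  moreover have "B \<inter> D = {}"
    by (auto simp: D_def)
  ultimately show thesis
    using that[of B D] C(3) unfolding C_eq by simp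
qed

text \<open>The projection along \<open>K\<close> onto a complement in the whole coordinate space.
  Its image of a subspace containing \<open>K\<close> serves as the quotient by \<open>K\<close>,
  without leaving that space.\<close>

lemma linear_with_kernel:
  assumes "coord.subspace K"
  obtains g where "coord_linear g" "\<And>u. g u = 0 \<longleftrightarrow> u \<in> K"
proof -
  obtain B D where BD: "B \<inter> D = {}" "coord.independent (B \<union> D)" "K = coord.span B"
    "UNIV = coord.span (B \<union> D)"
    using kernel_complement[OF assms subset_UNIV coord.subspace_UNIV] by metis
  obtain p where p: "coord_linear p" "\<forall>x\<in>B \<union> D. p x = (if x \<in> D then x else 0)"
    using coord_pair.linear_independent_extend[OF BD(2), of "\<lambda>x. if x \<in> D then x else 0"] by blast
  have "coord.span B \<subseteq> {u. p u = 0}"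
    using p BD(1) by (intro coord.span_minimal) (auto simp: coord.subspace_def coord_linearD[OF p(1)])
  moreover have "coord.span (B \<union> D) \<subseteq> {u. u - p u \<in> coord.span B}"
  proof (rule coord.span_minimal)
    show "coord.subspace {u. u - p u \<in> coord.span B}"
    proof (rule coord.subspaceI)
      fix u v c assume uv: "u \<in> {u. u - p u \<in> coord.span B}"
      then have "coord_scale c (u - p u) \<in> coord.span B"
        by (auto intro: coord.span_scale)
      then show "coord_scale c u \<in> {u. u - p u \<in> coord.span B}"
        using p(1) by (simp add: coord_linearD[OF p(1)] coord.scale_right_diff_distrib)
      assume v: "v \<in> {u. u - p u \<in> coord.span B}"
      have "(u - p u) + (v - p v) \<in> coord.span B"
        using uv v by (auto intro: coord.span_add)
      then show "u + v \<in> {u. u - p u \<in> coord.span B}"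
        using p(1) by (simp add: coord_linearD[OF p(1)] algebra_simps)
    qed (use p(1) in \<open>simp add: coord_linearD[OF p(1)] coord.span_zero\<close>)
    show "B \<union> D \<subseteq> {u. u - p u \<in> coord.span B}"
      using p(2) BD(1) by (auto intro: coord.span_base coord.span_zero)
  qed
  ultimately have "(u \<in> K \<longrightarrow> p u = 0) \<and> u - p u \<in> K" for u
    using BD(3,4) by blast
  then have "p u = 0 \<longleftrightarrow> u \<in> K" for u
    by (metis diff_zero)
  then show thesis
    using that p(1) by blast
qed

text \<open>A projection onto the line of \<open>u0\<close>, needed as a rank one endomorphism to be
  tested against a brick.\<close>

lemma linear_functional_fixing:
  assumes "u0 \<noteq> 0"
  obtains p where "coord_linear p" "p u0 = u0" "\<And>u. \<exists>c. p u = coord_scale c u0"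
proof -
  obtain B D where BD: "B \<inter> D = {}" "coord.independent (B \<union> D)" "coord.span {u0} = coord.span B"
    "UNIV = coord.span (B \<union> D)"
    using kernel_complement[OF coord.subspace_span subset_UNIV coord.subspace_UNIV, of "{u0}"] by metis
  obtain p where p: "coord_linear p" "\<forall>x\<in>B \<union> D. p x = (if x \<in> B then x else 0)"
    using coord_pair.linear_independent_extend[OF BD(2), of "\<lambda>x. if x \<in> B then x else 0"] by blast
  have "coord.span B \<subseteq> {u. p u = u}"
    using p by (intro coord.span_minimal) (auto simp: coord.subspace_def coord_linearD[OF p(1)])
  then have "p u0 = u0"
    using BD(3) coord.span_base[of u0 "{u0}"] by auto
  moreover have "coord.span (B \<union> D) \<subseteq> {u. p u \<in> coord.span B}"
    using p by (intro coord.span_minimal)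
      (auto simp: coord.subspace_def coord_linearD[OF p(1)] intro: coord.span_add coord.span_scale coord.span_zero coord.span_base)
  then have "\<exists>c. p u = coord_scale c u0" for u
    using BD(3,4) coord.span_singleton[of u0] by blast
  ultimately show thesis
    using that p(1) by blast
qed

lemma rank_nullity:
  assumes V: "findim_subspace V" and f: "linear_between V W f"
  shows "findim_subspace (f ` V)" "coord.dim V = coord.dim {u \<in> V. f u = 0} + coord.dim (f ` V)"
proof -
  have sub: "coord.subspace V"
    using V by (rule findim_subspace_imp_subspace)
  obtain g where g: "coord_linear g" "\<And>u. u \<in> V \<Longrightarrow> g u = f u"
    using linear_between_extend[OF sub f] by blast
  interpret g: Vector_Spaces.linear coord_scale coord_scale g
    by fact
  have img: "f ` V = g ` V"
    using g(2) by simp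
  show "findim_subspace (f ` V)"
    unfolding img using V g(1) by (rule findim_subspace_image)
  let ?K = "{u \<in> V. f u = 0}"
  obtain B D where BD: "B \<inter> D = {}" "coord.independent (B \<union> D)" "?K = coord.span B"
    "V = coord.span (B \<union> D)" "coord.span B \<inter> coord.span D \<subseteq> {0}"
    by (rule kernel_complement[OF subspace_kernel[OF f sub] Collect_restrict sub])
  obtain E where "finite E" "V = coord.span E"
    using V by (auto simp: findim_subspace_def)
  then have fin: "finite (B \<union> D)"
    using coord.independent_span_bound[OF _ BD(2)] BD(4) coord.span_superset[of "B \<union> D"] by blast
  have indep: "coord.independent B" "coord.independent D"
    using BD(2) coord.independent_mono by blast+
  have D_V: "coord.span D \<subseteq> V"
    using coord.span_mono[of D "B \<union> D"] BD(4) by auto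
  have inj: "inj_on g (coord.span D)"
    unfolding g.inj_on_iff_eq_0[OF coord.subspace_span]
  proof
    fix u assume u: "u \<in> coord.span D"
    show "g u = 0 \<longrightarrow> u = 0"
    proof
      assume "g u = 0"
      then have "u \<in> ?K"
        using u D_V g(2)[of u] by auto
      then show "u = 0"
        using BD(3,5) u by auto
    qed
  qed
  then have gD: "coord.independent (g ` D)"
    using coord_pair.linear_independent_injective_image[OF g(1) indep(2)] by blast
  have "g ` V = coord.span (g ` B \<union> g ` D)"
    using BD(4) by (simp add: g.span_image flip: image_Un)
  also have "\<dots> = coord.span (g ` D)"
  proof -
    have zero: "g ` B \<subseteq> {0}"
    proof
      fix w assume "w \<in> g ` B"
      then obtain b where "b \<in> ?K" "w = g b"
        using BD(3) coord.span_superset[of B] by blast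
      then show "w \<in> {0}"
        using g(2) by simp
    qed
    have "g ` B \<subseteq> coord.span (g ` D)"
      by (rule order_trans[OF zero]) (simp add: coord.span_zero)
    then have "coord.span (g ` B \<union> g ` D) \<subseteq> coord.span (g ` D)"
      using coord.span_superset[of "g ` D"] by (intro coord.span_minimal coord.subspace_span Un_least)
    then show ?thesis
      using coord.span_mono[OF Un_upper2, of "g ` D" "g ` B"] by (rule equalityI)
  qed
  finally have "coord.dim (f ` V) = card (g ` D)"
    unfolding img using gD by (simp add: coord.dim_eq_card_independent)
  also have "\<dots> = card D"
    using inj coord.span_superset[of D] by (intro card_image) (auto intro: inj_on_subset)
  finally have "coord.dim (f ` V) = card D" .
  moreover have "coord.dim ?K = card B"
    unfolding BD(3) using indep(1) by (simp add: coord.dim_eq_card_independent)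
  moreover have "coord.dim V = card (B \<union> D)"
    unfolding BD(4) using BD(2) by (simp add: coord.dim_eq_card_independent)
  moreover have "card (B \<union> D) = card B + card D"
    using fin BD(1) by (intro card_Un_disjoint) auto
  ultimately show "coord.dim V = coord.dim ?K + coord.dim (f ` V)"
    by simp
qed

lemma coord_dim_zero: "coord.dim {0} = 0"
  by (metis card.empty coord.dim_eq_card_independent coord.dim_span coord.independent_empty coord.span_empty)

lemma dim_image_injective:
  assumes "findim_subspace V" "linear_between V W f" "\<And>u. u \<in> V \<Longrightarrow> f u = 0 \<Longrightarrow> u = 0"
  shows "coord.dim (f ` V) = coord.dim V"
proof -
  have V: "coord.subspace V"
    using assms(1) by (rule findim_subspace_imp_subspace)
  then have "{u \<in> V. f u = 0} = {0}"
    using assms(3) linear_betweenD(5)[OF assms(2) V] coord.subspace_0[OF V] by (intro set_eqI) auto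
  then show ?thesis
    using rank_nullity(2)[OF assms(1,2)] by (simp add: coord_dim_zero)
qed

lemma findim_subspace_if_kernel:
  assumes V: "coord.subspace V" and f: "linear_between V W f"
    and W: "findim_subspace W" and K: "findim_subspace {u \<in> V. f u = 0}"
  shows "findim_subspace V"
proof -
  obtain g where g: "coord_linear g" "\<And>u. u \<in> V \<Longrightarrow> g u = f u"
    using linear_between_extend[OF V f] by blast
  interpret g: Vector_Spaces.linear coord_scale coord_scale g
    by fact
  have "coord.subspace (f ` V)"
    using g.subspace_image[OF V] g(2) by simp
  moreover have "f ` V \<subseteq> W"
    using f by (auto simp: linear_between_def)
  ultimately have "findim_subspace (f ` V)"
    using findim_subspace_subset[OF W] by blast
  then obtain E where E: "finite E" "f ` V = coord.span E"
    by (auto simp: findim_subspace_def)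
  obtain B where B: "finite B" "{u \<in> V. f u = 0} = coord.span B"
    using K by (auto simp: findim_subspace_def)
  obtain s where s: "\<And>e. e \<in> E \<Longrightarrow> s e \<in> V \<and> f (s e) = e"
    using E(2) coord.span_superset[of E] by (metis image_iff subsetD)
  have "V \<subseteq> coord.span (B \<union> s ` E)"
  proof
    fix u assume u: "u \<in> V"
    have "g ` s ` E = E"
      using s g(2) by force
    then have "f u \<in> g ` coord.span (s ` E)"
      using E(2) u by (auto simp: g.span_image[symmetric])
    then obtain w where w: "w \<in> coord.span (s ` E)" "f u = g w"
      by blast
    have "coord.span (s ` E) \<subseteq> V"
      using s V by (intro coord.span_minimal) auto
    then have "w \<in> V"
      using w(1) by blast
    then have "u - w \<in> V" "f (u - w) = 0"
      using u w(2) g(2) linear_betweenD(3)[OF f V] coord.subspace_diff[OF V] by simp_all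
    then have "u - w \<in> coord.span B"
      unfolding B(2)[symmetric] by simp
    then have "u - w \<in> coord.span (B \<union> s ` E)"
      by (rule subsetD[OF coord.span_mono[OF Un_upper1]])
    moreover have "w \<in> coord.span (B \<union> s ` E)"
      using w(1) by (rule subsetD[OF coord.span_mono[OF Un_upper2]])
    ultimately have "(u - w) + w \<in> coord.span (B \<union> s ` E)"
      by (rule coord.span_add)
    then show "u \<in> coord.span (B \<union> s ` E)"
      by simp
  qed
  then show ?thesis
    using B(1) E(1) by (intro findim_subspace_subset[OF findim_subspace_span V]) simp_all
qed

text \<open>The universal property of the quotient: the value does not depend on the chosen
  preimage, since two of them differ by an element of the kernel.\<close>

lemma linear_factor:
  assumes D: "coord.subspace D" and g: "coord_linear g" and \<theta>: "linear_between D W \<theta>"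
    and ker: "\<And>d. d \<in> D \<Longrightarrow> g d = 0 \<Longrightarrow> \<theta> d = 0"
  obtains \<psi> where "linear_between (g ` D) W \<psi>" "\<And>d. d \<in> D \<Longrightarrow> \<psi> (g d) = \<theta> d"
proof -
  define \<psi> where "\<psi> = (\<lambda>w. \<theta> (SOME d. d \<in> D \<and> g d = w))"
  have eq: "\<psi> (g d) = \<theta> d" if d: "d \<in> D" for d
  proof -
    let ?e = "SOME e. e \<in> D \<and> g e = g d"
    have e: "?e \<in> D \<and> g ?e = g d"
      by (rule someI[of _ d]) (use d in simp)
    then have "?e - d \<in> D" "g (?e - d) = 0"
      using d coord.subspace_diff[OF D] by (auto simp: coord_linearD[OF g])
    then have "\<theta> ?e - \<theta> d = 0"
      using ker[of "?e - d"] linear_betweenD(3)[OF \<theta> D] e d by auto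
    then show ?thesis
      by (simp add: \<psi>_def)
  qed
  have "linear_between (g ` D) W \<psi>"
  proof (rule linear_betweenI)
    fix u assume "u \<in> g ` D"
    then obtain d where d: "d \<in> D" "u = g d"
      by blast
    then show "\<psi> u \<in> W"
      using eq linear_betweenD(1)[OF \<theta> D] by auto
    show "\<psi> (coord_scale c u) = coord_scale c (\<psi> u)" for c
      using eq[of "coord_scale c d"] d coord.subspace_scale[OF D] eq[of d] linear_betweenD(4)[OF \<theta> D, of d c]
      by (simp add: coord_linearD[OF g])
    fix v assume "v \<in> g ` D"
    then obtain e where e: "e \<in> D" "v = g e"
      by blast
    show "\<psi> (u + v) = \<psi> u + \<psi> v"
      using eq[of "d + e"] eq[of d] eq[of e] d e coord.subspace_add[OF D] linear_betweenD(2)[OF \<theta> D, of d e]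
      by (simp add: coord_linearD[OF g])
  qed
  then show thesis
    using eq that by blast
qed

subsection \<open>Finite direct sums inside the coordinate space\<close>

text \<open>Two kinds of direct sums are needed in the same space: over the arcs at a vertex, for
  the reflection functors, and over numbers, for sums of representations.\<close>

locale coord_coproduct =
  fixes proj inj :: "'l \<Rightarrow> ('e, 'k::field) coord_vec \<Rightarrow> ('e, 'k) coord_vec"
  assumes linear_proj: "coord_linear (proj a)"
    and linear_inj: "coord_linear (inj a)"
    and proj_inj: "proj a (inj b v) = (if a = b then v else 0)"
begin

text \<open>The first condition excludes whatever lies outside the components in \<open>A\<close>.
  For arcs this includes the coordinates with an empty list, which belong to no component.\<close>

definition dsum :: "'l set \<Rightarrow> ('l \<Rightarrow> ('e, 'k) coord_vec set) \<Rightarrow> ('e, 'k) coord_vec set" where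
  "dsum A V = {u. u = (\<Sum>a\<in>A. inj a (proj a u)) \<and> (\<forall>a\<in>A. proj a u \<in> V a)}"

lemma dsum_proj: "u \<in> dsum A V \<Longrightarrow> a \<in> A \<Longrightarrow> proj a u \<in> V a"
  by (simp add: dsum_def)

lemma dsum_expand: "u \<in> dsum A V \<Longrightarrow> u = (\<Sum>a\<in>A. inj a (proj a u))"
  by (simp add: dsum_def)

lemma dsumI:
  "u = (\<Sum>a\<in>A. inj a (proj a u)) \<Longrightarrow> (\<And>a. a \<in> A \<Longrightarrow> proj a u \<in> V a) \<Longrightarrow> u \<in> dsum A V"
  by (simp add: dsum_def)

lemma proj_sum:
  assumes "finite A"
  shows "proj a (\<Sum>b\<in>A. inj b (f b)) = (if a \<in> A then f a else 0)"
  using assms by (simp add: coord_linearD(5)[OF linear_proj] proj_inj if_distrib cong: if_cong)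

lemma sum_in_dsum:
  assumes "finite A" "\<And>a. a \<in> A \<Longrightarrow> f a \<in> V a"
  shows "(\<Sum>a\<in>A. inj a (f a)) \<in> dsum A V"
  using assms by (simp add: dsum_def proj_sum)

lemma subspace_dsum:
  assumes "\<And>a. a \<in> A \<Longrightarrow> coord.subspace (V a)"
  shows "coord.subspace (dsum A V)"
proof (rule coord.subspaceI)
  show "0 \<in> dsum A V"
    using assms by (simp add: dsum_def coord_linearD[OF linear_proj] coord_linearD[OF linear_inj] coord.subspace_0)
next
  fix u v assume uv: "u \<in> dsum A V" "v \<in> dsum A V"
  have "u + v = (\<Sum>a\<in>A. inj a (proj a (u + v)))"
    using uv[THEN dsum_expand]
    by (simp add: coord_linearD[OF linear_proj] coord_linearD[OF linear_inj] sum.distrib)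
  then show "u + v \<in> dsum A V"
    by (rule dsumI)
      (use uv[THEN dsum_proj] assms in \<open>simp add: coord_linearD(1)[OF linear_proj] coord.subspace_add\<close>)
next
  fix c u assume u: "u \<in> dsum A V"
  have "coord_scale c u = (\<Sum>a\<in>A. inj a (proj a (coord_scale c u)))"
    using dsum_expand[OF u]
    by (simp add: coord_linearD[OF linear_proj] coord_linearD[OF linear_inj] flip: coord.scale_sum_right)
  then show "coord_scale c u \<in> dsum A V"
    by (rule dsumI)
      (use dsum_proj[OF u] assms in \<open>simp add: coord_linearD(3)[OF linear_proj] coord.subspace_scale\<close>)
qed

lemma inj_in_dsum:
  assumes "finite A" "a \<in> A" "u \<in> V a" "\<And>b. b \<in> A \<Longrightarrow> 0 \<in> V b"
  shows "inj a u \<in> dsum A V"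
proof (rule dsumI)
  have "(\<Sum>b\<in>A. inj b (proj b (inj a u))) = (\<Sum>b\<in>A. if b = a then inj a u else 0)"
    by (rule sum.cong) (simp_all add: proj_inj coord_linearD(4)[OF linear_inj])
  also have "\<dots> = inj a u"
    using assms(1,2) by simp
  finally show "inj a u = (\<Sum>b\<in>A. inj b (proj b (inj a u)))"
    by (rule sym)
  show "proj b (inj a u) \<in> V b" if "b \<in> A" for b
    using assms(3) assms(4)[OF that] by (simp add: proj_inj)
qed

lemma linear_between_proj: "a \<in> A \<Longrightarrow> linear_between (dsum A V) (V a) (proj a)"
  by (rule linear_between_coord_linear[OF linear_proj]) (rule dsum_proj)

lemma linear_between_inj:
  assumes "finite A" "a \<in> A" "\<And>b. b \<in> A \<Longrightarrow> coord.subspace (V b)"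
  shows "linear_between (V a) (dsum A V) (inj a)"
  by (rule linear_between_coord_linear[OF linear_inj])
    (rule inj_in_dsum[OF assms(1,2) _ coord.subspace_0[OF assms(3)]])

lemma dsum_cong:
  assumes "\<And>a. a \<in> A \<Longrightarrow> V a = W a"
  shows "dsum A V = dsum A W"
  using assms by (auto simp: dsum_def)

text \<open>On the sum with one more index \<open>b\<close>, the projection to \<open>b\<close> is
  onto \<open>V b\<close> and its kernel is the old sum.\<close>

lemma findim_dsum:
  assumes "finite A" "\<And>a. a \<in> A \<Longrightarrow> findim_subspace (V a)"
  shows "findim_subspace (dsum A V)" "coord.dim (dsum A V) = (\<Sum>a\<in>A. coord.dim (V a))"
proof -
  have "findim_subspace (dsum A V) \<and> coord.dim (dsum A V) = (\<Sum>a\<in>A. coord.dim (V a))"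
    using assms
  proof (induction A)
    case empty
    have "dsum {} V = {0}"
      by (auto simp: dsum_def)
    then show ?case
      using findim_subspace_span[of "{}"] coord_dim_zero by simp
  next
    case (insert b A)
    let ?D = "dsum (insert b A) V"
    have sub: "coord.subspace ?D"
      using insert.prems by (intro subspace_dsum findim_subspace_imp_subspace)
    have lin: "linear_between ?D (V b) (proj b)"
      using linear_proj by (rule linear_between_coord_linear) (simp add: dsum_def)
    have ker: "{u \<in> ?D. proj b u = 0} = dsum A V"
    proof (intro equalityI subsetI)
      fix u assume "u \<in> {u \<in> ?D. proj b u = 0}"
      then have u: "u \<in> ?D" "proj b u = 0"
        by simp_all
      have "(\<Sum>a\<in>insert b A. inj a (proj a u)) = (\<Sum>a\<in>A. inj a (proj a u))"
        using insert.hyps u(2) by (simp add: coord_linearD(4)[OF linear_inj])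
      with dsum_expand[OF u(1)] have "u = (\<Sum>a\<in>A. inj a (proj a u))"
        by (rule trans)
      then show "u \<in> dsum A V"
        by (rule dsumI) (use dsum_proj[OF u(1)] in simp)
    next
      fix u assume u: "u \<in> dsum A V"
      have zero: "proj b u = 0"
        using insert.hyps by (subst dsum_expand[OF u]) (simp add: proj_sum)
      have "(\<Sum>a\<in>insert b A. inj a (proj a u)) = (\<Sum>a\<in>A. inj a (proj a u))"
        using insert.hyps zero by (simp add: coord_linearD(4)[OF linear_inj])
      with dsum_expand[OF u] have "u = (\<Sum>a\<in>insert b A. inj a (proj a u))"
        by simp
      then have "u \<in> ?D"
      proof (rule dsumI)
        fix a assume "a \<in> insert b A"
        then show "proj a u \<in> V a"
          using zero dsum_proj[OF u] coord.subspace_0[OF findim_subspace_imp_subspace[OF insert.prems]]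
          by (cases "a = b") auto
      qed
      then show "u \<in> {u \<in> ?D. proj b u = 0}"
        using zero by simp
    qed
    have fin: "findim_subspace ?D"
      using insert by (intro findim_subspace_if_kernel[OF sub lin]) (auto simp: ker)
    have surj: "proj b ` ?D = V b"
    proof (intro equalityI subsetI)
      fix v assume v: "v \<in> V b"
      have w: "(\<Sum>a\<in>insert b A. inj a (if a = b then v else 0)) \<in> ?D"
      proof (rule sum_in_dsum)
        fix a assume "a \<in> insert b A"
        then show "(if a = b then v else 0) \<in> V a"
          using v coord.subspace_0[OF findim_subspace_imp_subspace[OF insert.prems], of a] by auto
      qed (use insert.hyps in simp)
      have "proj b (\<Sum>a\<in>insert b A. inj a (if a = b then v else 0)) = v"
        by (subst proj_sum) (use insert.hyps(1) in simp_all)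
      then show "v \<in> proj b ` ?D"
        using imageI[OF w, of "proj b"] by (simp only:)
    qed (use dsum_proj in blast)
    have "coord.dim ?D = coord.dim (dsum A V) + coord.dim (V b)"
      using rank_nullity(2)[OF fin lin] unfolding ker surj .
    then show ?case
      using fin insert by simp
  qed
  then show "findim_subspace (dsum A V)" "coord.dim (dsum A V) = (\<Sum>a\<in>A. coord.dim (V a))"
    by blast+
qed

end

definition arc_inj :: "'e \<Rightarrow> ('e, 'k::field) coord_vec \<Rightarrow> ('e, 'k) coord_vec" where
  "arc_inj a v = (\<lambda>(p, n). case p of [] \<Rightarrow> 0 | b # q \<Rightarrow> if b = a then v (q, n) else 0)"

interpretation arc_coproduct: coord_coproduct
  "arc_component :: 'e \<Rightarrow> ('e, 'k::field) coord_vec \<Rightarrow> _" arc_inj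
  by unfold_locales
    (auto simp: arc_component_def arc_inj_def coord_scale_def fun_eq_iff split: list.split)

text \<open>Pairing splits the number of a coordinate into the index of a copy and a new number, so
  infinitely many copies of the coordinate space fit into it; the lists of arcs stay
  untouched.\<close>

definition copy_proj :: "nat \<Rightarrow> ('e, 'k::field) coord_vec \<Rightarrow> ('e, 'k) coord_vec" where
  "copy_proj i u = (\<lambda>(p, n). u (p, prod_encode (i, n)))"

definition copy_inj :: "nat \<Rightarrow> ('e, 'k::field) coord_vec \<Rightarrow> ('e, 'k) coord_vec" where
  "copy_inj i v = (\<lambda>(p, n). if fst (prod_decode n) = i then v (p, snd (prod_decode n)) else 0)"

interpretation copy_coproduct: coord_coproduct
  "copy_proj :: nat \<Rightarrow> ('e, 'k::field) coord_vec \<Rightarrow> _" copy_inj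
  by unfold_locales (auto simp: copy_proj_def copy_inj_def coord_scale_def fun_eq_iff)

lemma sum_fun_apply:
  fixes f :: "'a \<Rightarrow> 'b \<Rightarrow> 'c::comm_monoid_add"
  shows "(\<Sum>a\<in>A. f a) x = (\<Sum>a\<in>A. f a x)"
  by (induction A rule: infinite_finite_induct) auto

lemma incoming_sum_eq_dsum:
  fixes G :: "('v, 'e) pre_digraph" and M :: "('v, 'e, 'k::field) quiver_rep"
  assumes "finite (in_arcs G x)"
  shows "incoming_sum G x M = arc_coproduct.dsum (in_arcs G x) (\<lambda>a. space M (tail G a))"
proof -
  have "(\<forall>p n. u (p, n) \<noteq> 0 \<longrightarrow> p \<noteq> [] \<and> hd p \<in> in_arcs G x) \<longleftrightarrow>
      u = (\<Sum>a\<in>in_arcs G x. arc_inj a (arc_component a u))" for u :: "('e, 'k) coord_vec"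
  proof -
    have "(\<Sum>a\<in>in_arcs G x. arc_inj a (arc_component a u)) (p, n) =
        (if p \<noteq> [] \<and> hd p \<in> in_arcs G x then u (p, n) else 0)" for p n
    proof (cases p)
      case Nil
      then show ?thesis
        by (simp add: sum_fun_apply arc_inj_def)
    next
      case (Cons b q)
      then have "(\<Sum>a\<in>in_arcs G x. arc_inj a (arc_component a u)) (p, n) =
          (\<Sum>a\<in>in_arcs G x. if b = a then u (p, n) else 0)"
        by (auto simp: sum_fun_apply arc_inj_def arc_component_def intro!: sum.cong)
      then show ?thesis
        using assms Cons by simp
    qed
    then have "u = (\<Sum>a\<in>in_arcs G x. arc_inj a (arc_component a u)) \<longleftrightarrow>
        (\<forall>p n. u (p, n) = (if p \<noteq> [] \<and> hd p \<in> in_arcs G x then u (p, n) else 0))"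
      by (simp add: fun_eq_iff)
    then show ?thesis
      by auto
  qed
  then show ?thesis
    by (auto simp: incoming_sum_def arc_coproduct.dsum_def)
qed

section \<open>Representations and homomorphisms\<close>

text \<open>The linear structure alone is carried through the positive functors; finite dimension is
  tracked for the negative ones, where dimension vectors are computed.\<close>

definition lin_rep :: "('v, 'e) pre_digraph \<Rightarrow> ('v, 'e, 'k::field) quiver_rep \<Rightarrow> bool" where
  "lin_rep G M \<longleftrightarrow> (\<forall>v \<in> verts G. coord.subspace (space M v)) \<and>
     (\<forall>a \<in> arcs G. linear_between (space M (tail G a)) (space M (head G a)) (arrow_map M a))"

definition rep_hom :: "('v, 'e) pre_digraph \<Rightarrow> ('v, 'e, 'k::field) quiver_rep \<Rightarrow> ('v, 'e, 'k) quiver_rep \<Rightarrow>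
    ('v \<Rightarrow> ('e, 'k) coord_vec \<Rightarrow> ('e, 'k) coord_vec) \<Rightarrow> bool" where
  "rep_hom G M N \<phi> \<longleftrightarrow> (\<forall>v \<in> verts G. linear_between (space M v) (space N v) (\<phi> v)) \<and>
     (\<forall>a \<in> arcs G. \<forall>u \<in> space M (tail G a).
        \<phi> (head G a) (arrow_map M a u) = arrow_map N a (\<phi> (tail G a) u))"

text \<open>Three cases are used: the projections of a direct sum, a single injective morphism, and
  the empty family, for which it says that \<open>M\<close> is zero.\<close>

definition jointly_injective :: "('v, 'e) pre_digraph \<Rightarrow> ('v, 'e, 'k::field) quiver_rep \<Rightarrow>
    'i set \<Rightarrow> ('i \<Rightarrow> 'v \<Rightarrow> ('e, 'k) coord_vec \<Rightarrow> ('e, 'k) coord_vec) \<Rightarrow> bool" where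
  "jointly_injective G M I \<phi> \<longleftrightarrow>
     (\<forall>v \<in> verts G. \<forall>u \<in> space M v. (\<forall>i \<in> I. \<phi> i v u = 0) \<longrightarrow> u = 0)"

lemma is_rep_imp_lin_rep: "is_rep G M \<Longrightarrow> lin_rep G M"
  by (simp add: is_rep_def lin_rep_def findim_subspace_def)

lemma lin_rep_subspace: "lin_rep G M \<Longrightarrow> v \<in> verts G \<Longrightarrow> coord.subspace (space M v)"
  by (simp add: lin_rep_def)

lemma lin_rep_arrow: "lin_rep G M \<Longrightarrow> a \<in> arcs G \<Longrightarrow>
    linear_between (space M (tail G a)) (space M (head G a)) (arrow_map M a)"
  by (simp add: lin_rep_def)

lemma rep_hom_linear: "rep_hom G M N \<phi> \<Longrightarrow> v \<in> verts G \<Longrightarrow> linear_between (space M v) (space N v) (\<phi> v)"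
  by (simp add: rep_hom_def)

lemma rep_hom_commute: "rep_hom G M N \<phi> \<Longrightarrow> a \<in> arcs G \<Longrightarrow> u \<in> space M (tail G a) \<Longrightarrow>
    \<phi> (head G a) (arrow_map M a u) = arrow_map N a (\<phi> (tail G a) u)"
  by (simp add: rep_hom_def)

definition reflection_hom :: "('v, 'e) pre_digraph \<Rightarrow> 'v \<Rightarrow>
    ('v \<Rightarrow> ('e, 'k::field) coord_vec \<Rightarrow> ('e, 'k) coord_vec) \<Rightarrow> 'v \<Rightarrow> ('e, 'k) coord_vec \<Rightarrow> ('e, 'k) coord_vec" where
  "reflection_hom G x \<phi> =
     \<phi>(x := \<lambda>u. \<Sum>a\<in>in_arcs G x. arc_inj a (\<phi> (tail G a) (arc_component a u)))"

text \<open>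
  The negative reflection functor on a representation \<open>Y\<close> of the quiver in which \<open>x\<close> is a source.
  The cokernel at \<open>x\<close> is realised inside the coordinate space as the image of the direct sum
  under a linear map with the right kernel.
\<close>

definition source_map :: "('v, 'e) pre_digraph \<Rightarrow> 'v \<Rightarrow> ('v, 'e, 'k::field) quiver_rep \<Rightarrow>
    ('e, 'k) coord_vec \<Rightarrow> ('e, 'k) coord_vec" where
  "source_map G x Y u = (\<Sum>a\<in>in_arcs G x. arc_inj a (arrow_map Y a u))"

definition quotient_map :: "('e, 'k::field) coord_vec set \<Rightarrow> ('e, 'k) coord_vec \<Rightarrow> ('e, 'k) coord_vec" where
  "quotient_map K = (SOME g. coord_linear g \<and> (\<forall>u. g u = 0 \<longleftrightarrow> u \<in> K))"

text \<open>\<open>Y\<close> lives on the reversed quiver, but \<open>incoming_sum G x\<close> only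
  reads the arcs at \<open>x\<close> and their far ends, which are tails in \<open>G\<close>. So it
  yields the sum of the targets of the arrows leaving the source.\<close>

definition inverse_reflection :: "('v, 'e) pre_digraph \<Rightarrow> 'v \<Rightarrow>
    ('v, 'e, 'k::field) quiver_rep \<Rightarrow> ('v, 'e, 'k) quiver_rep" where
  "inverse_reflection G x Y = (let q = quotient_map (source_map G x Y ` space Y x) in \<lparr>
     space = (space Y)(x := q ` incoming_sum G x Y),
     arrow_map = (\<lambda>a. if a \<in> in_arcs G x then q \<circ> arc_inj a else arrow_map Y a)\<rparr>)"

lemma quotient_map:
  assumes "coord.subspace K"
  shows "coord_linear (quotient_map K)" "quotient_map K u = 0 \<longleftrightarrow> u \<in> K"
proof -
  have "\<exists>g. coord_linear g \<and> (\<forall>u. g u = 0 \<longleftrightarrow> u \<in> K)"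
    using linear_with_kernel[OF assms] by metis
  then have "coord_linear (quotient_map K) \<and> (\<forall>u. quotient_map K u = 0 \<longleftrightarrow> u \<in> K)"
    unfolding quotient_map_def by (rule someI_ex)
  then show "coord_linear (quotient_map K)" "quotient_map K u = 0 \<longleftrightarrow> u \<in> K"
    by blast+
qed

lemma graded_quiver_ends:
  assumes "graded_quiver G" "a \<in> arcs G"
  shows "tail G a \<in> verts G" "head G a \<in> verts G"
  using assms by (auto simp: graded_quiver_def fin_digraph_def wf_digraph_def)

lemma rep_hom_compose:
  assumes "graded_quiver G" "rep_hom G L M \<phi>" "rep_hom G M N \<psi>"
  shows "rep_hom G L N (\<lambda>v u. \<psi> v (\<phi> v u))"
  unfolding rep_hom_def
proof (intro conjI ballI)
  show "linear_between (space L v) (space N v) (\<lambda>u. \<psi> v (\<phi> v u))" if "v \<in> verts G" for v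
    using rep_hom_linear[OF assms(2) that] rep_hom_linear[OF assms(3) that] by (rule linear_between_compose)
  fix a u assume a: "a \<in> arcs G" and u: "u \<in> space L (tail G a)"
  have "\<phi> (tail G a) u \<in> space M (tail G a)"
    using rep_hom_linear[OF assms(2) graded_quiver_ends(1)[OF assms(1) a]] u
    by (simp add: linear_between_def image_subset_iff)
  then show "\<psi> (head G a) (\<phi> (head G a) (arrow_map L a u)) = arrow_map N a (\<psi> (tail G a) (\<phi> (tail G a) u))"
    by (simp only: rep_hom_commute[OF assms(2) a u] rep_hom_commute[OF assms(3) a])
qed

locale sink_reflection =
  fixes G :: "('v, 'e) pre_digraph" and x :: 'v
  assumes graded: "graded_quiver G" and sink: "sink G x"
begin

abbreviation H :: "('v, 'e) pre_digraph" where
  "H \<equiv> reverse_at x G"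

abbreviation source_sum :: "('v, 'e, 'k::field) quiver_rep \<Rightarrow> ('e, 'k) coord_vec set" where
  "source_sum M \<equiv> arc_coproduct.dsum (in_arcs G x) (\<lambda>a. space M (tail G a))"

abbreviation pos :: "('v, 'e, 'k::field) quiver_rep \<Rightarrow> ('v, 'e, 'k) quiver_rep" where
  "pos \<equiv> reflection_functor G x"

lemma x_vert: "x \<in> verts G"
  using sink by (simp add: sink_iff)

lemma finite_in: "finite (in_arcs G x)"
proof -
  have "finite (arcs G)"
    using graded by (auto simp: graded_quiver_def fin_digraph_def fin_digraph_axioms_def)
  then show ?thesis
    by (rule finite_subset[rotated]) auto
qed

lemmas ends_verts = graded_quiver_ends[OF graded]

lemma in_arc:
  assumes "a \<in> in_arcs G x"
  shows "a \<in> arcs G" "head G a = x" "tail G a \<noteq> x" "tail G a \<in> verts G" "tail H a = x"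
    "head H a = tail G a"
proof -
  show a: "a \<in> arcs G" "head G a = x"
    using assms by auto
  then show "tail G a \<noteq> x"
    using sink by (auto simp: sink_iff)
  show "tail G a \<in> verts G"
    using a ends_verts by blast
  show "tail H a = x" "head H a = tail G a"
    using a by (simp_all add: tail_reverse_at head_reverse_at)
qed

lemma other_arc:
  assumes "a \<in> arcs G" "a \<notin> in_arcs G x"
  shows "head G a \<noteq> x" "tail G a \<noteq> x" "tail H a = tail G a" "head H a = head G a"
proof -
  show 1: "head G a \<noteq> x"
    using assms by auto
  show 2: "tail G a \<noteq> x"
    using sink assms(1) by (auto simp: sink_iff)
  show "tail H a = tail G a" "head H a = head G a"
    using assms(1) 1 2 by (simp_all add: tail_reverse_at head_reverse_at)
qed

lemma incoming_sum: "incoming_sum G x M = source_sum M"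
  using finite_in by (rule incoming_sum_eq_dsum)

lemma space_reflection: "space (pos M) v =
    (if v = x then {u \<in> source_sum M. incoming_map G x M u = 0} else space M v)"
  by (simp add: reflection_functor_def incoming_sum)

lemma arrow_reflection: "arrow_map (pos M) a =
    (if a \<in> in_arcs G x then arc_component a else arrow_map M a)"
  by (simp add: reflection_functor_def)

lemma source_sum_subspace:
  assumes "\<And>v. v \<in> verts G \<Longrightarrow> coord.subspace (space M v)"
  shows "coord.subspace (source_sum M)"
  by (intro arc_coproduct.subspace_dsum assms in_arc(4))

lemma component_in: "u \<in> source_sum M \<Longrightarrow> a \<in> in_arcs G x \<Longrightarrow> arc_component a u \<in> space M (tail G a)"
  by (rule arc_coproduct.dsum_proj)

lemma component_linear: "a \<in> in_arcs G x \<Longrightarrow>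
    linear_between (source_sum M) (space M (tail G a)) (arc_component a)"
  by (rule arc_coproduct.linear_between_proj)

lemma arc_inj_linear:
  assumes "a \<in> in_arcs G x" "\<And>v. v \<in> verts G \<Longrightarrow> coord.subspace (space M v)"
  shows "linear_between (space M (tail G a)) (source_sum M) (arc_inj a)"
  using arc_coproduct.linear_between_inj[where V = "\<lambda>a. space M (tail G a)", OF finite_in assms(1)]
    assms(2)[OF in_arc(4)] by blast

lemma incoming_map_linear:
  assumes M: "lin_rep G M"
  shows "linear_between (source_sum M) (space M x) (incoming_map G x M)"
proof -
  have "linear_between (source_sum M) (space M x)
      (\<lambda>u. \<Sum>a\<in>in_arcs G x. arrow_map M a (arc_component a u))"
  proof (rule linear_between_sum[OF lin_rep_subspace[OF M x_vert]])
    fix a assume a: "a \<in> in_arcs G x"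
    show "linear_between (source_sum M) (space M x) (\<lambda>u. arrow_map M a (arc_component a u))"
      using linear_between_compose[OF component_linear[OF a] lin_rep_arrow[OF M in_arc(1)[OF a]]]
        in_arc(2)[OF a] by simp
  qed
  then show ?thesis
    by (simp add: incoming_map_def[abs_def])
qed

lemma reflection_lin_rep:
  assumes M: "lin_rep G M"
  shows "lin_rep H (pos M)"
  unfolding lin_rep_def
proof (intro conjI ballI)
  fix v assume "v \<in> verts H"
  then show "coord.subspace (space (pos M) v)"
    using subspace_kernel[OF incoming_map_linear[OF M] source_sum_subspace[OF lin_rep_subspace[OF M]]]
      lin_rep_subspace[OF M] by (simp add: space_reflection)
next
  fix a assume "a \<in> arcs H"
  then have a: "a \<in> arcs G"
    by simp
  show "linear_between (space (pos M) (tail H a))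
      (space (pos M) (head H a)) (arrow_map (pos M) a)"
  proof (cases "a \<in> in_arcs G x")
    case True
    have "linear_between {u \<in> source_sum M. incoming_map G x M u = 0} (space M (tail G a)) (arc_component a)"
      using arc_coproduct.linear_proj
      by (rule linear_between_coord_linear) (simp add: component_in[OF _ True])
    then show ?thesis
      using True in_arc[OF True] by (simp add: space_reflection arrow_reflection)
  next
    case False
    then show ?thesis
      using other_arc[OF a False] lin_rep_arrow[OF M a] by (simp add: space_reflection arrow_reflection)
  qed
qed

lemma component_reflection_hom:
  assumes "a \<in> in_arcs G x"
  shows "arc_component a (reflection_hom G x \<phi> x u) = \<phi> (tail G a) (arc_component a u)"
  using assms finite_in by (simp add: reflection_hom_def arc_coproduct.proj_sum)

lemma reflection_hom:
  assumes \<phi>: "rep_hom G M N \<phi>" and M: "lin_rep G M" and N: "lin_rep G N"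
  shows "rep_hom H (pos M) (pos N) (reflection_hom G x \<phi>)"
proof -
  have \<phi>_lin: "linear_between (space M (tail G a)) (space N (tail G a)) (\<phi> (tail G a))"
    "coord.subspace (space M (tail G a))" if "a \<in> in_arcs G x" for a
    using rep_hom_linear[OF \<phi>] lin_rep_subspace[OF M] in_arc(4)[OF that] by auto
  note \<phi>x = linear_betweenD[OF rep_hom_linear[OF \<phi> x_vert] lin_rep_subspace[OF M x_vert]]
  have cu: "arc_component a u \<in> space M (tail G a)" if "u \<in> source_sum M" "a \<in> in_arcs G x" for a u
    using that by (rule arc_coproduct.dsum_proj)
  have at_x: "linear_between (source_sum M) (source_sum N) (reflection_hom G x \<phi> x)"
  proof -
    have "linear_between (source_sum M) (source_sum N)
        (\<lambda>u. \<Sum>a\<in>in_arcs G x. arc_inj a (\<phi> (tail G a) (arc_component a u)))"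
    proof (rule linear_between_sum)
      show "coord.subspace (source_sum N)"
        by (rule source_sum_subspace) (rule lin_rep_subspace[OF N])
      fix a assume a: "a \<in> in_arcs G x"
      show "linear_between (source_sum M) (source_sum N)
          (\<lambda>u. arc_inj a (\<phi> (tail G a) (arc_component a u)))"
        by (rule linear_between_compose[OF linear_between_compose[OF component_linear[OF a] \<phi>_lin(1)[OF a]]
            arc_inj_linear[OF a lin_rep_subspace[OF N]]])
    qed
    then show ?thesis
      by (simp add: reflection_hom_def)
  qed
  \<comment> \<open>Naturality of the incoming map: this is why kernels are carried into
    kernels.\<close>
  have incoming: "incoming_map G x N (reflection_hom G x \<phi> x u) = \<phi> x (incoming_map G x M u)"
    if u: "u \<in> source_sum M" for u
  proof -
    have "incoming_map G x N (reflection_hom G x \<phi> x u) =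
        (\<Sum>a\<in>in_arcs G x. arrow_map N a (\<phi> (tail G a) (arc_component a u)))"
      unfolding incoming_map_def by (rule sum.cong) (simp_all add: component_reflection_hom)
    also have "\<dots> = (\<Sum>a\<in>in_arcs G x. \<phi> x (arrow_map M a (arc_component a u)))"
    proof (rule sum.cong)
      fix a assume a: "a \<in> in_arcs G x"
      show "arrow_map N a (\<phi> (tail G a) (arc_component a u)) = \<phi> x (arrow_map M a (arc_component a u))"
        using rep_hom_commute[OF \<phi> in_arc(1)[OF a] cu[OF u a]] in_arc(2)[OF a] by simp
    qed simp
    also have "\<dots> = \<phi> x (\<Sum>a\<in>in_arcs G x. arrow_map M a (arc_component a u))"
    proof (rule \<phi>x(6)[symmetric])
      fix a assume a: "a \<in> in_arcs G x"
      show "arrow_map M a (arc_component a u) \<in> space M x"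
        using linear_betweenD(1)[OF lin_rep_arrow[OF M in_arc(1)[OF a]] \<phi>_lin(2)[OF a] cu[OF u a]]
          in_arc(2)[OF a] by simp
    qed
    finally show ?thesis
      by (simp add: incoming_map_def)
  qed
  show ?thesis
    unfolding rep_hom_def
  proof (intro conjI ballI)
    fix v assume v: "v \<in> verts H"
    show "linear_between (space (pos M) v) (space (pos N) v)
        (reflection_hom G x \<phi> v)"
    proof (cases "v = x")
      case True
      have "linear_between {u \<in> source_sum M. incoming_map G x M u = 0}
          {u \<in> source_sum N. incoming_map G x N u = 0} (reflection_hom G x \<phi> x)"
      proof (rule linear_between_subset[OF at_x])
        fix u assume "u \<in> {u \<in> source_sum M. incoming_map G x M u = 0}"
        then show "reflection_hom G x \<phi> x u \<in> {u \<in> source_sum N. incoming_map G x N u = 0}"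
          using at_x incoming[of u] \<phi>x(5) by (auto simp: linear_between_def)
      qed auto
      then show ?thesis
        using True by (simp add: space_reflection)
    next
      case False
      then show ?thesis
        using v rep_hom_linear[OF \<phi>] by (simp add: space_reflection reflection_hom_def)
    qed
  next
    fix a u assume "a \<in> arcs H" and u: "u \<in> space (pos M) (tail H a)"
    then have a: "a \<in> arcs G"
      by simp
    show "reflection_hom G x \<phi> (head H a) (arrow_map (pos M) a u) =
        arrow_map (pos N) a (reflection_hom G x \<phi> (tail H a) u)"
    proof (cases "a \<in> in_arcs G x")
      case True
      then show ?thesis
        using in_arc[OF True] component_reflection_hom[OF True, of \<phi> u]
        by (simp add: arrow_reflection) (simp add: reflection_hom_def)
    next
      case False
      then show ?thesis
        using other_arc[OF a False] rep_hom_commute[OF \<phi> a] u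
        by (simp add: arrow_reflection space_reflection reflection_hom_def)
    qed
  qed
qed

lemma source_sum_zeroI:
  assumes "u \<in> source_sum M" "\<And>a. a \<in> in_arcs G x \<Longrightarrow> arc_component a u = 0"
  shows "u = 0"
proof -
  have "u = (\<Sum>a\<in>in_arcs G x. arc_inj a (arc_component a u))"
    using assms(1) by (rule arc_coproduct.dsum_expand)
  also have "\<dots> = 0"
    using assms(2) by (simp add: coord_linearD(4)[OF arc_coproduct.linear_inj])
  finally show ?thesis .
qed

text \<open>A vector in the new space at \<open>x\<close> is determined by its components, which lie
  at vertices other than \<open>x\<close>, where the family is unchanged.\<close>

lemma reflection_jointly_injective:
  assumes inj: "jointly_injective G M I \<phi>"
  shows "jointly_injective H (pos M) I (\<lambda>i. reflection_hom G x (\<phi> i))"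
  unfolding jointly_injective_def
proof (intro ballI impI)
  fix v u assume v: "v \<in> verts H" and u: "u \<in> space (pos M) v"
    and zero: "\<forall>i \<in> I. reflection_hom G x (\<phi> i) v u = 0"
  show "u = 0"
  proof (cases "v = x")
    case True
    then have ux: "u \<in> source_sum M"
      using u by (simp add: space_reflection)
    then show ?thesis
    proof (rule source_sum_zeroI)
      fix a assume a: "a \<in> in_arcs G x"
      have "\<forall>i \<in> I. \<phi> i (tail G a) (arc_component a u) = 0"
        using zero component_reflection_hom[OF a, of _ u] True
        by (metis coord_linearD(4)[OF arc_coproduct.linear_proj])
      then show "arc_component a u = 0"
        using inj in_arc(4)[OF a] arc_coproduct.dsum_proj[OF ux a] by (simp add: jointly_injective_def)
    qed
  next
    case False
    then show ?thesis
      using inj u v zero by (simp add: jointly_injective_def space_reflection reflection_hom_def)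
  qed
qed

end

lemma seq_functor_lin_rep:
  assumes "graded_quiver G" "admissible G S" "lin_rep G M"
  shows "lin_rep (reverse_along S G) (seq_functor G S M)"
  using assms
proof (induction S arbitrary: G M)
  case (Cons x S)
  interpret sink_reflection G x
    using Cons.prems by unfold_locales auto
  show ?case
    using Cons.IH[OF graded_quiver_reverse_at[OF graded sink] _ reflection_lin_rep[OF Cons.prems(3)]]
      Cons.prems(2) by simp
qed simp

text \<open>Reflection functors are left exact.\<close>

lemma seq_functor_zero_if_jointly_injective:
  assumes "graded_quiver G" "admissible G S" "lin_rep G M"
    and "\<And>i. i \<in> I \<Longrightarrow> lin_rep G (N i)" "\<And>i. i \<in> I \<Longrightarrow> rep_hom G M (N i) (\<phi> i)"
    and "jointly_injective G M I \<phi>"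
    and "v \<in> verts G" "\<And>i. i \<in> I \<Longrightarrow> space (seq_functor G S (N i)) v = {0}"
  shows "space (seq_functor G S M) v = {0}"
  using assms
proof (induction S arbitrary: G M N \<phi>)
  case Nil
  have "u = 0" if u: "u \<in> space M v" for u
  proof -
    have "\<phi> i v u \<in> space (N i) v" if "i \<in> I" for i
      using rep_hom_linear[OF Nil.prems(5)[OF that] Nil.prems(7)] u by (auto simp: linear_between_def)
    then have "\<forall>i \<in> I. \<phi> i v u = 0"
      using Nil.prems(8) unfolding seq_functor.simps(1) by blast
    then show ?thesis
      using Nil.prems(6,7) u unfolding jointly_injective_def by blast
  qed
  moreover have "0 \<in> space M v"
    using lin_rep_subspace[OF Nil.prems(3,7)] by (rule coord.subspace_0)
  ultimately show ?case
    unfolding seq_functor.simps(1) by blast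
next
  case (Cons x S)
  interpret sink_reflection G x
    using Cons.prems by unfold_locales auto
  have "space (seq_functor H S (reflection_functor G x M)) v = {0}"
  proof (rule Cons.IH)
    show "graded_quiver H"
      using graded sink by (rule graded_quiver_reverse_at)
    show "jointly_injective H (reflection_functor G x M) I (\<lambda>i. reflection_hom G x (\<phi> i))"
      using Cons.prems(6) by (rule reflection_jointly_injective)
    fix i assume i: "i \<in> I"
    show "rep_hom H (reflection_functor G x M) (reflection_functor G x (N i)) (reflection_hom G x (\<phi> i))"
      using Cons.prems(5)[OF i] Cons.prems(3) Cons.prems(4)[OF i] by (rule reflection_hom)
    show "lin_rep H (reflection_functor G x (N i))"
      using Cons.prems(4)[OF i] by (rule reflection_lin_rep)
    show "space (seq_functor H S (reflection_functor G x (N i))) v = {0}"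
      using Cons.prems(8)[OF i] by (simp only: seq_functor.simps)
  qed (use Cons.prems reflection_lin_rep[OF Cons.prems(3)] in simp_all)
  then show ?case
    by (simp only: seq_functor.simps)
qed

lemma seq_functor_zero_if_embedded:
  assumes "graded_quiver G" "admissible G S" "lin_rep G M" "lin_rep G N" "rep_hom G M N \<phi>"
    and inj: "\<And>v u. v \<in> verts G \<Longrightarrow> u \<in> space M v \<Longrightarrow> \<phi> v u = 0 \<Longrightarrow> u = 0"
    and "v \<in> verts G" "space (seq_functor G S N) v = {0}"
  shows "space (seq_functor G S M) v = {0}"
proof (rule seq_functor_zero_if_jointly_injective[where I = "{()}" and N = "\<lambda>i. N" and \<phi> = "\<lambda>i. \<phi>"])
  show "jointly_injective G M {()} (\<lambda>i. \<phi>)"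
    unfolding jointly_injective_def using inj by blast
qed (rule assms)+

lemma seq_functor_zero:
  assumes "graded_quiver G" "admissible G S" "lin_rep G M"
    and "\<And>v. v \<in> verts G \<Longrightarrow> space M v = {0}" "v \<in> verts G"
  shows "space (seq_functor G S M) v = {0}"
proof (rule seq_functor_zero_if_jointly_injective[where I = "{} :: nat set" and N = "\<lambda>i. M"
      and \<phi> = "\<lambda>i v u. u"])
  show "jointly_injective G M ({} :: nat set) (\<lambda>i v u. u)"
    unfolding jointly_injective_def using assms(4) by blast
qed (fact assms | blast)+

lemma seq_functor_append:
  "seq_functor G (S @ T) M = seq_functor (reverse_along S G) T (seq_functor G S M)"
  by (induction S arbitrary: G M) auto

lemma seq_functor_other_vertex:
  assumes "v \<notin> set S"
  shows "space (seq_functor G S M) v = space M v"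
  using assms by (induction S arbitrary: G M) (auto simp: reflection_functor_def)

text \<open>An equality, not just an isomorphism: with no edge between \<open>x\<close> and
  \<open>y\<close>, neither reflection changes the spaces and maps that the other one reads.\<close>

lemma reflection_functor_commute:
  assumes "edges_between G x y = {}" "x \<noteq> y"
  shows "reflection_functor (reverse_at x G) y (reflection_functor G x M) =
    reflection_functor (reverse_at y G) x (reflection_functor G y M)"
proof -
  have one: "in_arcs (reverse_at x G) y = in_arcs G y \<and>
      incoming_sum (reverse_at x G) y (reflection_functor G x M) = incoming_sum G y M \<and>
      incoming_map (reverse_at x G) y (reflection_functor G x M) = incoming_map G y M"
    if xy: "edges_between G x y = {}" "x \<noteq> y" for x y
  proof -
    have ends: "\<not> (tail G a = x \<and> head G a = y)" "\<not> (tail G a = y \<and> head G a = x)" if "a \<in> arcs G" for a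
    proof -
      have "a \<notin> edges_between G x y"
        using xy(1) by simp
      then show "\<not> (tail G a = x \<and> head G a = y)" "\<not> (tail G a = y \<and> head G a = x)"
        using that by (auto simp: edges_between_def)
    qed
    have "head (reverse_at x G) a = y \<longleftrightarrow> head G a = y" if "a \<in> arcs G" for a
      using xy(2) ends[OF that] head_reverse_at[OF that, of x] by metis
    then have arcs: "in_arcs (reverse_at x G) y = in_arcs G y"
      unfolding in_arcs_def by auto
    have arc: "tail (reverse_at x G) a = tail G a" "tail G a \<noteq> x" "a \<notin> in_arcs G x"
      if a: "a \<in> in_arcs G y" for a
    proof -
      have "a \<in> arcs G" "head G a = y"
        using a by auto
      then show "tail (reverse_at x G) a = tail G a" "tail G a \<noteq> x" "a \<notin> in_arcs G x"
        using xy(2) ends(1)[of a] tail_reverse_at[of a G x] by auto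
    qed
    have "incoming_sum (reverse_at x G) y (reflection_functor G x M) = incoming_sum G y M"
    proof -
      have "space (reflection_functor G x M) (tail (reverse_at x G) a) = space M (tail G a)"
        if "a \<in> in_arcs G y" for a
        unfolding arc(1)[OF that] using arc(2)[OF that] by (simp add: reflection_functor_def)
      then show ?thesis
        unfolding incoming_sum_def arcs by (simp cong: ball_cong del: in_in_arcs_conv)
    qed
    moreover have "incoming_map (reverse_at x G) y (reflection_functor G x M) u = incoming_map G y M u" for u
      unfolding incoming_map_def arcs
      by (rule sum.cong) (simp_all add: reflection_functor_def arc(3) del: in_in_arcs_conv)
    ultimately show ?thesis
      using arcs by blast
  qed
  have "reflection_functor (reverse_at x G) y (reflection_functor G x M) = \<lparr>
      space = (space M)(x := {u \<in> incoming_sum G x M. incoming_map G x M u = 0},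
        y := {u \<in> incoming_sum G y M. incoming_map G y M u = 0}),
      arrow_map = (\<lambda>a. if a \<in> in_arcs G x \<union> in_arcs G y then arc_component a else arrow_map M a)\<rparr>"
    unfolding reflection_functor_def[of "reverse_at x G"] using one[OF assms]
    by (auto simp: reflection_functor_def fun_eq_iff)
  moreover have "reflection_functor (reverse_at y G) x (reflection_functor G y M) = \<lparr>
      space = (space M)(x := {u \<in> incoming_sum G x M. incoming_map G x M u = 0},
        y := {u \<in> incoming_sum G y M. incoming_map G y M u = 0}),
      arrow_map = (\<lambda>a. if a \<in> in_arcs G x \<union> in_arcs G y then arc_component a else arrow_map M a)\<rparr>"
    unfolding reflection_functor_def[of "reverse_at y G"]
    using one[of y x] assms by (auto simp: reflection_functor_def fun_eq_iff edges_between_commute)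
  ultimately show ?thesis
    by simp
qed

lemma seq_equiv_seq_functor:
  assumes "seq_equiv G S T"
  shows "seq_functor G S M = seq_functor G T M"
  using assms
proof (induction rule: seq_equiv_induct)
  case (swap U x y W)
  show ?case
  proof (cases "x = y")
    case False
    have e: "edges_between (reverse_along U G) x y = {}"
      using swap by simp
    show ?thesis
      using reverse_at_commute[OF e] reflection_functor_commute[OF e False, of "seq_functor (reverse_along U G) [] (seq_functor G U M)"]
      by (simp add: seq_functor_append)
  qed simp
qed

section \<open>The negative reflection functor\<close>

text \<open>\<open>Y\<close> lives on the reversed quiver, where \<open>x\<close> is a source. A
  violating vector would span a direct summand isomorphic to the simple representation at
  \<open>x\<close>, which the negative functor loses.\<close>

definition source_injective :: "('v, 'e) pre_digraph \<Rightarrow> 'v \<Rightarrow> ('v, 'e, 'k::field) quiver_rep \<Rightarrow> bool" where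
  "source_injective G x Y \<longleftrightarrow>
     (\<forall>u \<in> space Y x. (\<forall>a \<in> in_arcs G x. arrow_map Y a u = 0) \<longrightarrow> u = 0)"

text \<open>The strong form with scalars, the same one at all vertices. It survives negative
  reflections and holds for simple representations over any field.\<close>

definition brick :: "('v, 'e) pre_digraph \<Rightarrow> ('v, 'e, 'k::field) quiver_rep \<Rightarrow> bool" where
  "brick G M \<longleftrightarrow> (\<forall>\<phi>. rep_hom G M M \<phi> \<longrightarrow>
     (\<exists>c. \<forall>v \<in> verts G. \<forall>u \<in> space M v. \<phi> v u = coord_scale c u))"

context sink_reflection
begin

abbreviation source_image :: "('v, 'e, 'k::field) quiver_rep \<Rightarrow> ('e, 'k) coord_vec set" where
  "source_image Y \<equiv> source_map G x Y ` space Y x"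

abbreviation neg :: "('v, 'e, 'k::field) quiver_rep \<Rightarrow> ('v, 'e, 'k) quiver_rep" where
  "neg \<equiv> inverse_reflection G x"

abbreviation coker :: "('v, 'e, 'k::field) quiver_rep \<Rightarrow> ('e, 'k) coord_vec \<Rightarrow> ('e, 'k) coord_vec" where
  "coker Y \<equiv> quotient_map (source_image Y)"

lemma source_arrow:
  assumes "lin_rep H Y" "a \<in> in_arcs G x"
  shows "linear_between (space Y x) (space Y (tail G a)) (arrow_map Y a)"
  using lin_rep_arrow[OF assms(1), of a] in_arc[OF assms(2)] by simp

lemma source_space: "lin_rep H Y \<Longrightarrow> v \<in> verts G \<Longrightarrow> coord.subspace (space Y v)"
  by (rule lin_rep_subspace[of H]) simp_all

lemma source_sum_space: "lin_rep H Y \<Longrightarrow> coord.subspace (source_sum Y)"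
  by (rule source_sum_subspace) (rule source_space)

lemma component_source_map:
  "a \<in> in_arcs G x \<Longrightarrow> arc_component a (source_map G x Y u) = arrow_map Y a u"
  using finite_in by (simp add: source_map_def arc_coproduct.proj_sum)

lemma source_map_linear:
  assumes Y: "lin_rep H Y"
  shows "linear_between (space Y x) (source_sum Y) (source_map G x Y)"
proof -
  have "linear_between (space Y x) (source_sum Y) (\<lambda>u. \<Sum>a\<in>in_arcs G x. arc_inj a (arrow_map Y a u))"
  proof (rule linear_between_sum[OF source_sum_space[OF Y]])
    fix a assume a: "a \<in> in_arcs G x"
    show "linear_between (space Y x) (source_sum Y) (\<lambda>u. arc_inj a (arrow_map Y a u))"
      by (rule linear_between_compose[OF source_arrow[OF Y a] arc_inj_linear[OF a source_space[OF Y]]])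
  qed
  then show ?thesis
    by (simp add: source_map_def[abs_def])
qed

lemma source_image_subset:
  assumes "lin_rep H Y"
  shows "source_image Y \<subseteq> source_sum Y"
  using source_map_linear[OF assms] unfolding linear_between_def by (rule conjunct1)

lemma source_image_subspace: "lin_rep H Y \<Longrightarrow> coord.subspace (source_image Y)"
  by (rule subspace_image_between[OF source_space[OF _ x_vert] source_map_linear])

lemmas quotient = quotient_map[OF source_image_subspace]

lemma space_inverse: "space (neg Y) v =
    (if v = x then coker Y ` source_sum Y else space Y v)"
  by (simp add: inverse_reflection_def Let_def incoming_sum)

lemma space_inverse_sink:
  "space (neg Y) x = coker Y ` source_sum Y"
  by (simp add: space_inverse)

lemma space_inverse_other: "v \<noteq> x \<Longrightarrow> space (neg Y) v = space Y v"
  by (simp add: space_inverse)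

lemma arrow_inverse: "arrow_map (neg Y) a =
    (if a \<in> in_arcs G x then coker Y \<circ> arc_inj a else arrow_map Y a)"
  by (simp add: inverse_reflection_def Let_def)

lemma inj_in_source_sum:
  assumes "lin_rep H Y" "a \<in> in_arcs G x" "u \<in> space Y (tail G a)"
  shows "arc_inj a u \<in> source_sum Y"
  by (rule arc_coproduct.inj_in_dsum[where V = "\<lambda>a. space Y (tail G a)", OF finite_in assms(2,3)])
    (rule coord.subspace_0[OF source_space[OF assms(1) in_arc(4)]])

lemma inverse_lin_rep:
  assumes Y: "lin_rep H Y"
  shows "lin_rep G (neg Y)"
  unfolding lin_rep_def
proof (intro conjI ballI)
  fix v assume v: "v \<in> verts G"
  have "coord.subspace (coker Y ` source_sum Y)"
    by (rule subspace_image_between[OF source_sum_space[OF Y] linear_between_coord_linear[OF quotient(1)[OF Y] UNIV_I]])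
  then show "coord.subspace (space (neg Y) v)"
    using source_space[OF Y v] by (cases "v = x") (simp_all only: space_inverse_sink space_inverse_other not_False_eq_True)
next
  fix a assume a: "a \<in> arcs G"
  show "linear_between (space (neg Y) (tail G a))
      (space (neg Y) (head G a)) (arrow_map (neg Y) a)"
  proof (cases "a \<in> in_arcs G x")
    case True
    have "linear_between (space Y (tail G a)) (coker Y ` source_sum Y)
        (coker Y \<circ> arc_inj a)"
      unfolding comp_def
    proof (rule linear_between_compose[where f = "arc_inj a" and V = "source_sum Y" and g = "coker Y"])
      show "linear_between (space Y (tail G a)) (source_sum Y) (arc_inj a)"
        by (rule arc_inj_linear[OF True source_space[OF Y]])
      show "linear_between (source_sum Y) (coker Y ` source_sum Y) (coker Y)"
        by (rule linear_between_coord_linear[OF quotient(1)[OF Y]]) (rule imageI)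
    qed
    then show ?thesis
      using True in_arc[OF True] by (simp only: space_inverse arrow_inverse if_True simp_thms if_False)
  next
    case False
    then show ?thesis
      using other_arc[OF a False] lin_rep_arrow[OF Y, of a] a by (simp add: space_inverse arrow_inverse)
  qed
qed

lemma inverse_is_rep:
  assumes "is_rep H Y"
  shows "is_rep G (neg Y)"
proof -
  have Y: "lin_rep H Y"
    using assms by (rule is_rep_imp_lin_rep)
  have fin: "findim_subspace (space Y v)" if "v \<in> verts G" for v
    using assms that by (simp add: is_rep_def)
  have "findim_subspace (coker Y ` source_sum Y)"
    by (intro findim_subspace_image quotient(1) Y arc_coproduct.findim_dsum(1) finite_in fin in_arc(4))
  then have "findim_subspace (space (neg Y) v)" if "v \<in> verts G" for v
    using fin[OF that] by (cases "v = x") (simp_all only: space_inverse_sink space_inverse_other not_False_eq_True)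
  then show ?thesis
    using inverse_lin_rep[OF Y] by (simp add: is_rep_def lin_rep_def)
qed

lemma source_map_inj_on:
  assumes Y: "lin_rep H Y" and inj: "source_injective G x Y"
  shows "inj_on (source_map G x Y) (space Y x)"
proof (rule inj_onI)
  fix u v assume uv: "u \<in> space Y x" "v \<in> space Y x" "source_map G x Y u = source_map G x Y v"
  have "arrow_map Y a (u - v) = 0" if a: "a \<in> in_arcs G x" for a
  proof -
    have "arrow_map Y a u = arrow_map Y a v"
      using component_source_map[OF a, of Y u] component_source_map[OF a, of Y v] uv(3) by (simp only:)
    then show ?thesis
      using linear_betweenD(3)[OF source_arrow[OF Y a] source_space[OF Y x_vert] uv(1,2)]
      by (simp only: diff_self)
  qed
  moreover have "u - v \<in> space Y x"
    using source_space[OF Y x_vert] uv(1,2) by (rule coord.subspace_diff)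
  ultimately have "u - v = 0"
    using inj unfolding source_injective_def by blast
  then show "u = v"
    by simp
qed

lemma quotient_expand:
  assumes Y: "lin_rep H Y" and u: "u \<in> source_sum Y"
  shows "coker Y u =
    (\<Sum>a\<in>in_arcs G x. coker Y (arc_inj a (arc_component a u)))"
  by (subst arc_coproduct.dsum_expand[OF u]) (rule coord_linearD(5)[OF quotient(1)[OF Y]])

lemma source_sum_inverse: "source_sum (neg Y) = source_sum Y"
  using in_arc(3) by (intro arc_coproduct.dsum_cong) (simp only: space_inverse if_False)

lemma incoming_map_inverse:
  assumes Y: "lin_rep H Y" and u: "u \<in> source_sum Y"
  shows "incoming_map G x (neg Y) u = coker Y u"
  unfolding incoming_map_def quotient_expand[OF Y u]
  by (rule sum.cong[OF refl]) (simp only: arrow_inverse if_True simp_thms o_apply)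

text \<open>The incoming map of \<open>neg Y\<close> is the cokernel map, and its kernel is the
  image of \<open>source_map\<close>. So going back and forth only replaces the space at
  \<open>x\<close> by this image.\<close>

lemma space_reflection_inverse:
  assumes Y: "lin_rep H Y"
  shows "space (pos (neg Y)) v =
    (if v = x then source_image Y else space Y v)"
proof (cases "v = x")
  case True
  have "u \<in> source_sum Y \<and> incoming_map G x (neg Y) u = 0 \<longleftrightarrow> u \<in> source_image Y" for u
    using incoming_map_inverse[OF Y, of u] quotient(2)[OF Y, of u] source_image_subset[OF Y] by auto
  then show ?thesis
    unfolding space_reflection source_sum_inverse using True by simp
next
  case False
  then show ?thesis
    by (simp only: space_reflection space_inverse if_False)
qed

lemma arrow_reflection_inverse: "arrow_map (pos (neg Y)) a =
    (if a \<in> in_arcs G x then arc_component a else arrow_map Y a)"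
  by (simp add: arrow_reflection arrow_inverse)

text \<open>The unit of the adjunction at \<open>Y\<close>. It is an isomorphism exactly when
  \<open>source_map\<close> is injective on the space at \<open>x\<close>.\<close>

definition unit_hom :: "('v, 'e, 'k::field) quiver_rep \<Rightarrow> 'v \<Rightarrow> ('e, 'k) coord_vec \<Rightarrow> ('e, 'k) coord_vec" where
  "unit_hom Y v = (if v = x then source_map G x Y else (\<lambda>u. u))"

definition unit_inverse :: "('v, 'e, 'k::field) quiver_rep \<Rightarrow> 'v \<Rightarrow> ('e, 'k) coord_vec \<Rightarrow> ('e, 'k) coord_vec" where
  "unit_inverse Y v = (if v = x then inv_into (space Y x) (source_map G x Y) else (\<lambda>u. u))"

lemma linear_between_id: "linear_between V V (\<lambda>u. u)"
  by (simp add: linear_between_def)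

lemma unit_hom:
  assumes Y: "lin_rep H Y"
  shows "rep_hom H Y (pos (neg Y)) (unit_hom Y)"
  unfolding rep_hom_def
proof (intro conjI ballI)
  fix v assume v: "v \<in> verts H"
  have "linear_between (space Y x) (source_image Y) (source_map G x Y)"
    by (rule linear_between_subset[OF source_map_linear[OF Y] order_refl]) (rule imageI)
  then show "linear_between (space Y v) (space (pos (neg Y)) v) (unit_hom Y v)"
    by (simp add: linear_between_id space_reflection_inverse[OF Y] unit_hom_def)
next
  fix a u assume "a \<in> arcs H"
  then have a: "a \<in> arcs G"
    by simp
  show "unit_hom Y (head H a) (arrow_map Y a u) =
      arrow_map (pos (neg Y)) a (unit_hom Y (tail H a) u)"
  proof (cases "a \<in> in_arcs G x")
    case True
    show ?thesis
      using in_arc[OF True] True component_source_map[OF True, of Y u]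
      by (simp only: arrow_reflection_inverse unit_hom_def if_True simp_thms if_False)
  next
    case False
    then show ?thesis
      using other_arc[OF a False] by (simp only: arrow_reflection_inverse unit_hom_def if_False)
  qed
qed

lemma unit_inverse_unit:
  assumes "lin_rep H Y" "source_injective G x Y" "u \<in> space Y v"
  shows "unit_inverse Y v (unit_hom Y v u) = u"
  using source_map_inj_on[OF assms(1,2)] assms(3) by (auto simp: unit_inverse_def unit_hom_def)

lemma unit_inverse:
  assumes Y: "lin_rep H Y" and inj: "source_injective G x Y"
  shows "rep_hom H (pos (neg Y)) Y (unit_inverse Y)"
proof -
  have inv: "inv_into (space Y x) (source_map G x Y) (source_map G x Y u) = u" if "u \<in> space Y x" for u
    using source_map_inj_on[OF Y inj] that by (rule inv_into_f_f)
  have lin: "linear_between (source_image Y) (space Y x) (inv_into (space Y x) (source_map G x Y))"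
    by (rule linear_between_inv_into[OF source_map_linear[OF Y] source_space[OF Y x_vert] source_map_inj_on[OF Y inj]])
  show ?thesis
    unfolding rep_hom_def
  proof (intro conjI ballI)
    fix v assume v: "v \<in> verts H"
    show "linear_between (space (pos (neg Y)) v) (space Y v) (unit_inverse Y v)"
      using lin by (simp add: linear_between_id space_reflection_inverse[OF Y] unit_inverse_def)
  next
    fix a w assume "a \<in> arcs H" and w: "w \<in> space (pos (neg Y)) (tail H a)"
    then have a: "a \<in> arcs G"
      by simp
    show "unit_inverse Y (head H a) (arrow_map (pos (neg Y)) a w) =
        arrow_map Y a (unit_inverse Y (tail H a) w)"
    proof (cases "a \<in> in_arcs G x")
      case True
      obtain u where u: "u \<in> space Y x" "w = source_map G x Y u"
        using w in_arc(5)[OF True] by (auto simp: space_reflection_inverse[OF Y])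
      show ?thesis
        using in_arc[OF True] True component_source_map[OF True, of Y u] inv[OF u(1)] u(2)
        by (simp only: arrow_reflection_inverse unit_inverse_def if_True simp_thms if_False)
    next
      case False
      then show ?thesis
        using other_arc[OF a False] by (simp only: arrow_reflection_inverse unit_inverse_def if_False)
    qed
  qed
qed

lemma unit_hom_zero:
  assumes Y: "lin_rep H Y" and v: "v \<in> verts G"
  shows "unit_hom Y v 0 = 0"
  using linear_betweenD(5)[OF rep_hom_linear[OF unit_hom[OF Y]] source_space[OF Y v]] v by simp

text \<open>The unit and its inverse are both injective, so left exactness applied in both
  directions stands in for invariance under isomorphism.\<close>

lemma seq_functor_inverse_zero_iff:
  assumes Y: "lin_rep H Y" and inj: "source_injective G x Y"
    and S: "admissible H S" and v: "v \<in> verts G"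
  shows "space (seq_functor H S (pos (neg Y))) v = {0} \<longleftrightarrow>
    space (seq_functor H S Y) v = {0}"
proof -
  have H: "graded_quiver H" and v': "v \<in> verts H"
    using graded_quiver_reverse_at[OF graded sink] v by simp_all
  have FY: "lin_rep H (pos (neg Y))"
    using inverse_lin_rep[OF Y] by (rule reflection_lin_rep)
  note unit_inv = unit_inverse_unit[OF Y inj]
  have unit_inverse_zero: "unit_inverse Y w 0 = 0" if "w \<in> verts G" for w
    using unit_inv[OF coord.subspace_0[OF source_space[OF Y that]]] unit_hom_zero[OF Y that] by (simp only:)
  show ?thesis
  proof
    assume z: "space (seq_functor H S (pos (neg Y))) v = {0}"
    show "space (seq_functor H S Y) v = {0}"
    proof (rule seq_functor_zero_if_embedded[OF H S Y FY unit_hom[OF Y] _ v' z])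
      fix w u assume "w \<in> verts H" "u \<in> space Y w" "unit_hom Y w u = 0"
      then show "u = 0"
        using unit_inv[of u w] unit_inverse_zero[of w] unfolding verts_reverse_at by (simp only:)
    qed
  next
    assume z: "space (seq_functor H S Y) v = {0}"
    show "space (seq_functor H S (pos (neg Y))) v = {0}"
    proof (rule seq_functor_zero_if_embedded[OF H S FY Y unit_inverse[OF Y inj] _ v' z])
      fix w u' assume w: "w \<in> verts H"
        "u' \<in> space (pos (neg Y)) w" "unit_inverse Y w u' = 0"
      then obtain u where "u \<in> space Y w" "u' = unit_hom Y w u"
        by (auto simp: space_reflection_inverse[OF Y] unit_hom_def split: if_splits)
      then show "u' = 0"
        using unit_inv[of u w] w(1,3) unit_hom_zero[OF Y, of w] unfolding verts_reverse_at by (simp only:)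
    qed
  qed
qed

text \<open>One half of the adjunction between the negative and the positive reflection functor.\<close>

lemma lift_hom:
  assumes Y: "lin_rep H Y" and M: "lin_rep G M"
    and \<phi>: "rep_hom H Y (pos M) \<phi>"
  obtains \<psi> where "rep_hom G (neg Y) M \<psi>" "\<And>v. v \<noteq> x \<Longrightarrow> \<psi> v = \<phi> v"
proof -
  define \<theta> where "\<theta> = (\<lambda>d. \<Sum>a\<in>in_arcs G x. arrow_map M a (\<phi> (tail G a) (arc_component a d)))"
  have \<phi>_lin: "linear_between (space Y (tail G a)) (space M (tail G a)) (\<phi> (tail G a))"
    if "a \<in> in_arcs G x" for a
    using rep_hom_linear[OF \<phi>, of "tail G a"] in_arc[OF that] by (simp add: space_reflection)
  note \<phi>l = linear_betweenD[OF \<phi>_lin source_space[OF _ in_arc(4)], OF _ Y]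
  have M_lin: "linear_between (space M (tail G a)) (space M x) (arrow_map M a)" if "a \<in> in_arcs G x" for a
    using lin_rep_arrow[OF M in_arc(1)[OF that]] in_arc(2)[OF that] by simp
  note Ml = linear_betweenD[OF M_lin lin_rep_subspace[OF M in_arc(4)]]
  have "linear_between (source_sum Y) (space M x)
      (\<lambda>d. \<Sum>a\<in>in_arcs G x. arrow_map M a (\<phi> (tail G a) (arc_component a d)))"
  proof (rule linear_between_sum[OF lin_rep_subspace[OF M x_vert]])
    fix a assume a: "a \<in> in_arcs G x"
    show "linear_between (source_sum Y) (space M x) (\<lambda>d. arrow_map M a (\<phi> (tail G a) (arc_component a d)))"
      by (rule linear_between_compose[OF linear_between_compose[OF component_linear[OF a] \<phi>_lin[OF a]] M_lin[OF a]])
  qed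
  then have \<theta>_lin: "linear_between (source_sum Y) (space M x) \<theta>"
    by (simp only: \<theta>_def)
  have \<phi>_arrow: "\<phi> (tail G a) (arrow_map Y a u) = arc_component a (\<phi> x u)"
    if "a \<in> in_arcs G x" "u \<in> space Y x" for a u
    using rep_hom_commute[OF \<phi>, of a u] in_arc[OF that(1)] that
    by (simp add: arrow_reflection)
  \<comment> \<open>On the image of \<open>source_map\<close>, \<open>\<theta>\<close> becomes the
    incoming map of \<open>M\<close> applied to \<open>\<phi> x u\<close>. This is zero because
    \<open>\<phi> x u\<close> lies in the kernel that is the space of \<open>pos M\<close> at
    \<open>x\<close>. Hence \<open>\<theta>\<close> factors through the cokernel.\<close>
  have ker: "\<theta> d = 0" if "d \<in> source_sum Y" and d: "coker Y d = 0" for d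
  proof -
    obtain u where u: "u \<in> space Y x" "d = source_map G x Y u"
      using d unfolding quotient(2)[OF Y] by blast
    have "\<theta> d = (\<Sum>a\<in>in_arcs G x. arrow_map M a (arc_component a (\<phi> x u)))"
      unfolding \<theta>_def u(2)
      by (rule sum.cong[OF refl]) (simp only: component_source_map \<phi>_arrow[OF _ u(1)])
    also have "\<dots> = incoming_map G x M (\<phi> x u)"
      by (simp add: incoming_map_def)
    also have "\<dots> = 0"
    proof -
      have "\<phi> x u \<in> space (pos M) x"
        using rep_hom_linear[OF \<phi>, of x] x_vert u(1) by (auto simp: linear_between_def)
      then show ?thesis
        unfolding space_reflection by simp
    qed
    finally show ?thesis .
  qed
  obtain \<psi>x where \<psi>x: "linear_between (coker Y ` source_sum Y) (space M x) \<psi>x"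
    "\<And>d. d \<in> source_sum Y \<Longrightarrow> \<psi>x (coker Y d) = \<theta> d"
    by (rule linear_factor[OF source_sum_space[OF Y] quotient(1)[OF Y] \<theta>_lin ker])
      (assumption | rule that | blast)+
  have "rep_hom G (neg Y) M (\<phi>(x := \<psi>x))"
    unfolding rep_hom_def
  proof (intro conjI ballI)
    fix v assume v: "v \<in> verts G"
    show "linear_between (space (neg Y) v) (space M v) ((\<phi>(x := \<psi>x)) v)"
      using \<psi>x(1) rep_hom_linear[OF \<phi>, of v] v by (cases "v = x") (simp_all add: space_inverse space_reflection)
  next
    fix a u assume a: "a \<in> arcs G" and u: "u \<in> space (neg Y) (tail G a)"
    show "(\<phi>(x := \<psi>x)) (head G a) (arrow_map (neg Y) a u) =
        arrow_map M a ((\<phi>(x := \<psi>x)) (tail G a) u)"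
    proof (cases "a \<in> in_arcs G x")
      case True
      have u': "u \<in> space Y (tail G a)"
        using u in_arc(3)[OF True] by (simp add: space_inverse)
      have "\<psi>x (coker Y (arc_inj a u)) = \<theta> (arc_inj a u)"
        using inj_in_source_sum[OF Y True u'] by (rule \<psi>x(2))
      also have "\<dots> = (\<Sum>b\<in>in_arcs G x. if b = a then arrow_map M a (\<phi> (tail G a) u) else 0)"
        unfolding \<theta>_def
      proof (rule sum.cong[OF refl])
        fix b assume b: "b \<in> in_arcs G x"
        show "arrow_map M b (\<phi> (tail G b) (arc_component b (arc_inj a u))) =
            (if b = a then arrow_map M a (\<phi> (tail G a) u) else 0)"
          using \<phi>l(5)[OF b b] Ml(5)[OF b b] by (cases "b = a") (simp_all only: arc_coproduct.proj_inj if_True simp_thms if_False)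
      qed
      also have "\<dots> = arrow_map M a (\<phi> (tail G a) u)"
        using finite_in True by (simp only: sum.delta if_True simp_thms)
      finally show ?thesis
        using True in_arc[OF True] by (simp only: arrow_inverse if_True simp_thms o_apply fun_upd_apply if_False)
    next
      case False
      then show ?thesis
        using other_arc[OF a False] rep_hom_commute[OF \<phi>, of a u] a u
        by (simp add: arrow_inverse arrow_reflection space_inverse)
    qed
  qed
  then show thesis
    by (rule that) simp
qed

text \<open>A nonzero vector of \<open>pos M\<close> at \<open>x\<close> has a nonzero component, so
  a morphism that is nonzero at \<open>x\<close> is also nonzero at a neighbour. This matters
  because lifting a morphism keeps it only away from \<open>x\<close>.\<close>

lemma hom_nonzero_off_sink:
  assumes Y: "lin_rep H Y" and M: "lin_rep G M"
    and \<phi>: "rep_hom H Y (pos M) \<phi>"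
    and u: "u \<in> space Y v" "v \<in> verts G" "\<phi> v u \<noteq> 0"
  obtains w u' where "w \<in> verts G" "w \<noteq> x" "u' \<in> space Y w" "\<phi> w u' \<noteq> 0"
proof (cases "v = x")
  case True
  have "\<phi> x u \<in> source_sum M"
    using rep_hom_linear[OF \<phi>, of x] x_vert u(1) True by (auto simp: linear_between_def space_reflection)
  then obtain a where a: "a \<in> in_arcs G x" "arc_component a (\<phi> x u) \<noteq> 0"
    using source_sum_zeroI[of "\<phi> x u" M] u(3) True by blast
  have "\<phi> (tail G a) (arrow_map Y a u) = arc_component a (\<phi> x u)"
    using rep_hom_commute[OF \<phi>, of a u] in_arc[OF a(1)] a(1) u(1) True by (simp add: arrow_reflection)
  moreover have "arrow_map Y a u \<in> space Y (tail G a)"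
    using source_arrow[OF Y a(1)] u(1) True by (auto simp: linear_between_def)
  ultimately show thesis
    using a in_arc[OF a(1)] that by metis
next
  case False
  then show thesis
    using u that by blast
qed

text \<open>Reflecting an endomorphism of \<open>neg Y\<close> and conjugating with the unit gives
  one of \<open>Y\<close>, hence a scalar. It determines the original one away from
  \<open>x\<close>, and at \<open>x\<close> as well, since that space is generated by the images of
  the incoming arrows.\<close>

lemma brick_inverse:
  assumes Y: "lin_rep H Y" and inj: "source_injective G x Y" and brick: "brick H Y"
  shows "brick G (neg Y)"
  unfolding brick_def
proof (intro allI impI)
  fix \<phi> assume \<phi>: "rep_hom G (neg Y) (neg Y) \<phi>"
  note X = inverse_lin_rep[OF Y]
  note F\<phi> = reflection_hom[OF \<phi> X X]
  define \<chi> where "\<chi> = (\<lambda>v u. unit_inverse Y v (reflection_hom G x \<phi> v (unit_hom Y v u)))"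
  note H = graded_quiver_reverse_at[OF graded sink]
  have "rep_hom H Y Y \<chi>"
    unfolding \<chi>_def
    by (rule rep_hom_compose[OF H rep_hom_compose[OF H unit_hom[OF Y] F\<phi>] unit_inverse[OF Y inj]])
  then obtain c where c: "\<And>v u. v \<in> verts G \<Longrightarrow> u \<in> space Y v \<Longrightarrow> \<chi> v u = coord_scale c u"
    using brick unfolding brick_def verts_reverse_at by blast
  have off: "\<phi> v u = coord_scale c u" if "v \<in> verts G" "v \<noteq> x" "u \<in> space Y v" for v u
    using c[OF that(1,3)] that(2) by (simp add: \<chi>_def unit_inverse_def unit_hom_def reflection_hom_def)
  have at: "\<phi> x w = coord_scale c w" if w_in: "w \<in> space (neg Y) x" for w
  proof -
    let ?q = "coker Y"
    obtain d where d: "d \<in> source_sum Y" "w = ?q d"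
      using w_in unfolding space_inverse_sink by blast
    have d_comp: "arc_component a d \<in> space Y (tail G a)" if "a \<in> in_arcs G x" for a
      using d(1) that by (rule component_in)
    have arrow: "?q (arc_inj a u) = arrow_map (neg Y) a u" if "a \<in> in_arcs G x" for a u
      using that by (simp only: arrow_inverse if_True simp_thms o_apply)
    have w: "w = (\<Sum>a\<in>in_arcs G x. ?q (arc_inj a (arc_component a d)))"
      unfolding d(2) using Y d(1) by (rule quotient_expand)
    have "\<phi> x w = (\<Sum>a\<in>in_arcs G x. \<phi> x (?q (arc_inj a (arc_component a d))))"
      unfolding w
    proof (rule linear_betweenD(6)[OF rep_hom_linear[OF \<phi> x_vert] lin_rep_subspace[OF X x_vert]])
      fix a assume a: "a \<in> in_arcs G x"
      show "?q (arc_inj a (arc_component a d)) \<in> space (neg Y) x"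
        using inj_in_source_sum[OF Y a d_comp[OF a]] by (simp add: space_inverse)
    qed
    also have "\<dots> = (\<Sum>a\<in>in_arcs G x. coord_scale c (?q (arc_inj a (arc_component a d))))"
    proof (rule sum.cong[OF refl])
      fix a assume a: "a \<in> in_arcs G x"
      have "\<phi> x (?q (arc_inj a (arc_component a d))) =
          arrow_map (neg Y) a (\<phi> (tail G a) (arc_component a d))"
        unfolding arrow[OF a]
        using rep_hom_commute[OF \<phi> in_arc(1)[OF a], of "arc_component a d"] d_comp[OF a] in_arc(2,3)[OF a]
        by (simp add: space_inverse)
      also have "\<dots> = ?q (arc_inj a (coord_scale c (arc_component a d)))"
        unfolding arrow[OF a] off[OF in_arc(4)[OF a] in_arc(3)[OF a] d_comp[OF a]] ..
      also have "\<dots> = coord_scale c (?q (arc_inj a (arc_component a d)))"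
        by (simp only: coord_linearD(3)[OF arc_coproduct.linear_inj] coord_linearD(3)[OF quotient(1)[OF Y]])
      finally show "\<phi> x (?q (arc_inj a (arc_component a d))) = coord_scale c (?q (arc_inj a (arc_component a d)))" .
    qed
    also have "\<dots> = coord_scale c w"
      unfolding w coord.scale_sum_right ..
    finally show ?thesis .
  qed
  have "\<phi> v u = coord_scale c u" if "v \<in> verts G" "u \<in> space (neg Y) v" for v u
    using that at[of u] off[of v u] by (cases "v = x") (simp_all add: space_inverse)
  then show "\<exists>c. \<forall>v\<in>verts G. \<forall>u\<in>space (neg Y) v. \<phi> v u = coord_scale c u"
    by blast
qed

text \<open>If all arrows kill \<open>u0\<close> at the source \<open>x\<close>, then a projection
  onto its line, extended by zero, is an endomorphism. It must be a scalar and fixes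
  \<open>u0\<close>, so it is the identity and all of \<open>Y\<close> is the line of
  \<open>u0\<close>.\<close>

lemma brick_not_source_injective:
  assumes Y: "lin_rep H Y" and brick: "brick H Y" and not_inj: "\<not> source_injective G x Y"
  obtains u0 where "u0 \<noteq> 0" "space Y x = coord.span {u0}"
    "\<And>v. v \<in> verts G \<Longrightarrow> v \<noteq> x \<Longrightarrow> space Y v = {0}" "\<And>a. a \<in> in_arcs G x \<Longrightarrow> arrow_map Y a u0 = 0"
proof -
  obtain u0 where u0: "u0 \<in> space Y x" "u0 \<noteq> 0" "\<And>a. a \<in> in_arcs G x \<Longrightarrow> arrow_map Y a u0 = 0"
    using not_inj unfolding source_injective_def by blast
  obtain p where p: "coord_linear p" "p u0 = u0" "\<And>u. \<exists>c. p u = coord_scale c u0"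
    using linear_functional_fixing[OF u0(2)] by metis
  define \<chi> where "\<chi> = (\<lambda>v. if v = x then p else (\<lambda>u. 0))"
  have p_in: "p u \<in> space Y x" for u
    using p(3)[of u] coord.subspace_scale[OF source_space[OF Y x_vert] u0(1)] by metis
  have "rep_hom H Y Y \<chi>"
    unfolding rep_hom_def
  proof (intro conjI ballI)
    fix v assume "v \<in> verts H"
    then have "linear_between (space Y v) (space Y v) (\<lambda>u. 0)"
      using coord.subspace_0[OF source_space[OF Y]]
      by (intro linear_betweenI) (simp_all only: verts_reverse_at coord.scale_zero_right add_0)
    then show "linear_between (space Y v) (space Y v) (\<chi> v)"
      using linear_between_coord_linear[OF p(1) p_in] by (simp add: \<chi>_def)
  next
    fix a u assume "a \<in> arcs H"
    then have a: "a \<in> arcs G"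
      by simp
    show "\<chi> (head H a) (arrow_map Y a u) = arrow_map Y a (\<chi> (tail H a) u)"
    proof (cases "a \<in> in_arcs G x")
      case True
      obtain c where c: "p u = coord_scale c u0"
        using p(3) by metis
      have "arrow_map Y a (p u) = 0"
        unfolding c linear_betweenD(4)[OF source_arrow[OF Y True] source_space[OF Y x_vert] u0(1)]
          u0(3)[OF True] by (rule coord.scale_zero_right)
      then show ?thesis
        using in_arc[OF True] by (simp only: \<chi>_def if_True simp_thms if_False simp_thms)
    next
      case False
      have "arrow_map Y a 0 = 0"
        using linear_betweenD(5)[OF lin_rep_arrow[OF Y, of a] source_space[OF Y]] a ends_verts(1)[OF a]
          other_arc(3)[OF a False] by simp
      then show ?thesis
        using other_arc[OF a False] by (simp only: \<chi>_def if_False)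
    qed
  qed
  then obtain c where c: "\<And>v u. v \<in> verts G \<Longrightarrow> u \<in> space Y v \<Longrightarrow> \<chi> v u = coord_scale c u"
    using brick unfolding brick_def verts_reverse_at by blast
  have "coord_scale c u0 = coord_scale 1 u0"
    using c[OF x_vert u0(1)] p(2) by (simp only: \<chi>_def if_True simp_thms coord.scale_one)
  then have c1: "c = 1"
    using u0(2) by (simp only: coord.scale_cancel_right) simp
  have "u \<in> coord.span {u0}" if "u \<in> space Y x" for u
  proof -
    have "p u = u"
      using c[OF x_vert that] c1 by (simp only: \<chi>_def if_True simp_thms coord.scale_one)
    then show ?thesis
      using p(3)[of u] coord.span_scale[OF coord.span_base[of u0 "{u0}"]] by (metis singletonI)
  qed
  moreover have "coord.span {u0} \<subseteq> space Y x"
    using u0(1) source_space[OF Y x_vert] by (intro coord.span_minimal) simp_all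
  ultimately have "space Y x = coord.span {u0}"
    by blast
  moreover have "space Y v = {0}" if v: "v \<in> verts G" "v \<noteq> x" for v
  proof -
    have "u = 0" if "u \<in> space Y v" for u
      using c[OF v(1) that] v(2) c1 by (simp only: \<chi>_def if_False coord.scale_one)
    then show ?thesis
      using coord.subspace_0[OF source_space[OF Y v(1)]] by blast
  qed
  ultimately show thesis
    using that u0 by blast
qed

text \<open>Dimension count in the exact sequence from the space at the source into the direct sum
  and on to its cokernel.\<close>

lemma dim_inverse:
  assumes rep: "is_rep H Y" and inj: "source_injective G x Y"
  shows "coord.dim (space (neg Y) x) + coord.dim (space Y x) =
    (\<Sum>a\<in>in_arcs G x. coord.dim (space Y (tail G a)))"
proof -
  have Y: "lin_rep H Y"
    using rep by (rule is_rep_imp_lin_rep)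
  have fin: "findim_subspace (space Y v)" if "v \<in> verts G" for v
    using rep that by (simp add: is_rep_def)
  have D: "findim_subspace (source_sum Y)"
    "coord.dim (source_sum Y) = (\<Sum>a\<in>in_arcs G x. coord.dim (space Y (tail G a)))"
    using arc_coproduct.findim_dsum[where V = "\<lambda>a. space Y (tail G a)", OF finite_in fin[OF in_arc(4)]]
    by simp_all
  have zero: "source_map G x Y u = 0 \<Longrightarrow> u = 0" if "u \<in> space Y x" for u
    using inj_onD[OF source_map_inj_on[OF Y inj] _ that coord.subspace_0[OF source_space[OF Y x_vert]]]
      linear_betweenD(5)[OF source_map_linear[OF Y] source_space[OF Y x_vert]] by (simp only:)
  have ker: "{u \<in> source_sum Y. coker Y u = 0} = source_image Y"
    unfolding quotient(2)[OF Y] using source_image_subset[OF Y] by blast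
  have lin: "linear_between (source_sum Y) UNIV (coker Y)"
    by (rule linear_between_coord_linear[OF quotient(1)[OF Y] UNIV_I])
  have "coord.dim (source_sum Y) = coord.dim (source_image Y) +
      coord.dim (coker Y ` source_sum Y)"
    using rank_nullity(2)[OF D(1) lin] unfolding ker .
  moreover have "coord.dim (source_image Y) = coord.dim (space Y x)"
    by (rule dim_image_injective[OF fin[OF x_vert] source_map_linear[OF Y] zero])
  ultimately show ?thesis
    using D(2) by (simp only: space_inverse if_True simp_thms add.commute)
qed

text \<open>At a sink every edge is an incoming arc, so the reflection takes the form in which
  \<open>dim_inverse\<close> computes dimensions.\<close>

lemma lookup_simple_reflection:
  "Poly_Mapping.lookup (simple_reflection G x z) v =
    (if v = x then (\<Sum>a\<in>in_arcs G x. Poly_Mapping.lookup z (tail G a)) - Poly_Mapping.lookup z x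
     else Poly_Mapping.lookup z v)"
  using subset_UNIV
proof (induction z rule: frag_induction)
  case zero
  then show ?case
    using simple_reflection_diff[of G x 0 0] by simp
next
  case (one j)
  have "(\<Sum>a\<in>in_arcs G x. Poly_Mapping.lookup (frag_of j) (tail G a)) = int (card {a \<in> in_arcs G x. tail G a = j})"
    using finite_in by (simp add: sum.If_cases Int_def del: in_in_arcs_conv)
  moreover have "{a \<in> in_arcs G x. tail G a = j} = (if j = x then {} else edges_between G x j)"
  proof (cases "j = x")
    case True
    then show ?thesis
      using in_arc(3) by auto
  next
    case False
    have "a \<in> arcs G \<and> head G a = x \<and> tail G a = j \<longleftrightarrow> a \<in> edges_between G x j" for a
      using sink by (auto simp: edges_between_def sink_iff doubleton_eq_iff)
    then show ?thesis
      using False by auto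
  qed
  ultimately show ?case
    by (auto simp: simple_reflection_frag_of lookup_minus cartan_entry_def)
next
  case (diff y z)
  then show ?case
    by (simp add: simple_reflection_diff lookup_minus sum_subtractf)
qed

end

section \<open>Representations attached to the letters of a sequence\<close>

definition base_vec :: "('e, 'k::field) coord_vec" where
  "base_vec = (\<lambda>i. if i = ([], 0) then 1 else 0)"

definition simple_rep :: "'v \<Rightarrow> ('v, 'e, 'k::field) quiver_rep" where
  "simple_rep v = \<lparr>space = (\<lambda>w. if w = v then coord.span {base_vec} else {0}), arrow_map = (\<lambda>a u. 0)\<rparr>"

text \<open>
  For an admissible sequence \<open>A\<close> followed by \<open>v\<close>, the simple representation at \<open>v\<close> is pulled back
  along \<open>A\<close> by negative reflection functors, as long as no simple summand gets lost.
\<close>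

inductive is_letter_rep :: "('v, 'e) pre_digraph \<Rightarrow> 'v list \<Rightarrow> 'v \<Rightarrow> ('v, 'e, 'k::field) quiver_rep \<Rightarrow> bool" where
  Nil: "is_letter_rep G [] v (simple_rep v)"
| Cons: "is_letter_rep (reverse_at x G) A v Y \<Longrightarrow> source_injective G x Y \<Longrightarrow>
    is_letter_rep G (x # A) v (inverse_reflection G x Y)"

lemma base_vec_nonzero: "base_vec \<noteq> 0"
  using fun_cong[of base_vec 0 "([], 0)"] by (auto simp: base_vec_def)

lemma space_simple_rep: "space (simple_rep v) v = coord.span {base_vec}"
  "w \<noteq> v \<Longrightarrow> space (simple_rep v) w = {0}"
  by (simp_all add: simple_rep_def)

lemma arrow_simple_rep: "arrow_map (simple_rep v) a u = 0"
  by (simp add: simple_rep_def)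

lemma findim_subspace_zero: "findim_subspace {0}"
  by (metis coord.span_empty finite.emptyI findim_subspace_span)

lemma linear_between_zero: "coord.subspace W \<Longrightarrow> linear_between V W (\<lambda>u. 0)"
  by (rule linear_betweenI) (simp_all only: coord.subspace_0 coord.scale_zero_right add_0)

lemma is_rep_simple_rep: "is_rep (G :: ('v, 'e) pre_digraph) (simple_rep v :: ('v, 'e, 'k::field) quiver_rep)"
proof -
  let ?L = "simple_rep v :: ('v, 'e, 'k) quiver_rep"
  have fin: "findim_subspace (space ?L w)" for w
    by (cases "w = v") (simp_all add: space_simple_rep findim_subspace_zero findim_subspace_span)
  have zero: "arrow_map ?L a = (\<lambda>u. 0)" for a
    by (rule ext) (rule arrow_simple_rep)
  show ?thesis
    unfolding is_rep_def zero
    by (intro conjI ballI fin linear_between_zero findim_subspace_imp_subspace)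
qed

lemma dim_simple_rep: "coord.dim (space (simple_rep v) w) = of_bool (w = v)"
proof (cases "w = v")
  case True
  then show ?thesis
    by (simp add: space_simple_rep(1) coord.dim_eq_card_independent base_vec_nonzero)
next
  case False
  then show ?thesis
    by (simp add: space_simple_rep(2) coord_dim_zero)
qed

lemma brick_simple_rep:
  fixes G :: "('v, 'e) pre_digraph"
  assumes v: "v \<in> verts G"
  shows "brick G (simple_rep v :: ('v, 'e, 'k::field) quiver_rep)"
  unfolding brick_def
proof (intro allI impI)
  fix \<phi> assume \<phi>: "rep_hom G (simple_rep v :: ('v, 'e, 'k) quiver_rep) (simple_rep v) \<phi>"
  have sub: "coord.subspace (space (simple_rep v :: ('v, 'e, 'k) quiver_rep) w)" if "w \<in> verts G" for w
    by (rule lin_rep_subspace[OF is_rep_imp_lin_rep[OF is_rep_simple_rep] that])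
  note lin = linear_betweenD[OF rep_hom_linear[OF \<phi>] sub]
  have b: "base_vec \<in> space (simple_rep v :: ('v, 'e, 'k) quiver_rep) v"
    unfolding space_simple_rep(1) by (rule coord.span_base) simp
  have "\<phi> v base_vec \<in> coord.span {base_vec}"
    using lin(1)[OF v v b] unfolding space_simple_rep(1) .
  then obtain c where c: "\<phi> v base_vec = coord_scale c base_vec"
    unfolding coord.span_singleton by blast
  have "\<phi> w u = coord_scale c u" if w: "w \<in> verts G" and u: "u \<in> space (simple_rep v) w" for w u
  proof (cases "w = v")
    case True
    then have "u \<in> coord.span {base_vec}"
      using u by (simp add: space_simple_rep(1))
    then obtain d where d: "u = coord_scale d base_vec"
      unfolding coord.span_singleton by blast
    show ?thesis
      unfolding True d lin(4)[OF v v b] c by (simp only: coord.scale_scale mult.commute)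
  next
    case False
    then have "u = 0"
      using u unfolding space_simple_rep(2)[OF False] by blast
    then show ?thesis
      using lin(5)[OF w w] by (simp only: coord.scale_zero_right)
  qed
  then show "\<exists>c. \<forall>w\<in>verts G. \<forall>u\<in>space (simple_rep v) w. \<phi> w u = coord_scale c u"
    by blast
qed

lemma letter_root_Cons: "letter_root G (x # A) v = simple_reflection G x (letter_root G A v)"
  by (simp add: letter_root_def weyl_word_append)

text \<open>Each negative step preserves finite dimension and bricks, acts on the dimension vector
  as a simple reflection, and is undone by the positive functor up to the unit. So the functors of
  \<open>A\<close> lead back to the simple representation at \<open>v\<close>.\<close>

lemma is_letter_rep_properties:
  fixes G :: "('v, 'e) pre_digraph" and X :: "('v, 'e, 'k::field) quiver_rep"
  assumes "is_letter_rep G A v X" "graded_quiver G" "admissible G (A @ [v])"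
  shows "is_rep G X \<and> brick G X \<and>
    (\<forall>w. Poly_Mapping.lookup (letter_root G A v) w =
      (if w \<in> verts G then int (coord.dim (space X w)) else 0)) \<and>
    (\<forall>w \<in> verts G. space (seq_functor G A X) w = {0} \<longleftrightarrow> w \<noteq> v)"
  using assms
proof (induction rule: is_letter_rep.induct)
  case (Nil G v)
  then have v: "v \<in> verts G"
    by (simp add: sink_iff)
  let ?L = "simple_rep v :: ('v, 'e, 'k) quiver_rep"
  have "base_vec \<in> space ?L v"
    unfolding space_simple_rep(1) by (rule coord.span_base) simp
  then have nonzero: "space ?L v \<noteq> {0}"
    by (metis base_vec_nonzero singletonD)
  have "Poly_Mapping.lookup (letter_root G [] v) w =
      (if w \<in> verts G then int (coord.dim (space ?L w)) else 0)" for w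
    unfolding dim_simple_rep using v by (auto simp: letter_root_def)
  moreover have "space ?L w = {0} \<longleftrightarrow> w \<noteq> v" for w
    by (cases "w = v") (simp_all only: nonzero space_simple_rep(2) simp_thms)
  moreover have "is_rep G ?L" "brick G ?L"
    using brick_simple_rep[OF v] by (blast intro: is_rep_simple_rep)+
  ultimately show ?case
    unfolding seq_functor.simps(1) by blast
next
  case (Cons x G A v Y)
  interpret sink_reflection G x
    using Cons.prems by unfold_locales simp_all
  have adm: "admissible H (A @ [v])"
    using Cons.prems by simp
  have IH: "is_rep H Y" "brick H Y"
    "\<And>w. Poly_Mapping.lookup (letter_root G A v) w = (if w \<in> verts G then int (coord.dim (space Y w)) else 0)"
    "\<And>w. w \<in> verts G \<Longrightarrow> space (seq_functor H A Y) w = {0} \<longleftrightarrow> w \<noteq> v"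
    using Cons.IH[OF graded_quiver_reverse_at[OF graded sink] adm]
    unfolding letter_root_reverse_at verts_reverse_at by blast+
  note Y = is_rep_imp_lin_rep[OF IH(1)]
  have "Poly_Mapping.lookup (letter_root G (x # A) v) w =
      (if w \<in> verts G then int (coord.dim (space (inverse_reflection G x Y) w)) else 0)" for w
  proof (cases "w = x")
    case True
    have "(\<Sum>a\<in>in_arcs G x. Poly_Mapping.lookup (letter_root G A v) (tail G a)) =
        (\<Sum>a\<in>in_arcs G x. int (coord.dim (space Y (tail G a))))"
      by (rule sum.cong[OF refl]) (simp only: IH(3) in_arc(4) if_True)
    also have "\<dots> = int (\<Sum>a\<in>in_arcs G x. coord.dim (space Y (tail G a)))"
      by simp
    also have "\<dots> = int (coord.dim (space (inverse_reflection G x Y) x)) + int (coord.dim (space Y x))"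
      unfolding dim_inverse[OF IH(1) Cons.hyps(2), symmetric] by simp
    finally show ?thesis
      unfolding letter_root_Cons lookup_simple_reflection using True IH(3)[of x] x_vert by simp
  next
    case False
    then show ?thesis
      unfolding letter_root_Cons lookup_simple_reflection using IH(3)[of w] by (simp add: space_inverse_other)
  qed
  moreover have "space (seq_functor G (x # A) (inverse_reflection G x Y)) w = {0} \<longleftrightarrow> w \<noteq> v"
    if "w \<in> verts G" for w
    unfolding seq_functor.simps(2)
    using seq_functor_inverse_zero_iff[OF Y Cons.hyps(2) _ that, of A] adm IH(4)[OF that]
    by (simp only: admissible_append)
  ultimately show ?case
    using inverse_is_rep[OF IH(1)] brick_inverse[OF Y Cons.hyps(2) IH(2)] by blast
qed

text \<open>At the end of \<open>A\<close>, a nonzero vector at \<open>v\<close> is a nonzero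
  morphism from the simple representation, which is then lifted backwards through \<open>A\<close>.
  The lifting never stops: a refused \<open>Y\<close> would vanish off \<open>x\<close>, while the
  morphism is nonzero there. So existence of the letter representation is part of the
  conclusion.\<close>

lemma letter_rep_hom:
  fixes G :: "('v, 'e) pre_digraph" and M :: "('v, 'e, 'k::field) quiver_rep"
  assumes "graded_quiver G" "admissible G (A @ [v])" "lin_rep G M"
    and "space (seq_functor G A M) v \<noteq> {0}"
  shows "\<exists>X \<psi> w u. is_letter_rep G A v X \<and> rep_hom G X M \<psi> \<and> w \<in> verts G \<and> u \<in> space X w \<and> \<psi> w u \<noteq> 0"
  using assms
proof (induction A arbitrary: G M)
  case Nil
  then have v: "v \<in> verts G" "\<And>a. a \<in> arcs G \<Longrightarrow> tail G a \<noteq> v"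
    by (simp_all add: sink_iff)
  note sub = lin_rep_subspace[OF Nil.prems(3)]
  obtain u0 where u0: "u0 \<in> space M v" "u0 \<noteq> 0"
    using Nil.prems(4) coord.subspace_0[OF sub[OF v(1)]] unfolding seq_functor.simps(1) by blast
  \<comment> \<open>On the line of \<open>base_vec\<close> the coordinate \<open>([], 0)\<close> is
    the coefficient, so \<open>base_vec\<close> goes to \<open>u0\<close>.\<close>
  define \<psi> :: "'v \<Rightarrow> ('e, 'k) coord_vec \<Rightarrow> ('e, 'k) coord_vec" where "\<psi> = (\<lambda>w. if w = v then (\<lambda>u. coord_scale (u ([], 0)) u0) else (\<lambda>u. 0))"
  have \<psi>_lin: "coord_linear (\<lambda>u :: ('e, 'k) coord_vec. coord_scale (u ([], 0)) u0)"
    by (rule coord_linearI) (simp_all add: coord.scale_left_distrib, simp add: coord_scale_def mult.assoc)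
  have \<psi>0: "\<psi> w 0 = 0" for w
    using coord_linearD(4)[OF \<psi>_lin] by (cases "w = v") (simp_all only: \<psi>_def if_True if_False simp_thms)
  have "rep_hom G (simple_rep v) M \<psi>"
    unfolding rep_hom_def
  proof (intro conjI ballI)
    fix w assume w: "w \<in> verts G"
    show "linear_between (space (simple_rep v) w) (space M w) (\<psi> w)"
    proof (cases "w = v")
      case True
      then show ?thesis
        using linear_between_coord_linear[OF \<psi>_lin, of _ "space M v"] coord.subspace_scale[OF sub[OF v(1)] u0(1)]
        by (simp only: \<psi>_def if_True simp_thms)
    next
      case False
      then show ?thesis
        using linear_between_zero[OF sub[OF w]] by (simp only: \<psi>_def if_False)
    qed
  next
    fix a u assume a: "a \<in> arcs G"
    have "\<psi> (tail G a) u = 0"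
      using v(2)[OF a] by (simp only: \<psi>_def if_False)
    then show "\<psi> (head G a) (arrow_map (simple_rep v) a u) = arrow_map M a (\<psi> (tail G a) u)"
      using linear_betweenD(5)[OF lin_rep_arrow[OF Nil.prems(3) a] sub[OF graded_quiver_ends(1)[OF Nil.prems(1) a]]]
      by (simp only: arrow_simple_rep \<psi>0)
  qed
  moreover have "base_vec \<in> space (simple_rep v :: ('v, 'e, 'k) quiver_rep) v"
    unfolding space_simple_rep(1) by (rule coord.span_base) simp
  moreover have "\<psi> v base_vec \<noteq> 0"
  proof -
    have "\<psi> v base_vec = coord_scale 1 u0"
      by (simp add: \<psi>_def base_vec_def)
    then show ?thesis
      using u0(2) by (simp only: coord.scale_one not_False_eq_True)
  qed
  ultimately show ?case
    using v(1) by (blast intro: is_letter_rep.Nil)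
next
  case (Cons x A)
  interpret sink_reflection G x
    using Cons.prems by unfold_locales simp_all
  note H = graded_quiver_reverse_at[OF graded sink]
  have adm: "admissible H (A @ [v])"
    using Cons.prems by simp
  obtain Y \<phi> w u where Y: "is_letter_rep H A v Y" "rep_hom H Y (reflection_functor G x M) \<phi>"
    and wu: "w \<in> verts G" "u \<in> space Y w" "\<phi> w u \<noteq> 0"
    using Cons.IH[OF H adm reflection_lin_rep[OF Cons.prems(3)]] Cons.prems(4)
    unfolding seq_functor.simps(2) verts_reverse_at by blast
  have props: "is_rep H Y" "brick H Y"
    using is_letter_rep_properties[OF Y(1) H adm] by blast+
  note Y' = is_rep_imp_lin_rep[OF props(1)]
  obtain w' u' where wu': "w' \<in> verts G" "w' \<noteq> x" "u' \<in> space Y w'" "\<phi> w' u' \<noteq> 0"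
    by (rule hom_nonzero_off_sink[OF Y' Cons.prems(3) Y(2) wu(2,1,3)])
  have inj: "source_injective G x Y"
  proof (rule ccontr)
    assume "\<not> source_injective G x Y"
    then have "space Y w' = {0}"
      using brick_not_source_injective[OF Y' props(2)] wu'(1,2) by metis
    then have "u' = 0"
      using wu'(3) by blast
    moreover have "\<phi> w' 0 = 0"
      using linear_betweenD(5)[OF rep_hom_linear[OF Y(2)] source_space[OF Y']] wu'(1) by simp
    ultimately show False
      using wu'(4) by blast
  qed
  obtain \<psi> where \<psi>: "rep_hom G (inverse_reflection G x Y) M \<psi>" "\<And>v. v \<noteq> x \<Longrightarrow> \<psi> v = \<phi> v"
    by (rule lift_hom[OF Y' Cons.prems(3) Y(2)]) (assumption | rule that | blast)+
  have "u' \<in> space (inverse_reflection G x Y) w'"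
    using wu'(2,3) by (simp add: space_inverse_other)
  moreover have "\<psi> w' u' \<noteq> 0"
    using wu'(4) \<psi>(2)[OF wu'(2)] by (simp only: not_False_eq_True)
  ultimately show ?case
    using is_letter_rep.Cons[OF Y(1) inj] \<psi>(1) wu'(1) by blast
qed

text \<open>Were a step refused, \<open>Y\<close> would be one-dimensional and live at
  \<open>x\<close> only. Reflecting its dimension vector gives the coefficient -1 at
  \<open>x\<close>, but the root of a letter of a reduced word is nonnegative.\<close>

lemma letter_rep_if_reduced:
  assumes "graded_quiver G" "admissible G (A @ [v])" "reduced_word G (A @ [v])"
  shows "\<exists>X :: ('v, 'e, 'k::field) quiver_rep. is_letter_rep (G :: ('v, 'e) pre_digraph) A v X"
  using assms
proof (induction A arbitrary: G)
  case Nil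
  show ?case
    by (rule exI) (rule is_letter_rep.Nil)
next
  case (Cons x A)
  interpret sink_reflection G x
    using Cons.prems by unfold_locales simp_all
  note H = graded_quiver_reverse_at[OF graded sink]
  have adm: "admissible H (A @ [v])"
    using Cons.prems by simp
  have verts: "set ([x] @ (A @ [v])) \<subseteq> verts G"
    using admissible_verts[OF Cons.prems(2)] by simp
  have "reduced_word G (A @ [v])"
    using reduced_word_append(2)[of G "[x]" "A @ [v]"] Cons.prems(3) verts by simp
  then obtain Y :: "('v, 'e, 'k) quiver_rep" where Y: "is_letter_rep H A v Y"
    using Cons.IH[OF H adm] by auto
  have props: "is_rep H Y" "brick H Y"
    "\<And>w. Poly_Mapping.lookup (letter_root G A v) w = (if w \<in> verts G then int (coord.dim (space Y w)) else 0)"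
    using is_letter_rep_properties[OF Y H adm] by simp_all
  have "source_injective G x Y"
  proof (rule ccontr)
    assume not_inj: "\<not> source_injective G x Y"
    obtain u0 where u0: "u0 \<noteq> 0" "space Y x = coord.span {u0}"
      "\<And>v. v \<in> verts G \<Longrightarrow> v \<noteq> x \<Longrightarrow> space Y v = {0}"
      using brick_not_source_injective[OF is_rep_imp_lin_rep[OF props(1)] props(2) not_inj] by metis
    have "coord.independent {u0}"
      using u0(1) by (simp only: coord.dependent_single not_False_eq_True)
    then have "coord.dim (space Y x) = 1"
      unfolding u0(2) by (simp add: coord.dim_eq_card_independent)
    then have "Poly_Mapping.lookup (letter_root G A v) x = 1"
      using props(3)[of x] x_vert by simp
    moreover have "(\<Sum>a\<in>in_arcs G x. Poly_Mapping.lookup (letter_root G A v) (tail G a)) = 0"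
    proof (rule sum.neutral, rule ballI)
      fix a assume a: "a \<in> in_arcs G x"
      show "Poly_Mapping.lookup (letter_root G A v) (tail G a) = 0"
        unfolding props(3) u0(3)[OF in_arc(4)[OF a] in_arc(3)[OF a]] coord_dim_zero by simp
    qed
    ultimately have "Poly_Mapping.lookup (letter_root G (x # A) v) x = -1"
      unfolding letter_root_Cons lookup_simple_reflection by simp
    moreover have "root_nonneg (letter_root G (x # A) v)"
      using Cons.prems(3) verts by (intro letter_root_nonneg_if_reduced) simp_all
    then have "0 \<le> Poly_Mapping.lookup (letter_root G (x # A) v) x"
      by (rule spec)
    ultimately show False
      by simp
  qed
  then show ?case
    using is_letter_rep.Cons[OF Y] by blast
qed

section \<open>Direct sums\<close>

definition direct_sum :: "nat \<Rightarrow> (nat \<Rightarrow> ('v, 'e, 'k::field) quiver_rep) \<Rightarrow> ('v, 'e, 'k) quiver_rep" where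
  "direct_sum n X = \<lparr>space = (\<lambda>v. copy_coproduct.dsum {..<n} (\<lambda>i. space (X i) v)),
     arrow_map = (\<lambda>a u. \<Sum>i<n. copy_inj i (arrow_map (X i) a (copy_proj i u)))\<rparr>"

lemma space_direct_sum: "space (direct_sum n X) v = copy_coproduct.dsum {..<n} (\<lambda>i. space (X i) v)"
  and arrow_direct_sum: "arrow_map (direct_sum n X) a u = (\<Sum>i<n. copy_inj i (arrow_map (X i) a (copy_proj i u)))"
  by (simp_all add: direct_sum_def)

lemma direct_sum_properties:
  fixes X :: "nat \<Rightarrow> ('v, 'e, 'k::field) quiver_rep"
  assumes G: "graded_quiver G" and X: "\<And>i. i < n \<Longrightarrow> is_rep G (X i)"
  shows "is_rep G (direct_sum n X)"
    and "i < n \<Longrightarrow> rep_hom G (direct_sum n X) (X i) (\<lambda>v. copy_proj i)"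
    and "i < n \<Longrightarrow> rep_hom G (X i) (direct_sum n X) (\<lambda>v. copy_inj i)"
    and "jointly_injective G (direct_sum n X) {..<n} (\<lambda>i v. copy_proj i)"
proof -
  note ends = graded_quiver_ends[OF G]
  have fin: "findim_subspace (space (X i) v)" if "i \<in> {..<n}" "v \<in> verts G" for i v
    using X[of i] that by (simp add: is_rep_def)
  note sub = findim_subspace_imp_subspace[OF fin]
  have arrow: "linear_between (space (X i) (tail G a)) (space (X i) (head G a)) (arrow_map (X i) a)"
    if "i \<in> {..<n}" "a \<in> arcs G" for i a
    using X[of i] that by (simp add: is_rep_def)
  note lin = linear_betweenD[OF arrow sub[OF _ ends(1)]]
  note cinj = coord_linearD[OF copy_coproduct.linear_inj]
  have proj_in: "copy_proj i u \<in> space (X i) v" if "u \<in> space (direct_sum n X) v" "i \<in> {..<n}" for i u v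
    using that(1)[unfolded space_direct_sum] that(2) by (rule copy_coproduct.dsum_proj)
  have proj_arrow: "copy_proj i (arrow_map (direct_sum n X) a u) = arrow_map (X i) a (copy_proj i u)"
    if "i \<in> {..<n}" for i a u
    unfolding arrow_direct_sum copy_coproduct.proj_sum[OF finite_lessThan] using that by (simp only: if_True)
  show "is_rep G (direct_sum n X)"
    unfolding is_rep_def
  proof (intro conjI ballI)
    show "findim_subspace (space (direct_sum n X) v)" if "v \<in> verts G" for v
      unfolding space_direct_sum
      using copy_coproduct.findim_dsum(1)[where V = "\<lambda>i. space (X i) v", OF finite_lessThan fin[OF _ that]] .
    fix a assume a: "a \<in> arcs G"
    show "linear_between (space (direct_sum n X) (tail G a)) (space (direct_sum n X) (head G a))
        (arrow_map (direct_sum n X) a)"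
      unfolding space_direct_sum arrow_direct_sum[abs_def]
    proof (rule linear_between_sum)
      show "coord.subspace (copy_coproduct.dsum {..<n} (\<lambda>i. space (X i) (head G a)))"
        by (rule copy_coproduct.subspace_dsum) (rule sub[OF _ ends(2)[OF a]])
      fix i assume i: "i \<in> {..<n}"
      show "linear_between (copy_coproduct.dsum {..<n} (\<lambda>i. space (X i) (tail G a)))
          (copy_coproduct.dsum {..<n} (\<lambda>i. space (X i) (head G a)))
          (\<lambda>u. copy_inj i (arrow_map (X i) a (copy_proj i u)))"
        using linear_between_compose[OF linear_between_compose[OF
            copy_coproduct.linear_between_proj[where V = "\<lambda>i. space (X i) (tail G a)", OF i] arrow[OF i a]]
            copy_coproduct.linear_between_inj[where V = "\<lambda>i. space (X i) (head G a)",
              OF finite_lessThan i sub[OF _ ends(2)[OF a]]]] .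
    qed
  qed
  show "rep_hom G (direct_sum n X) (X i) (\<lambda>v. copy_proj i)" if "i < n"
    unfolding rep_hom_def
  proof (intro conjI ballI)
    fix v
    show "linear_between (space (direct_sum n X) v) (space (X i) v) (copy_proj i)"
      by (rule linear_between_coord_linear[OF copy_coproduct.linear_proj]) (rule proj_in, use that in simp_all)
  next
    fix a u
    show "copy_proj i (arrow_map (direct_sum n X) a u) = arrow_map (X i) a (copy_proj i u)"
      by (rule proj_arrow) (use that in simp)
  qed
  show "rep_hom G (X i) (direct_sum n X) (\<lambda>v. copy_inj i)" if i: "i < n"
    unfolding rep_hom_def
  proof (intro conjI ballI)
    fix v assume v: "v \<in> verts G"
    show "linear_between (space (X i) v) (space (direct_sum n X) v) (copy_inj i)"
      unfolding space_direct_sum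
      using copy_coproduct.linear_between_inj[where V = "\<lambda>i. space (X i) v", OF finite_lessThan _ sub[OF _ v], of i]
        i by simp
  next
    fix a u assume a: "a \<in> arcs G" and u: "u \<in> space (X i) (tail G a)"
    have "arrow_map (direct_sum n X) a (copy_inj i u) =
        (\<Sum>j<n. if j = i then copy_inj i (arrow_map (X i) a u) else 0)"
      unfolding arrow_direct_sum
    proof (rule sum.cong[OF refl])
      fix j assume j: "j \<in> {..<n}"
      show "copy_inj j (arrow_map (X j) a (copy_proj j (copy_inj i u))) =
          (if j = i then copy_inj i (arrow_map (X i) a u) else 0)"
        using lin(5)[OF j a j a] cinj(4)
        by (cases "j = i") (simp_all only: copy_coproduct.proj_inj if_True if_False simp_thms)
    qed
    also have "\<dots> = copy_inj i (arrow_map (X i) a u)"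
      using i by (simp only: sum.delta[OF finite_lessThan] lessThan_iff if_True)
    finally show "copy_inj i (arrow_map (X i) a u) = arrow_map (direct_sum n X) a (copy_inj i u)"
      by (rule sym)
  qed
  show "jointly_injective G (direct_sum n X) {..<n} (\<lambda>i v. copy_proj i)"
    unfolding jointly_injective_def
  proof (intro ballI impI)
    fix v u assume u: "u \<in> space (direct_sum n X) v" and zero: "\<forall>i\<in>{..<n}. copy_proj i u = 0"
    have "u = (\<Sum>i<n. copy_inj i (copy_proj i u))"
      using u[unfolded space_direct_sum] by (rule copy_coproduct.dsum_expand)
    also have "\<dots> = (\<Sum>i<n. 0)"
      by (rule sum.cong[OF refl]) (simp only: zero[rule_format] cinj(4))
    finally show "u = 0"
      by simp
  qed
qed

section \<open>Shortest annihilating sequences and reduced words\<close>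

lemma annihilates_iff:
  "annihilates G S M \<longleftrightarrow> (\<forall>v \<in> verts G. space (seq_functor G S M) v = {0})"
  by (simp only: annihilates_def zero_rep_def verts_reverse_along)

text \<open>If \<open>M\<close> lives only at the sink, the incoming sum is zero and so is the
  kernel inside it.\<close>

lemma (in sink_reflection) reflection_zero:
  assumes M: "lin_rep G M" and zero: "\<And>w. w \<in> verts G \<Longrightarrow> w \<noteq> x \<Longrightarrow> space M w = {0}" and v: "v \<in> verts G"
  shows "space (reflection_functor G x M) v = {0}"
proof -
  have "u = 0" if u: "u \<in> space (reflection_functor G x M) v" for u
  proof (cases "v = x")
    case True
    then have ux: "u \<in> source_sum M"
      using u by (simp add: space_reflection)
    then show ?thesis
    proof (rule source_sum_zeroI)
      fix a assume a: "a \<in> in_arcs G x"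
      have "arc_component a u \<in> space M (tail G a)"
        using ux a by (rule component_in)
      then show "arc_component a u = 0"
        unfolding zero[OF in_arc(4)[OF a] in_arc(3)[OF a]] by (rule singletonD)
    qed
  next
    case False
    then have "u \<in> space M v"
      using u by (simp add: space_reflection)
    then show ?thesis
      unfolding zero[OF v False] by (rule singletonD)
  qed
  moreover have "0 \<in> space (reflection_functor G x M) v"
    using lin_rep_subspace[OF reflection_lin_rep[OF M], of v] v by (simp add: coord.subspace_0)
  ultimately show ?thesis
    by blast
qed

lemma seq_functor_append_zero:
  assumes "graded_quiver G" "admissible G (S @ U)" "lin_rep G M" "annihilates G S M"
  shows "annihilates G (S @ U) M"
  unfolding annihilates_iff seq_functor_append
proof
  fix v assume v: "v \<in> verts G"
  have S: "admissible G S" "admissible (reverse_along S G) U"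
    using assms(2) by (simp_all add: admissible_append)
  show "space (seq_functor (reverse_along S G) U (seq_functor G S M)) v = {0}"
    by (rule seq_functor_zero[OF graded_quiver_reverse_along[OF assms(1) S(1)] S(2)
        seq_functor_lin_rep[OF assms(1) S(1) assms(3)]])
      (use assms(4) v in \<open>simp_all only: annihilates_iff verts_reverse_along\<close>)
qed

lemma letter_rep_annihilated:
  assumes X: "is_letter_rep G A v X" and G: "graded_quiver G" and adm: "admissible G (A @ [v] @ B)"
  shows "annihilates G (A @ [v] @ B) X"
proof -
  have adm': "admissible G ((A @ [v]) @ B)" "admissible G (A @ [v])" "admissible G A" "sink (reverse_along A G) v"
    using adm by (simp_all add: admissible_append)
  note props = is_letter_rep_properties[OF X G adm'(2)]
  have X': "lin_rep G X"
    using props is_rep_imp_lin_rep by blast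
  interpret sink_reflection "reverse_along A G" v
    by unfold_locales (use graded_quiver_reverse_along[OF G adm'(3)] adm'(4) in simp_all)
  have "space (reflection_functor (reverse_along A G) v (seq_functor G A X)) w = {0}"
    if "w \<in> verts G" for w
  proof (rule reflection_zero)
    show "lin_rep (reverse_along A G) (seq_functor G A X)"
      by (rule seq_functor_lin_rep[OF G adm'(3) X'])
    show "w \<in> verts (reverse_along A G)"
      using that by simp
    show "space (seq_functor G A X) u = {0}" if "u \<in> verts (reverse_along A G)" "u \<noteq> v" for u
      using props that unfolding verts_reverse_along by blast
  qed
  then have "annihilates G (A @ [v]) X"
    unfolding annihilates_iff seq_functor_append seq_functor.simps by blast
  then show ?thesis
    using seq_functor_append_zero[OF G adm'(1) X'] by simp
qed

text \<open>After \<open>A\<close> the space at \<open>v\<close> is nonzero, and only a further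
  letter \<open>v\<close> could change it.\<close>

lemma letter_rep_not_annihilated:
  assumes X: "is_letter_rep G A v X" and G: "graded_quiver G" and adm: "admissible G (A @ [v])"
    and B: "v \<notin> set B"
  shows "\<not> annihilates G (A @ B) X"
proof
  assume "annihilates G (A @ B) X"
  moreover have v: "v \<in> verts G"
    using admissible_verts[OF adm] by simp
  ultimately have "space (seq_functor G A X) v = {0}"
    using seq_functor_other_vertex[OF B] unfolding annihilates_iff seq_functor_append by blast
  then show False
    using is_letter_rep_properties[OF X G adm] v by blast
qed

lemma removable_last_letter:
  assumes G: "graded_quiver G" and S: "admissible G S" and equiv: "seq_equiv G S (T @ [v])"
  obtains A B where "S = A @ [v] @ B" "v \<notin> set B" "seq_equiv G T (A @ B)"
proof -
  have count: "count_list S u = count_list T u + of_bool (u = v)" for u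
    using fun_cong[OF seq_equiv_count[OF equiv], of u] by simp
  have "v \<in> set S"
    using count[of v] count_list_0_iff[of S v] by auto
  then obtain A B where AB: "S = A @ v # B" "v \<notin> set B"
    by (metis split_list_last)
  have adm: "admissible G (A @ [v])" "admissible G A" "admissible (reverse_along A G) (v # B)"
    using S AB(1) by (simp_all add: admissible_append)
  have T: "admissible G (T @ [v])" "admissible G T"
    using equiv by (simp_all add: seq_equiv_def admissible_append)
  have count_v: "count_list A v = count_list T v"
    using count[of v] AB by (simp add: count_list_0_iff)
  have "b \<noteq> v \<and> edges_between G b v = {}" if b: "b \<in> set B" for b
  proof (rule ccontr)
    assume "\<not> (b \<noteq> v \<and> edges_between G b v = {})"
    then have "b \<noteq> v" "edges_between G b v \<noteq> {}"
      using AB(2) b by blast+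
    then have "count_list A b = count_list T b"
      using neighbour_count_eq[OF G adm(1) T(1) count_v] by blast
    then have "count_list B b = 0"
      using count[of b] \<open>b \<noteq> v\<close> AB(1) by simp
    then show False
      using b by (simp add: count_list_0_iff)
  qed
  then have "seq_equiv (reverse_along A G) (v # B) (B @ [v])"
    using adm(3) by (intro bubble_back) simp_all
  then have AB_adm: "admissible G (A @ B)"
    using adm(2) by (simp add: seq_equiv_def admissible_append)
  have "count_list T u = count_list (A @ B) u" for u
    using count[of u] AB(1) by (simp split: if_splits)
  then have "seq_equiv G T (A @ B)"
    unfolding seq_equiv_iff_count[OF T(2) AB_adm] by (rule ext)
  then show thesis
    using that AB by simp
qed

lemma annihilates_seq_equiv: "seq_equiv G S T \<Longrightarrow> annihilates G S M \<longleftrightarrow> annihilates G T M"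
  by (simp only: annihilates_iff seq_equiv_seq_functor)

lemma annihilates_embedded:
  assumes "graded_quiver G" "admissible G S" "lin_rep G M" "lin_rep G N" "rep_hom G M N \<phi>"
    and "\<And>v u. v \<in> verts G \<Longrightarrow> u \<in> space M v \<Longrightarrow> \<phi> v u = 0 \<Longrightarrow> u = 0" "annihilates G S N"
  shows "annihilates G S M"
  unfolding annihilates_iff
proof
  fix v assume v: "v \<in> verts G"
  then have "space (seq_functor G S N) v = {0}"
    using assms(7) unfolding annihilates_iff by blast
  with v show "space (seq_functor G S M) v = {0}"
    by (rule seq_functor_zero_if_embedded[OF assms(1-5), rotated]) (rule assms(6))
qed

text \<open>The module is the direct sum of the letter representations. Its projections show that
  \<open>S\<close> annihilates it, its inclusions that nothing smaller does.\<close>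

lemma shortest_annihilating_if_reduced:
  assumes G: "graded_quiver G" and S: "admissible G S" and red: "reduced_word G S"
  shows "\<exists>M :: ('v, 'e, 'k::field) quiver_rep. preprojective (G :: ('v, 'e) pre_digraph) M \<and> shortest_annihilating G M S"
proof -
  define n where "n = length S"
  have split: "S = take i S @ [S ! i] @ drop (Suc i) S" if "i < n" for i
    using that by (simp add: n_def id_take_nth_drop)
  have "\<exists>X :: ('v, 'e, 'k) quiver_rep. is_letter_rep G (take i S) (S ! i) X" if i: "i < n" for i
  proof (rule letter_rep_if_reduced[OF G])
    have "take i S @ [S ! i] = take (Suc i) S"
      using i by (simp add: n_def take_Suc_conv_app_nth)
    moreover have "S = take (Suc i) S @ drop (Suc i) S"
      by simp
    ultimately have S_eq: "S = (take i S @ [S ! i]) @ drop (Suc i) S"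
      by simp
    show "admissible G (take i S @ [S ! i])"
      using S by (subst (asm) S_eq) (simp only: admissible_append)
    show "reduced_word G (take i S @ [S ! i])"
      using reduced_word_append(1) red admissible_verts[OF S] S_eq by metis
  qed
  then obtain X :: "nat \<Rightarrow> ('v, 'e, 'k) quiver_rep"
    where X: "\<And>i. i < n \<Longrightarrow> is_letter_rep G (take i S) (S ! i) (X i)"
    by metis
  have adm: "admissible G (take i S @ [S ! i])" "admissible G (take i S @ [S ! i] @ drop (Suc i) S)" if "i < n" for i
    using S split[OF that] by (metis admissible_append append.assoc)+
  have X_rep: "is_rep G (X i)" if "i < n" for i
    using is_letter_rep_properties[OF X[OF that] G adm(1)[OF that]] by blast
  let ?M = "direct_sum n X"
  have M: "is_rep G ?M"
    and proj: "\<And>i. i < n \<Longrightarrow> rep_hom G ?M (X i) (\<lambda>v. copy_proj i)"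
    and inj: "\<And>i. i < n \<Longrightarrow> rep_hom G (X i) ?M (\<lambda>v. copy_inj i)"
    and joint: "jointly_injective G ?M {..<n} (\<lambda>i v. copy_proj i)"
    using direct_sum_properties[of G n X, OF G X_rep] by blast+
  note M' = is_rep_imp_lin_rep[OF M]
  have ann: "annihilates G S ?M"
    unfolding annihilates_iff
  proof
    fix v assume v: "v \<in> verts G"
    show "space (seq_functor G S ?M) v = {0}"
    proof (rule seq_functor_zero_if_jointly_injective[OF G S M' _ _ joint v])
      fix i assume "i \<in> {..<n}"
      then have i: "i < n"
        by simp
      show "lin_rep G (X i)"
        by (rule is_rep_imp_lin_rep[OF X_rep[OF i]])
      show "rep_hom G ?M (X i) (\<lambda>v. copy_proj i)"
        using i by (rule proj)
      show "space (seq_functor G S (X i)) v = {0}"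
        using letter_rep_annihilated[OF X[OF i] G adm(2)[OF i]] v
        unfolding split[OF i, symmetric] annihilates_iff by blast
    qed
  qed
  have "\<not> annihilates G S' ?M" if sub: "subsequence G S' S" and neq: "\<not> seq_equiv G S' S" for S'
  proof
    assume S'_ann: "annihilates G S' ?M"
    have S': "admissible G S'" "\<And>v. count_list S' v \<le> count_list S v"
      using sub by (simp_all add: subsequence_iff_count)
    \<comment> \<open>Enlarging \<open>S'\<close> keeps it annihilating, so it is enough to refute
      sequences with a single letter less than \<open>S\<close>. The summand of the omitted letter
      survives such a sequence.\<close>
    then obtain U where U: "seq_equiv G S (S' @ U)"
      using extend_to_larger_count[OF S'(1) S] by blast
    then have "U \<noteq> []"
      using neq seq_equiv_sym[OF U] by auto
    then obtain U' v where U': "U = U' @ [v]"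
      by (metis rev_exhaust)
    then have equiv: "seq_equiv G S ((S' @ U') @ [v])"
      using U by simp
    obtain A B where AB: "S = A @ [v] @ B" "v \<notin> set B" "seq_equiv G (S' @ U') (A @ B)"
      using removable_last_letter[OF G S equiv] by blast
    have "admissible G (S' @ U')"
      using AB(3) by (simp add: seq_equiv_def)
    then have "annihilates G (S' @ U') ?M"
      using seq_functor_append_zero[OF G _ M' S'_ann] by blast
    then have AB_ann: "annihilates G (A @ B) ?M"
      using annihilates_seq_equiv[OF AB(3)] by blast
    let ?i = "length A"
    have i: "?i < n" "take ?i S = A" "S ! ?i = v"
      using AB(1) by (simp_all add: n_def)
    have "annihilates G (A @ B) (X ?i)"
    proof (rule annihilates_embedded[OF G _ is_rep_imp_lin_rep[OF X_rep[OF i(1)]] M' inj[OF i(1)] _ AB_ann])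
      show "admissible G (A @ B)"
        using AB(3) by (simp add: seq_equiv_def)
      fix u :: "('e, 'k) coord_vec" assume "copy_inj ?i u = 0"
      then have "copy_proj ?i (copy_inj ?i u) = copy_proj ?i 0"
        by (rule arg_cong)
      then show "u = 0"
        by (simp only: copy_coproduct.proj_inj if_True simp_thms coord_linearD(4)[OF copy_coproduct.linear_proj])
    qed
    moreover have "\<not> annihilates G (A @ B) (X ?i)"
      using letter_rep_not_annihilated[OF _ G _ AB(2)] X[OF i(1)] adm(1)[OF i(1)] unfolding i(2,3) by blast
    ultimately show False
      by blast
  qed
  then have "shortest_annihilating G ?M S"
    using S ann by (simp add: shortest_annihilating_def)
  moreover have "preprojective G ?M"
    using M S ann by (auto simp: preprojective_def)
  ultimately show ?thesis
    by blast
qed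

text \<open>
  If the letter \<open>y\<close> after \<open>A\<close>, \<open>v\<close>, \<open>B\<close> is a neighbour of \<open>v\<close> and \<open>B\<close> avoids \<open>v\<close>, \<open>y\<close>, then a
  representation that the functors of \<open>A\<close>, \<open>v\<close>, \<open>B\<close> turn into the simple representation
  at \<open>y\<close> is not killed at \<open>v\<close> by those of \<open>A\<close>: otherwise the kernel defining the reflection
  at \<open>v\<close> would contain the space at \<open>y\<close>.
\<close>

lemma previous_neighbour_nonzero:
  assumes G: "graded_quiver G" and adm: "admissible G (A @ v # B)" and X: "lin_rep G X"
    and y: "edges_between G y v \<noteq> {}" "y \<noteq> v" and B: "v \<notin> set B" "y \<notin> set B"
    and zero_v: "space (seq_functor G (A @ v # B) X) v = {0}"
    and nonzero_y: "space (seq_functor G (A @ v # B) X) y \<noteq> {0}"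
  shows "space (seq_functor G A X) v \<noteq> {0}"
proof
  assume N_v: "space (seq_functor G A X) v = {0}"
  have adm': "admissible G A" "sink (reverse_along A G) v"
    using adm by (simp_all add: admissible_append)
  interpret sink_reflection "reverse_along A G" v
    by unfold_locales (use graded_quiver_reverse_along[OF G adm'(1)] adm'(2) in simp_all)
  let ?N = "seq_functor G A X"
  have N: "lin_rep (reverse_along A G) ?N"
    by (rule seq_functor_lin_rep[OF G adm'(1) X])
  have after: "space (seq_functor G (A @ v # B) X) w = space (reflection_functor (reverse_along A G) v ?N) w"
    if "w \<notin> set B" for w
    unfolding seq_functor_append seq_functor.simps using that by (rule seq_functor_other_vertex)
  have y_vert: "y \<in> verts (reverse_along A G)"
    using edges_between_verts(1)[OF G y(1)] by simp
  have "edges_between (reverse_along A G) y v \<noteq> {}"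
    using y(1) by simp
  then obtain a where a': "a \<in> arcs (reverse_along A G)"
    "{tail (reverse_along A G) a, head (reverse_along A G) a} = {y, v}"
    unfolding edges_between_def by blast
  then have a: "a \<in> in_arcs (reverse_along A G) v" "tail (reverse_along A G) a = y"
    using adm'(2) unfolding sink_iff in_arcs_def doubleton_eq_iff by blast+
  have "space ?N y \<noteq> {0}"
    using nonzero_y unfolding after[OF B(2)] using y(2) by (simp only: space_reflection if_False not_False_eq_True)
  then obtain u where u: "u \<in> space ?N y" "u \<noteq> 0"
    using coord.subspace_0[OF lin_rep_subspace[OF N y_vert]] by blast
  have "arc_inj a u \<in> source_sum ?N"
  proof (rule arc_coproduct.inj_in_dsum[where V = "\<lambda>a. space ?N (tail (reverse_along A G) a)", OF finite_in a(1)])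
    show "u \<in> space ?N (tail (reverse_along A G) a)"
      using u(1) a(2) by simp
    show "0 \<in> space ?N (tail (reverse_along A G) b)" if "b \<in> in_arcs (reverse_along A G) v" for b
      by (rule coord.subspace_0[OF lin_rep_subspace[OF N in_arc(4)[OF that]]])
  qed
  moreover from this have "incoming_map (reverse_along A G) v ?N (arc_inj a u) \<in> space ?N v"
    using incoming_map_linear[OF N] unfolding linear_between_def by blast
  then have "incoming_map (reverse_along A G) v ?N (arc_inj a u) = 0"
    unfolding N_v by (rule singletonD)
  ultimately have "arc_inj a u \<in> space (reflection_functor (reverse_along A G) v ?N) v"
    unfolding space_reflection by simp
  then have "arc_inj a u = 0"
    unfolding after[OF B(1), symmetric] zero_v by (rule singletonD)
  then have "arc_component a (arc_inj a u) = arc_component a 0"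
    by (rule arg_cong)
  then have "u = 0"
    by (simp only: arc_coproduct.proj_inj if_True simp_thms coord_linearD(4)[OF arc_coproduct.linear_proj])
  then show False
    using u(2) by blast
qed

text \<open>Between two occurrences of \<open>v\<close> every neighbour must occur, since its
  multiplicity is tied to that of \<open>v\<close> whenever \<open>v\<close> is due. A neighbour
  exists because every vertex meets an arc.\<close>

lemma next_letter_is_neighbour:
  assumes G: "graded_quiver G" and adm: "admissible G (A @ [v] @ B @ [y])"
    and B: "\<And>b. b \<in> set B \<Longrightarrow> b \<noteq> v \<and> edges_between G b v = {}"
    and y: "\<not> (y \<noteq> v \<and> edges_between G y v = {})"
  shows "y \<noteq> v" "edges_between G y v \<noteq> {}"
proof -
  have adm': "admissible G (A @ [v])" "admissible G ((A @ [v] @ B) @ [y])"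
    using adm by (simp_all add: admissible_append)
  show "y \<noteq> v"
  proof
    assume "y = v"
    then have adm2: "admissible G ((A @ [v] @ B) @ [v])"
      using adm'(2) by simp
    have v: "v \<in> verts G"
      using admissible_verts[OF adm'(1)] by simp
    then obtain a where a: "a \<in> arcs G" "tail G a = v \<or> head G a = v"
      using G unfolding graded_quiver_def by blast
    obtain u where u: "edges_between G u v \<noteq> {}" "u = tail G a \<or> u = head G a" "u \<noteq> v"
    proof (cases "tail G a = v")
      case True
      then show thesis
        using that[of "head G a"] a(1) graded_quiver_no_loop[OF G a(1)] by (auto simp: edges_between_def)
    next
      case False
      then show thesis
        using that[of "tail G a"] a by (auto simp: edges_between_def)
    qed
    have "u \<notin> set B" "v \<notin> set B"
      using B u(1) by blast+
    then have "count_list (A @ [v] @ B) u = count_list A u" "count_list (A @ [v] @ B) v = Suc (count_list A v)"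
      using u(3) by (simp_all add: count_list_0_iff[THEN iffD2])
    moreover have "tail G a = v \<and> head G a = u \<or> head G a = v \<and> tail G a = u"
      using a(2) u(2,3) by blast
    ultimately show False
      using sink_reverse_along_count[OF G adm'(1) a(1)] sink_reverse_along_count[OF G adm2 a(1)] by auto
  qed
  then show "edges_between G y v \<noteq> {}"
    using y by blast
qed

text \<open>Induction on the number of later letters. The representation is existentially quantified
  because the step passes from that of the next neighbour to the letter representation of this
  neighbour.\<close>

lemma letter_nonzero:
  assumes G: "graded_quiver (G :: ('v, 'e) pre_digraph)" and M: "lin_rep G (M :: ('v, 'e, 'k::field) quiver_rep)"
    and T: "shortest_annihilating G M T" and split: "T = A @ v # B"
  shows "\<exists>N :: ('v, 'e, 'k) quiver_rep. lin_rep G N \<and> space (seq_functor G A N) v \<noteq> {0}"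
  using split
proof (induction "length B" arbitrary: A v B rule: less_induct)
  case less
  have T_adm: "admissible G T" and T_ann: "annihilates G T M"
    and T_min: "\<And>S'. subsequence G S' T \<Longrightarrow> \<not> seq_equiv G S' T \<Longrightarrow> \<not> annihilates G S' M"
    using T by (simp_all add: shortest_annihilating_def)
  have adm: "admissible G A" "admissible (reverse_along A G) (v # B)"
    using T_adm less.prems by (simp_all add: admissible_append)
  show ?case
  proof (cases "\<forall>b \<in> set B. b \<noteq> v \<and> edges_between G b v = {}")
    \<comment> \<open>No later letter blocks \<open>v\<close>, so it can be moved to the end, and by
      minimality the sequence without it does not annihilate \<open>M\<close>.\<close>
    case True
    have "seq_equiv (reverse_along A G) (v # B) (B @ [v])"
      using adm(2) True by (intro bubble_back) simp_all
    then have equiv: "seq_equiv G T ((A @ B) @ [v])"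
      using seq_equiv_append[OF _ adm(1)] less.prems by simp
    then have AB: "admissible G (A @ B)"
      by (simp add: seq_equiv_def admissible_append)
    have count: "count_list T u = count_list (A @ B) u + of_bool (u = v)" for u
      using fun_cong[OF seq_equiv_count[OF equiv], of u] by simp
    have "subsequence G (A @ B) T"
      using AB T_adm count by (simp add: subsequence_iff_count)
    moreover have "\<not> seq_equiv G (A @ B) T"
    proof
      assume "seq_equiv G (A @ B) T"
      then show False
        using count[of v] fun_cong[OF seq_equiv_count, of G "A @ B" T v] by simp
    qed
    ultimately obtain w where w: "w \<in> verts G" "space (seq_functor G (A @ B) M) w \<noteq> {0}"
      using T_min unfolding annihilates_iff by blast
    have "annihilates G ((A @ B) @ [v]) M"
      using T_ann annihilates_seq_equiv[OF equiv] by blast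
    then have "space (seq_functor (reverse_along (A @ B) G) [v] (seq_functor G (A @ B) M)) w = {0}"
      using w(1) unfolding annihilates_iff seq_functor_append[of G "A @ B"] by blast
    \<comment> \<open>The last reflection changes only the space at \<open>v\<close>, so what it
      kills must sit at \<open>v\<close>; the letters of \<open>B\<close> did not touch that
      space.\<close>
    then have "w = v"
      using w(2) seq_functor_other_vertex[of w "[v]"] by (metis empty_iff list.set(1) set_ConsD)
    then have "space (seq_functor G A M) v \<noteq> {0}"
      using w(2) seq_functor_other_vertex[of v B] True unfolding seq_functor_append by metis
    then show ?thesis
      using M by blast
  next
    \<comment> \<open>With \<open>y\<close> the first later letter that blocks \<open>v\<close>, the
      functors of \<open>A\<close>, \<open>v\<close>, \<open>B1\<close> turn the letter
      representation of \<open>y\<close> into the simple one at \<open>y\<close>.\<close>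
    case False
    then obtain B1 y B2 where B: "B = B1 @ y # B2" "\<not> (y \<noteq> v \<and> edges_between G y v = {})"
      "\<forall>b \<in> set B1. b \<noteq> v \<and> edges_between G b v = {}"
      using split_list_first_prop[of B "\<lambda>b. \<not> (b \<noteq> v \<and> edges_between G b v = {})"] by blast
    have T_eq: "T = (A @ v # B1) @ y # B2"
      using less.prems B(1) by simp
    have adm': "admissible G (A @ [v] @ B1 @ [y])" "admissible G ((A @ v # B1) @ [y])" "admissible G (A @ v # B1)"
      using T_adm T_eq by (simp_all add: admissible_append)
    have y: "y \<noteq> v" "edges_between G y v \<noteq> {}"
      using next_letter_is_neighbour[OF G adm'(1) _ B(2)] B(3) by blast+
    obtain N :: "('v, 'e, 'k) quiver_rep" where N: "lin_rep G N" "space (seq_functor G (A @ v # B1) N) y \<noteq> {0}"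
      using less.hyps[OF _ T_eq] B(1) by auto
    obtain X :: "('v, 'e, 'k) quiver_rep" where X: "is_letter_rep G (A @ v # B1) y X"
      using letter_rep_hom[OF G adm'(2) N] by blast
    note props = is_letter_rep_properties[OF X G adm'(2)]
    have X': "lin_rep G X"
      using props is_rep_imp_lin_rep by blast
    have verts: "v \<in> verts G" "y \<in> verts G"
      using admissible_verts[OF adm'(1)] by simp_all
    have B1: "v \<notin> set B1" "y \<notin> set B1"
      using B(3) y by blast+
    have "space (seq_functor G A X) v \<noteq> {0}"
    proof (rule previous_neighbour_nonzero[OF G adm'(3) X' y(2,1) B1])
      show "space (seq_functor G (A @ v # B1) X) v = {0}"
        using props verts(1) y(1) by blast
      show "space (seq_functor G (A @ v # B1) X) y \<noteq> {0}"
        using props verts(2) by blast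
    qed
    then show ?thesis
      using X' by blast
  qed
qed

text \<open>A letter that sees a nonzero space has a letter representation, whose dimension vector
  is the root of that letter.\<close>

lemma reduced_if_shortest_annihilating:
  assumes G: "graded_quiver (G :: ('v, 'e) pre_digraph)" and M: "is_rep G (M :: ('v, 'e, 'k::field) quiver_rep)"
    and T: "shortest_annihilating G M T"
  shows "reduced_word G T"
proof (rule reduced_if_letter_roots_nonneg)
  have adm: "admissible G T"
    using T by (simp add: shortest_annihilating_def)
  then show "set T \<subseteq> verts G"
    by (rule admissible_verts)
  fix A v B assume T_eq: "T = A @ [v] @ B"
  then have A: "admissible G (A @ [v])"
    using adm by (simp add: admissible_append)
  obtain N :: "('v, 'e, 'k) quiver_rep" where N: "lin_rep G N" "space (seq_functor G A N) v \<noteq> {0}"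
    using letter_nonzero[OF G is_rep_imp_lin_rep[OF M] T, of A v B] T_eq by auto
  obtain X :: "('v, 'e, 'k) quiver_rep" where "is_letter_rep G A v X"
    using letter_rep_hom[OF G A N] by blast
  then show "root_nonneg (letter_root G A v)"
    using is_letter_rep_properties[OF _ G A, of X] by simp
qed

lemma seq_equiv_reduced_word:
  assumes "seq_equiv G S T"
  shows "reduced_word G S \<longleftrightarrow> reduced_word G T"
proof -
  have "length S = length T"
    using assms by (induction rule: seq_equiv_induct) simp
  then show ?thesis
    using seq_equiv_weyl_word[OF assms] by (simp add: reduced_word_def)
qed

theorem theorem4p6:
  fixes G :: "('v, 'e) pre_digraph" and S :: "'v list"
  assumes "acyclic_quiver G"
    and "admissible G S"
  shows "((\<exists>(M :: ('v, 'e, 'k::field) quiver_rep) S\<^sub>M.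
              preprojective G M \<and> shortest_annihilating G M S\<^sub>M \<and> seq_equiv G S S\<^sub>M)
            \<longleftrightarrow> reduced_word G S) \<and>
         (S \<noteq> [] \<longrightarrow>
            (\<exists>Ts. minimal_principal_join_expr G S Ts) \<and>
            (\<forall>Ts. minimal_principal_join_expr G S Ts \<longrightarrow>
               (reduced_word G S \<longleftrightarrow> (\<forall>T \<in> set Ts. reduced_word G T))))"
proof -
  have G: "graded_quiver G"
    using assms(1) by (rule acyclic_quiver_graded)
  have "reduced_word G S"
    if "preprojective G M" "shortest_annihilating G M S\<^sub>M" "seq_equiv G S S\<^sub>M"
    for M :: "('v, 'e, 'k) quiver_rep" and S\<^sub>M
    using reduced_if_shortest_annihilating[OF G _ that(2)] that(1,3)
    by (simp add: preprojective_def seq_equiv_reduced_word)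
  moreover have "\<exists>(M :: ('v, 'e, 'k) quiver_rep) S\<^sub>M.
      preprojective G M \<and> shortest_annihilating G M S\<^sub>M \<and> seq_equiv G S S\<^sub>M"
    if "reduced_word G S"
    using shortest_annihilating_if_reduced[OF G assms(2) that] seq_equiv_refl[OF assms(2)] by blast
  moreover have "\<exists>Ts. minimal_principal_join_expr G S Ts"
    using G assms(2) by (rule minimal_principal_join_expr_exists)
  moreover have "reduced_word G S \<longleftrightarrow> (\<forall>T \<in> set Ts. reduced_word G T)"
    if "minimal_principal_join_expr G S Ts" for Ts
    using that by (intro reduced_word_principal_join[OF G assms(2)]) (simp add: minimal_principal_join_expr_def)
  ultimately show ?thesis
    by blast
qed

end
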